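(* Let $A$ be a unital $C^*$-algebra and $H$ a Hilbert space of dimension $d$ which is large enough to contain strictly a copy of every cyclic representation of $A$, i.e. $d\ge\dim K$ for every cyclic representation of $A$ on a Hilbert space $K$, and, if the supremum $s$ of these dimensions is finite, $d>s$. Let $\xi\in H$ be a unit vector and let $rep_\xi(A:H)=\{\pi\in rep(A:H): \xi\in\pi(1)H\}$ with the subspace topology. Then the map $\theta_\xi: rep_\xi(A:H)\to S(A)$, $\pi\mapsto\langle\pi(-)\xi,\xi\rangle$, is well defined and is a quotient map.
   Context: $rep(A:H)$ denotes the set of all (possibly degenerate) representations of $A$ on $H$, i.e. all $*$-homomorphisms $A\to B(H)$, with the topology of pointwise convergence for the weak operator topology on $B(H)$: $\pi_j\to\pi$ iff $\pi_j(a)\to\pi(a)$ in the weak operator topology for every $a\in A$. $S(A)=\{\varphi\in A^*:\varphi\ge0,\ \|\varphi\|=1\}$ is the state space, with the weak-$*$ topology. *)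

theory Defs
  imports "HOL-Analysis.Analysis"
begin

definition cstar_algebra ::
  "(complex \<Rightarrow> 'a::{real_normed_algebra_1,banach} \<Rightarrow> 'a) \<Rightarrow> ('a \<Rightarrow> 'a) \<Rightarrow> bool" where
  "cstar_algebra cmult star \<longleftrightarrow>
     (\<forall>r x. cmult (complex_of_real r) x = scaleR r x) \<and>
     (\<forall>c x y. cmult c (x + y) = cmult c x + cmult c y) \<and>
     (\<forall>c d x. cmult (c + d) x = cmult c x + cmult d x) \<and>
     (\<forall>c d x. cmult (c * d) x = cmult c (cmult d x)) \<and>
     (\<forall>c x y. cmult c (x * y) = cmult c x * y \<and> cmult c (x * y) = x * cmult c y) \<and>
     (\<forall>c x. norm (cmult c x) = cmod c * norm x) \<and>
     (\<forall>x. star (star x) = x) \<and>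
     (\<forall>x y. star (x + y) = star x + star y) \<and>
     (\<forall>c x. star (cmult c x) = cmult (cnj c) (star x)) \<and>
     (\<forall>x y. star (x * y) = star y * star x) \<and>
     (\<forall>x. norm (star x * x) = norm x ^ 2)"

record 'v hspace =
  hcarrier :: "'v set"
  hadd :: "'v \<Rightarrow> 'v \<Rightarrow> 'v"
  hscale :: "complex \<Rightarrow> 'v \<Rightarrow> 'v"
  hzero :: "'v"
  hinner :: "'v \<Rightarrow> 'v \<Rightarrow> complex"

definition hdiff :: "'v hspace \<Rightarrow> 'v \<Rightarrow> 'v \<Rightarrow> 'v" where
  "hdiff H x y = hadd H x (hscale H (-1) y)"

definition hnorm :: "'v hspace \<Rightarrow> 'v \<Rightarrow> real" where
  "hnorm H x = sqrt (Re (hinner H x x))"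

definition inner_product_space :: "'v hspace \<Rightarrow> bool" where
  "inner_product_space H \<longleftrightarrow>
     hzero H \<in> hcarrier H \<and>
     (\<forall>x\<in>hcarrier H. \<forall>y\<in>hcarrier H. hadd H x y \<in> hcarrier H) \<and>
     (\<forall>c. \<forall>x\<in>hcarrier H. hscale H c x \<in> hcarrier H) \<and>
     (\<forall>x\<in>hcarrier H. \<forall>y\<in>hcarrier H. \<forall>z\<in>hcarrier H.
         hadd H (hadd H x y) z = hadd H x (hadd H y z)) \<and>
     (\<forall>x\<in>hcarrier H. \<forall>y\<in>hcarrier H. hadd H x y = hadd H y x) \<and>
     (\<forall>x\<in>hcarrier H. hadd H (hzero H) x = x) \<and>
     (\<forall>x\<in>hcarrier H. hadd H x (hscale H (-1) x) = hzero H) \<and>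
     (\<forall>c. \<forall>x\<in>hcarrier H. \<forall>y\<in>hcarrier H.
         hscale H c (hadd H x y) = hadd H (hscale H c x) (hscale H c y)) \<and>
     (\<forall>c d. \<forall>x\<in>hcarrier H. hscale H (c + d) x = hadd H (hscale H c x) (hscale H d x)) \<and>
     (\<forall>c d. \<forall>x\<in>hcarrier H. hscale H (c * d) x = hscale H c (hscale H d x)) \<and>
     (\<forall>x\<in>hcarrier H. hscale H 1 x = x) \<and>
     (\<forall>x\<in>hcarrier H. \<forall>y\<in>hcarrier H. \<forall>z\<in>hcarrier H.
         hinner H (hadd H x y) z = hinner H x z + hinner H y z) \<and>
     (\<forall>c. \<forall>x\<in>hcarrier H. \<forall>y\<in>hcarrier H. hinner H (hscale H c x) y = c * hinner H x y) \<and>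
     (\<forall>x\<in>hcarrier H. \<forall>y\<in>hcarrier H. hinner H y x = cnj (hinner H x y)) \<and>
     (\<forall>x\<in>hcarrier H. Im (hinner H x x) = 0 \<and> Re (hinner H x x) \<ge> 0) \<and>
     (\<forall>x\<in>hcarrier H. hinner H x x = 0 \<longrightarrow> x = hzero H)"

definition hilbert_space :: "'v hspace \<Rightarrow> bool" where
  "hilbert_space H \<longleftrightarrow> inner_product_space H \<and>
     (\<forall>s::nat \<Rightarrow> 'v. (\<forall>n. s n \<in> hcarrier H) \<and>
        (\<forall>e>0. \<exists>N. \<forall>m\<ge>N. \<forall>n\<ge>N. hnorm H (hdiff H (s m) (s n)) < e) \<longrightarrow>
        (\<exists>l\<in>hcarrier H. \<forall>e>0. \<exists>N. \<forall>n\<ge>N. hnorm H (hdiff H (s n) l) < e))"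

definition orthonormal_basis :: "'v hspace \<Rightarrow> 'v set \<Rightarrow> bool" where
  "orthonormal_basis H E \<longleftrightarrow> E \<subseteq> hcarrier H \<and>
     (\<forall>e\<in>E. hinner H e e = 1) \<and>
     (\<forall>e\<in>E. \<forall>f\<in>E. e \<noteq> f \<longrightarrow> hinner H e f = 0) \<and>
     (\<forall>x\<in>hcarrier H. (\<forall>e\<in>E. hinner H x e = 0) \<longrightarrow> x = hzero H)"

definition hdim_le :: "'v hspace \<Rightarrow> 'w hspace \<Rightarrow> bool" where
  "hdim_le K H \<longleftrightarrow> (\<exists>E1 E2 g. orthonormal_basis K E1 \<and> orthonormal_basis H E2 \<and>
                        inj_on g E1 \<and> g ` E1 \<subseteq> E2)"

definition hdim_le_nat :: "'v hspace \<Rightarrow> nat \<Rightarrow> bool" where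
  "hdim_le_nat K n \<longleftrightarrow> (\<exists>E. orthonormal_basis K E \<and> finite E \<and> card E \<le> n)"

definition bounded_op :: "'v hspace \<Rightarrow> ('v \<Rightarrow> 'v) \<Rightarrow> bool" where
  "bounded_op H T \<longleftrightarrow>
     (\<forall>x\<in>hcarrier H. T x \<in> hcarrier H) \<and>
     (\<forall>x\<in>hcarrier H. \<forall>y\<in>hcarrier H. T (hadd H x y) = hadd H (T x) (T y)) \<and>
     (\<forall>c. \<forall>x\<in>hcarrier H. T (hscale H c x) = hscale H c (T x)) \<and>
     (\<exists>C. \<forall>x\<in>hcarrier H. hnorm H (T x) \<le> C * hnorm H x) \<and>
     (\<forall>x. x \<notin> hcarrier H \<longrightarrow> T x = hzero H)"

text \<open>Operators are normalised to be hzero off the carrier, so that elements of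
B(H) correspond one-to-one to such functions. A representation is a
(possibly degenerate) *-homomorphism A \<rightarrow> B(H).\<close>

definition is_rep ::
  "(complex \<Rightarrow> 'a::{real_normed_algebra_1,banach} \<Rightarrow> 'a) \<Rightarrow> ('a \<Rightarrow> 'a) \<Rightarrow> 'v hspace
     \<Rightarrow> ('a \<Rightarrow> 'v \<Rightarrow> 'v) \<Rightarrow> bool" where
  "is_rep cmult star H \<pi> \<longleftrightarrow>
     (\<forall>a. bounded_op H (\<pi> a)) \<and>
     (\<forall>a b. \<forall>x\<in>hcarrier H. \<pi> (a + b) x = hadd H (\<pi> a x) (\<pi> b x)) \<and>
     (\<forall>c a. \<forall>x\<in>hcarrier H. \<pi> (cmult c a) x = hscale H c (\<pi> a x)) \<and>
     (\<forall>a b. \<forall>x\<in>hcarrier H. \<pi> (a * b) x = \<pi> a (\<pi> b x)) \<and>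
     (\<forall>a. \<forall>x\<in>hcarrier H. \<forall>y\<in>hcarrier H. hinner H (\<pi> (star a) x) y = hinner H x (\<pi> a y))"

definition reps ::
  "(complex \<Rightarrow> 'a::{real_normed_algebra_1,banach} \<Rightarrow> 'a) \<Rightarrow> ('a \<Rightarrow> 'a) \<Rightarrow> 'v hspace
     \<Rightarrow> ('a \<Rightarrow> 'v \<Rightarrow> 'v) set" where
  "reps cmult star H = {\<pi>. is_rep cmult star H \<pi>}"

definition rep_topology ::
  "(complex \<Rightarrow> 'a::{real_normed_algebra_1,banach} \<Rightarrow> 'a) \<Rightarrow> ('a \<Rightarrow> 'a) \<Rightarrow> 'v hspace
     \<Rightarrow> ('a \<Rightarrow> 'v \<Rightarrow> 'v) topology" where
  "rep_topology cmult star H = topology_generated_by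
     {{\<pi> \<in> reps cmult star H. hinner H (\<pi> a x) y \<in> U} | a x y U.
        x \<in> hcarrier H \<and> y \<in> hcarrier H \<and> open U}"

definition cyclic_rep ::
  "(complex \<Rightarrow> 'a::{real_normed_algebra_1,banach} \<Rightarrow> 'a) \<Rightarrow> ('a \<Rightarrow> 'a) \<Rightarrow> 'v hspace
     \<Rightarrow> ('a \<Rightarrow> 'v \<Rightarrow> 'v) \<Rightarrow> bool" where
  "cyclic_rep cmult star K \<pi> \<longleftrightarrow> hilbert_space K \<and> is_rep cmult star K \<pi> \<and>
     (\<exists>\<eta>\<in>hcarrier K. \<forall>x\<in>hcarrier K. \<forall>e>0. \<exists>a. hnorm K (hdiff K (\<pi> a \<eta>) x) < e)"

definition states ::
  "(complex \<Rightarrow> 'a::{real_normed_algebra_1,banach} \<Rightarrow> 'a) \<Rightarrow> ('a \<Rightarrow> 'a) \<Rightarrow> ('a \<Rightarrow> complex) set" where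
  "states cmult star = {\<phi>.
     (\<forall>a b. \<phi> (a + b) = \<phi> a + \<phi> b) \<and>
     (\<forall>c a. \<phi> (cmult c a) = c * \<phi> a) \<and>
     (\<forall>a. Im (\<phi> (star a * a)) = 0 \<and> Re (\<phi> (star a * a)) \<ge> 0) \<and>
     bdd_above ((\<lambda>a. cmod (\<phi> a)) ` {a. norm a \<le> 1}) \<and>
     (SUP a\<in>{a. norm a \<le> 1}. cmod (\<phi> a)) = 1}"

definition weak_star_topology ::
  "(complex \<Rightarrow> 'a::{real_normed_algebra_1,banach} \<Rightarrow> 'a) \<Rightarrow> ('a \<Rightarrow> 'a) \<Rightarrow> ('a \<Rightarrow> complex) topology" where
  "weak_star_topology cmult star = topology_generated_by
     {{\<phi> \<in> states cmult star. \<phi> a \<in> U} | a U. open U}"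

definition vector_state :: "'v hspace \<Rightarrow> 'v \<Rightarrow> ('a \<Rightarrow> 'v \<Rightarrow> 'v) \<Rightarrow> 'a \<Rightarrow> complex" where
  "vector_state H \<xi> \<pi> = (\<lambda>a. hinner H (\<pi> a \<xi>) \<xi>)"

end

theory Submission
  imports Defs
begin

text \<open>If \<open>H\<close> is finite-dimensional, the representations in question form a compact space, and a
  continuous surjection from a compact space onto a Hausdorff space is a quotient map.

  If \<open>H\<close> is infinite-dimensional, a state \<open>\<phi>\<close> is lifted to its GNS representation \<open>\<pi>\<close> on a
  subspace of \<open>H\<close> with cyclic vector \<open>\<xi>\<close>, extended by zero, and every neighbourhood of this \<open>\<pi>\<close>
  contains lifts of all states near \<open>\<phi>\<close>. Indeed, for \<open>\<psi>\<close> near \<open>\<phi>\<close> the Gram matrix of finitely many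
  vectors \<open>\<pi>\<^sub>\<psi>(c) \<xi>\<close> is near that of the \<open>\<pi>(c) \<xi>\<close>, so conjugation by a unitary fixing \<open>\<xi>\<close> makes these
  vectors close to each other. The same unitary can make \<open>\<pi>\<^sub>\<psi>\<close> almost annihilate finitely many
  vectors orthogonal to \<open>\<pi>(1) H\<close>, because there is room for a copy of them orthogonal to
  \<open>\<pi>\<^sub>\<psi>(1) H\<close>. As representations are contractive, this makes the given matrix coefficients close.
  Hence a set of states with open preimage is a neighbourhood of each of its points.\<close>

section \<open>Semi-inner product spaces\<close>

text \<open>A vector state fixes only the Gram matrix of the vectors \<open>\<pi> c \<xi>\<close>;
  the rest of a lift is a free choice, and lifts of close states chosen independently need not be
  close. The correcting unitary depends on the state and controls finitely many vectors at a time,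
  which is all that a weak operator neighbourhood can test. Neither a continuous section nor
  openness at every representation is claimed: a quotient map needs one good point in each fibre.
  The GNS lift is such a point because cyclicity replaces a test vector \<open>x\<close> by some
  \<open>\<pi> c \<xi>\<close> plus the part \<open>x - \<pi> 1 x\<close> that \<open>\<pi>\<close>
  annihilates. Doubling an infinite basis makes room for the second part; a finite basis leaves
  none, whence the separate compactness argument. Contractivity is not part of
  \<open>is_rep\<close>, which only grants each operator some bound; it is derived from positivity
  of vector functionals and square roots in the algebra. The GNS space is realised on sequences in
  the algebra, because \<open>nat \<Rightarrow> 'a\<close> is the type over which the dimension
  hypothesis ranges.\<close>

text \<open>One set of laws serves the GNS form on the algebra, the Cauchy sequences over it and
  genuine inner product spaces. \<open>inner_zero\<close> is a law of its own: without
  \<open>0 + 0 = 0\<close> in the carrier it does not follow from additivity.\<close>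

locale semi_ips =
  fixes H :: "'v hspace"
  assumes zero_in [simp]: "hzero H \<in> hcarrier H"
    and add_in [simp]: "\<lbrakk>x \<in> hcarrier H; y \<in> hcarrier H\<rbrakk> \<Longrightarrow> hadd H x y \<in> hcarrier H"
    and scale_in [simp]: "x \<in> hcarrier H \<Longrightarrow> hscale H c x \<in> hcarrier H"
    and inner_zero [simp]: "z \<in> hcarrier H \<Longrightarrow> hinner H (hzero H) z = 0"
    and inner_add [simp]: "\<lbrakk>x \<in> hcarrier H; y \<in> hcarrier H; z \<in> hcarrier H\<rbrakk>
           \<Longrightarrow> hinner H (hadd H x y) z = hinner H x z + hinner H y z"
    and inner_scale [simp]: "\<lbrakk>x \<in> hcarrier H; z \<in> hcarrier H\<rbrakk>
           \<Longrightarrow> hinner H (hscale H c x) z = c * hinner H x z"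
    and inner_cnj: "\<lbrakk>x \<in> hcarrier H; y \<in> hcarrier H\<rbrakk> \<Longrightarrow> hinner H y x = cnj (hinner H x y)"
    and inner_Im [simp]: "x \<in> hcarrier H \<Longrightarrow> Im (hinner H x x) = 0"
    and inner_ge0 [simp]: "x \<in> hcarrier H \<Longrightarrow> 0 \<le> Re (hinner H x x)"
begin

abbreviation C where "C \<equiv> hcarrier H"
abbreviation ip where "ip \<equiv> hinner H"
abbreviation nm where "nm \<equiv> hnorm H"
abbreviation df where "df \<equiv> hdiff H"

lemma diff_in [simp]: "\<lbrakk>x \<in> C; y \<in> C\<rbrakk> \<Longrightarrow> df x y \<in> C"
  by (simp add: hdiff_def)

lemma inner_diff [simp]: "\<lbrakk>x \<in> C; y \<in> C; z \<in> C\<rbrakk> \<Longrightarrow> ip (df x y) z = ip x z - ip y z"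
  by (simp add: hdiff_def)

lemma inner_add_right [simp]: "\<lbrakk>x \<in> C; y \<in> C; z \<in> C\<rbrakk> \<Longrightarrow> ip z (hadd H x y) = ip z x + ip z y"
  by (metis add_in inner_add inner_cnj complex_cnj_add)

lemma inner_scale_right [simp]: "\<lbrakk>x \<in> C; z \<in> C\<rbrakk> \<Longrightarrow> ip z (hscale H c x) = cnj c * ip z x"
  by (metis scale_in inner_scale inner_cnj complex_cnj_mult)

lemma inner_diff_right [simp]: "\<lbrakk>x \<in> C; y \<in> C; z \<in> C\<rbrakk> \<Longrightarrow> ip z (df x y) = ip z x - ip z y"
  by (simp add: hdiff_def)

lemma inner_zero_right [simp]: "z \<in> C \<Longrightarrow> ip z (hzero H) = 0"
  by (metis inner_zero inner_cnj zero_in complex_cnj_zero)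

lemma nm_ge0 [simp]: "x \<in> C \<Longrightarrow> 0 \<le> nm x"
  by (simp add: hnorm_def)

lemma nm_sq: "x \<in> C \<Longrightarrow> (nm x)\<^sup>2 = Re (ip x x)"
  by (simp add: hnorm_def)

lemma inner_self: "x \<in> C \<Longrightarrow> ip x x = complex_of_real ((nm x)\<^sup>2)"
  by (simp add: nm_sq complex_eq_iff)

lemma nm_zero [simp]: "nm (hzero H) = 0"
  by (simp add: hnorm_def)

lemma nm_scale: "x \<in> C \<Longrightarrow> nm (hscale H c x) = cmod c * nm x"
proof -
  assume x: "x \<in> C"
  have "ip (hscale H c x) (hscale H c x) = complex_of_real ((cmod c)\<^sup>2 * (nm x)\<^sup>2)"
    using x complex_norm_square[of c] by (simp add: inner_self[OF x] mult_ac)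
  then have "(nm (hscale H c x))\<^sup>2 = (cmod c * nm x)\<^sup>2"
    using x by (simp add: nm_sq power_mult_distrib)
  then show ?thesis
    using x by (simp add: power2_eq_iff_nonneg)
qed

lemma nm_diff_sq:
  assumes "x \<in> C" "y \<in> C"
  shows "(nm (df x y))\<^sup>2 = (nm x)\<^sup>2 - 2 * Re (ip x y) + (nm y)\<^sup>2"
proof -
  have "Re (ip y x) = Re (ip x y)"
    using assms inner_cnj[of x y] by simp
  then show ?thesis
    using assms by (simp add: nm_sq)
qed

lemma cauchy_schwarz:
  assumes x: "x \<in> C" and y: "y \<in> C"
  shows "cmod (ip x y) \<le> nm x * nm y"
proof -
  let ?z = "ip x y"
  have *: "0 \<le> (nm x)\<^sup>2 - 2 * t * (cmod ?z)\<^sup>2 + t\<^sup>2 * (cmod ?z)\<^sup>2 * (nm y)\<^sup>2" for t :: real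
  proof -
    let ?v = "hscale H (of_real t * ?z) y"
    have 1: "ip x ?v = of_real (t * (cmod ?z)\<^sup>2)"
      using x y complex_norm_square[of ?z] by (simp add: mult_ac)
    have 2: "(nm ?v)\<^sup>2 = t\<^sup>2 * (cmod ?z)\<^sup>2 * (nm y)\<^sup>2"
      using y by (simp add: nm_scale norm_mult power_mult_distrib)
    show ?thesis
      using nm_diff_sq[OF x scale_in[OF y], of "of_real t * ?z"] zero_le_power2[of "nm (df x ?v)"]
      unfolding 1 2 by simp
  qed
  have "(cmod ?z)\<^sup>2 \<le> (nm x)\<^sup>2 * (nm y)\<^sup>2"
  proof (cases "nm y = 0")
    case True
    have "cmod ?z = 0"
    proof (rule ccontr)
      assume nz: "cmod ?z \<noteq> 0"
      \<comment> \<open>This value of \<open>t\<close> turns the right-hand side into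
        \<open>-1\<close>.\<close>
      have "0 \<le> (nm x)\<^sup>2 - 2 * (((nm x)\<^sup>2 + 1) / (2 * (cmod ?z)\<^sup>2)) * (cmod ?z)\<^sup>2"
        using *[of "((nm x)\<^sup>2 + 1) / (2 * (cmod ?z)\<^sup>2)"] True by simp
      then show False
        using nz by simp
    qed
    then show ?thesis
      by simp
  next
    case False
    have "0 \<le> (nm x)\<^sup>2 - (cmod ?z)\<^sup>2 / (nm y)\<^sup>2"
      using *[of "1 / (nm y)\<^sup>2"] False by (simp add: power2_eq_square field_simps)
    then show ?thesis
      using False by (simp add: field_simps)
  qed
  then have "(cmod ?z)\<^sup>2 \<le> (nm x * nm y)\<^sup>2"
    by (simp add: power_mult_distrib)
  then show ?thesis
    using x y power2_le_imp_le by fastforce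
qed

lemma nm_add: 
  assumes "x \<in> C" "y \<in> C"
  shows "nm (hadd H x y) \<le> nm x + nm y"
proof (rule power2_le_imp_le)
  have "Re (ip y x) = Re (ip x y)"
    using assms inner_cnj[of x y] by simp
  then have "(nm (hadd H x y))\<^sup>2 = (nm x)\<^sup>2 + 2 * Re (ip x y) + (nm y)\<^sup>2"
    using assms by (simp add: nm_sq)
  also have "\<dots> \<le> (nm x)\<^sup>2 + 2 * (nm x * nm y) + (nm y)\<^sup>2"
    using cauchy_schwarz[OF assms] complex_Re_le_cmod[of "ip x y"] by linarith
  finally show "(nm (hadd H x y))\<^sup>2 \<le> (nm x + nm y)\<^sup>2"
    by (simp add: power2_eq_square algebra_simps)
qed (use assms in simp)

text \<open>Norms of vectors are compared through their inner products, so that no vector space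
  axiom (which a semi-inner product satisfies only up to null vectors) is needed.\<close>

lemma nm_cong:
  assumes "x \<in> C" "y \<in> C" "\<And>z. z \<in> C \<Longrightarrow> ip x z = ip y z"
  shows "nm x = nm y"
proof -
  have "ip x x = ip y x" "ip x y = ip y y"
    using assms by auto
  then have "Re (ip x x) = Re (ip y y)"
    using inner_cnj[of x y] assms by simp
  then show ?thesis
    by (simp add: hnorm_def)
qed

lemma nm_diff_commute: "\<lbrakk>x \<in> C; y \<in> C\<rbrakk> \<Longrightarrow> nm (df x y) = nm (df y x)"
  using nm_cong[of "df x y" "hscale H (-1) (df y x)"] by (simp add: nm_scale)

lemma nm_diff_triangle:
  assumes "x \<in> C" "y \<in> C" "z \<in> C"
  shows "nm (df x z) \<le> nm (df x y) + nm (df y z)"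
proof -
  have "nm (df x z) = nm (hadd H (df x y) (df y z))"
    using assms by (intro nm_cong) auto
  then show ?thesis
    using nm_add[of "df x y" "df y z"] assms by simp
qed

lemma nm_le_diff:
  assumes "x \<in> C" "y \<in> C"
  shows "nm x \<le> nm (df x y) + nm y"
proof -
  have "nm x = nm (hadd H (df x y) y)"
    using assms by (intro nm_cong) auto
  then show ?thesis
    using nm_add[of "df x y" y] assms by simp
qed

end

text \<open>Definiteness in extensional form: every vector identity, the vector space axioms and the
  linearity of operators with an adjoint included, can be proved by comparing inner
  products.\<close>

locale ips = semi_ips H for H :: "'v hspace" +
  assumes inner_ext: "\<lbrakk>x \<in> C; y \<in> C; \<And>z. z \<in> C \<Longrightarrow> ip x z = ip y z\<rbrakk> \<Longrightarrow> x = y"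
begin

lemma nm_eq0: "x \<in> C \<Longrightarrow> nm x = 0 \<Longrightarrow> x = hzero H"
proof (rule inner_ext)
  fix z assume "x \<in> C" "nm x = 0" "z \<in> C"
  then show "ip x z = ip (hzero H) z"
    using cauchy_schwarz[of x z] by simp
qed auto

lemma nm_diff_eq0: "\<lbrakk>x \<in> C; y \<in> C; nm (df x y) = 0\<rbrakk> \<Longrightarrow> x = y"
  using nm_eq0[of "df x y"] inner_diff inner_ext inner_zero
  by (metis diff_in eq_iff_diff_eq_0)

lemma inner_product_space: "inner_product_space H"
  unfolding inner_product_space_def
proof (intro conjI ballI allI impI)
  fix x assume "x \<in> C" "ip x x = 0"
  then show "x = hzero H"
    using nm_eq0[of x] by (simp add: hnorm_def)
next
  fix x y assume "x \<in> C" "y \<in> C"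
  then show "ip y x = cnj (ip x y)"
    by (rule inner_cnj)
qed (auto intro!: inner_ext simp: algebra_simps)

end

text \<open>The vector space axioms are spent on extensionality: \<open>x - y\<close> is orthogonal
  to itself, hence zero, and adding \<open>y\<close> back gives \<open>x = y\<close>.\<close>

lemma inner_product_space_imp_ips:
  assumes "inner_product_space H"
  shows "ips H"
proof -
  note ax = assms[unfolded inner_product_space_def]
  note zin = ax[THEN conjunct1]
    and addin = ax[THEN conjunct2, THEN conjunct1, rule_format]
    and scalein = ax[THEN conjunct2, THEN conjunct2, THEN conjunct1, rule_format]
  note ax3 = ax[THEN conjunct2, THEN conjunct2, THEN conjunct2]
  note assoc = ax3[THEN conjunct1, rule_format]
    and comm = ax3[THEN conjunct2, THEN conjunct1, rule_format]
    and zadd = ax3[THEN conjunct2, THEN conjunct2, THEN conjunct1, rule_format]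
    and neg = ax3[THEN conjunct2, THEN conjunct2, THEN conjunct2, THEN conjunct1, rule_format]
  have "\<forall>x\<in>hcarrier H. \<forall>y\<in>hcarrier H. \<forall>z\<in>hcarrier H.
         hinner H (hadd H x y) z = hinner H x z + hinner H y z"
    and "\<forall>c. \<forall>x\<in>hcarrier H. \<forall>y\<in>hcarrier H. hinner H (hscale H c x) y = c * hinner H x y"
    and "\<forall>x\<in>hcarrier H. \<forall>y\<in>hcarrier H. hinner H y x = cnj (hinner H x y)"
    and "\<forall>x\<in>hcarrier H. Im (hinner H x x) = 0 \<and> Re (hinner H x x) \<ge> 0"
    and "\<forall>x\<in>hcarrier H. hinner H x x = 0 \<longrightarrow> x = hzero H"
    using ax by - (elim conjE, assumption)+
  note inadd = this(1)[rule_format] and inscale = this(2)[rule_format] and insym = this(3)[rule_format]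
    and pos = this(4)[rule_format] and def0 = this(5)[rule_format]
  have z: "hinner H (hzero H) z = 0" if "z \<in> hcarrier H" for z
    using inadd[of "hzero H" "hzero H" z] zin zadd that by simp
  interpret semi_ips H
    by unfold_locales (fact zin addin scalein z inadd inscale insym pos[THEN conjunct1] pos[THEN conjunct2])+
  show ?thesis
  proof
    fix x y assume xy: "x \<in> C" "y \<in> C" "\<And>z. z \<in> C \<Longrightarrow> ip x z = ip y z"
    have d: "df x y = hzero H"
      using xy by (intro def0) simp_all
    have neg': "hadd H (hscale H (-1) y) y = hzero H"
      using comm[of y "hscale H (-1) y"] neg xy(2) by simp
    have "x = hadd H x (hadd H (hscale H (-1) y) y)"
      unfolding neg' using comm[of x "hzero H"] zadd xy by simp
    also have "\<dots> = hadd H (df x y) y"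
      unfolding hdiff_def using assoc xy by simp
    also have "\<dots> = y"
      unfolding d using zadd xy by simp
    finally show "x = y" .
  qed
qed

locale hilbert = ips H for H :: "'v hspace" +
  assumes complete: "\<lbrakk>\<And>n. s n \<in> C; \<forall>e>0. \<exists>N. \<forall>m\<ge>N. \<forall>n\<ge>N. nm (df (s m) (s n)) < e\<rbrakk>
    \<Longrightarrow> \<exists>l\<in>C. \<forall>e>0. \<exists>N. \<forall>n\<ge>(N::nat). nm (df (s n) l) < e"
begin

lemma hilbert_space: "hilbert_space H"
  unfolding hilbert_space_def using inner_product_space complete by blast

end

lemma hilbert_space_imp_hilbert:
  assumes "hilbert_space H"
  shows "hilbert H"
proof -
  interpret ips H
    using assms by (intro inner_product_space_imp_ips) (simp add: hilbert_space_def)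
  show ?thesis
    by unfold_locales (use assms in \<open>auto simp: hilbert_space_def\<close>)
qed

section \<open>Orthonormal systems and isometries\<close>

definition orthonormal :: "'v hspace \<Rightarrow> 'v set \<Rightarrow> bool" where
  "orthonormal H E \<longleftrightarrow> E \<subseteq> hcarrier H \<and> (\<forall>e\<in>E. hinner H e e = 1) \<and>
     (\<forall>e\<in>E. \<forall>f\<in>E. e \<noteq> f \<longrightarrow> hinner H e f = 0)"

lemma orthonormal_subset: "orthonormal H E \<Longrightarrow> F \<subseteq> E \<Longrightarrow> orthonormal H F"
  unfolding orthonormal_def by (simp add: subset_iff)

lemma orthonormal_basis_imp_orthonormal: "orthonormal_basis H E \<Longrightarrow> orthonormal H E"
  unfolding orthonormal_basis_def orthonormal_def by simp

section \<open>Finite linear combinations and Bessel's inequality\<close>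

context semi_ips
begin

text \<open>An \<open>hspace\<close> has no sum over finite sets, so the combination is built by
  induction and specified through its inner products.\<close>

lemma ex_lincomb:
  assumes "finite F" "F \<subseteq> C"
  shows "\<exists>y\<in>C. \<forall>z\<in>C. ip y z = (\<Sum>e\<in>F. c e * ip e z)"
  using assms
proof (induction F)
  case empty
  show ?case
    by (rule bexI[of _ "hzero H"]) auto
next
  case (insert f F)
  then obtain y where "y \<in> C" "\<forall>z\<in>C. ip y z = (\<Sum>e\<in>F. c e * ip e z)"
    by auto
  with insert show ?case
    by (intro bexI[of _ "hadd H (hscale H (c f) f) y"]) auto
qed

lemma orthonormal_lincomb:
  assumes F: "finite F" "orthonormal H F" and y: "y \<in> C" "\<And>z. z \<in> C \<Longrightarrow> ip y z = (\<Sum>e\<in>F. c e * ip e z)"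
  shows "\<And>e. e \<in> F \<Longrightarrow> ip y e = c e"
    and "(nm y)\<^sup>2 = (\<Sum>e\<in>F. (cmod (c e))\<^sup>2)"
proof -
  have FC: "F \<subseteq> C"
    using F by (simp add: orthonormal_def)
  show *: "ip y e = c e" if "e \<in> F" for e
  proof -
    have "ip y e = (\<Sum>f\<in>F. if f = e then c e else 0)"
      unfolding y(2)[OF subsetD[OF FC that]]
      by (rule sum.cong) (use F that in \<open>auto simp: orthonormal_def\<close>)
    then show ?thesis
      using F that by simp
  qed
  have "ip y y = (\<Sum>e\<in>F. complex_of_real ((cmod (c e))\<^sup>2))"
    unfolding y(2)[OF y(1)]
  proof (rule sum.cong)
    fix e assume e: "e \<in> F"
    have "ip e y = cnj (c e)"
      using inner_cnj[of y e] *[OF e] y(1) FC e by auto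
    then show "c e * ip e y = complex_of_real ((cmod (c e))\<^sup>2)"
      using complex_norm_square[of "c e"] by simp
  qed simp
  then show "(nm y)\<^sup>2 = (\<Sum>e\<in>F. (cmod (c e))\<^sup>2)"
    using y(1) by (simp add: nm_sq)
qed

text \<open>For the combination \<open>y\<close> with coefficients \<open>ip x e\<close>, both
  \<open>Re (ip y x)\<close> and the squared norm of \<open>y\<close> equal the sum on the left, so
  the squared norm of \<open>y - x\<close> is the gap between the two sides.\<close>

lemma bessel:
  assumes F: "finite F" "orthonormal H F" and x: "x \<in> C"
  shows "(\<Sum>e\<in>F. (cmod (ip x e))\<^sup>2) \<le> (nm x)\<^sup>2"
proof -
  have FC: "F \<subseteq> C"
    using F by (simp add: orthonormal_def)
  obtain y where y: "y \<in> C" "\<And>z. z \<in> C \<Longrightarrow> ip y z = (\<Sum>e\<in>F. ip x e * ip e z)"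
    using ex_lincomb[OF F(1) FC] by metis
  have "ip y x = (\<Sum>e\<in>F. complex_of_real ((cmod (ip x e))\<^sup>2))"
    unfolding y(2)[OF x]
  proof (rule sum.cong)
    fix e assume e: "e \<in> F"
    then have "ip e x = cnj (ip x e)"
      using inner_cnj[of x e] FC x by auto
    then show "ip x e * ip e x = complex_of_real ((cmod (ip x e))\<^sup>2)"
      using complex_norm_square[of "ip x e"] by simp
  qed simp
  then have "Re (ip y x) = (\<Sum>e\<in>F. (cmod (ip x e))\<^sup>2)"
    by simp
  then show ?thesis
    using orthonormal_lincomb(2)[OF F y] nm_diff_sq[OF y(1) x] zero_le_power2[of "nm (df y x)"]
    by simp
qed

end

section \<open>Fourier expansions over orthonormal systems of any cardinality\<close>

context hilbert
begin

text \<open>As \<open>E\<close> may be uncountable, partial sums are replaced by finite sets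
  \<open>F n\<close> that nearly exhaust the supremum \<open>S\<close> of the square sums. Enlarging
  \<open>F n\<close> to any finite \<open>G\<close> moves the vector by at most
  \<open>1 / real (Suc n)\<close>, so these vectors are Cauchy and the whole net of finite sums
  converges to their limit.\<close>

lemma riesz_fischer:
  assumes E: "orthonormal H E"
    and bound: "\<And>F. finite F \<Longrightarrow> F \<subseteq> E \<Longrightarrow> (\<Sum>e\<in>F. (cmod (c e))\<^sup>2) \<le> B"
  shows "\<exists>y\<in>C. (\<forall>z\<in>C. ((\<lambda>e. c e * ip e z) has_sum ip y z) E) \<and> (\<forall>e\<in>E. ip y e = c e)"
proof -
  have EC: "E \<subseteq> C"
    using E by (simp add: orthonormal_def)
  define fin where "fin F \<longleftrightarrow> finite F \<and> F \<subseteq> E" for F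
  define Q where "Q F = (\<Sum>e\<in>F. (cmod (c e))\<^sup>2)" for F
  have "\<forall>F. \<exists>y. fin F \<longrightarrow> y \<in> C \<and> (\<forall>z\<in>C. ip y z = (\<Sum>e\<in>F. c e * ip e z))"
    using ex_lincomb EC unfolding fin_def by (meson subset_trans)
  then obtain Y where "\<forall>F. fin F \<longrightarrow> Y F \<in> C \<and> (\<forall>z\<in>C. ip (Y F) z = (\<Sum>e\<in>F. c e * ip e z))"
    by metis
  then have YC: "\<And>F. fin F \<Longrightarrow> Y F \<in> C"
    and Y: "\<And>F z. fin F \<Longrightarrow> z \<in> C \<Longrightarrow> ip (Y F) z = (\<Sum>e\<in>F. c e * ip e z)"
    by auto
  have nested: "(nm (df (Y F) (Y G)))\<^sup>2 = Q F - Q G" if "fin F" "G \<subseteq> F" for F G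
  proof -
    have G: "fin G"
      using that by (auto simp: fin_def finite_subset)
    have "(nm (df (Y F) (Y G)))\<^sup>2 = Q (F - G)"
      unfolding Q_def
    proof (rule orthonormal_lincomb(2))
      show "finite (F - G)" "orthonormal H (F - G)"
        using that orthonormal_subset[OF E, of "F - G"] by (auto simp: fin_def)
      show "ip (df (Y F) (Y G)) z = (\<Sum>e\<in>F - G. c e * ip e z)" if "z \<in> C" for z
        using Y[OF \<open>fin F\<close> that] Y[OF G that] YC \<open>fin F\<close> G that \<open>G \<subseteq> F\<close>
        by (simp add: sum_diff fin_def)
    qed (use YC that G in auto)
    then show ?thesis
      using that by (simp add: Q_def sum_diff fin_def)
  qed
  define S where "S = (SUP F\<in>Collect fin. Q F)"
  have bdd: "bdd_above (Q ` Collect fin)"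
    using bound by (intro bdd_aboveI[of _ B]) (auto simp: Q_def fin_def)
  have ne: "Collect fin \<noteq> {}"
    by (auto simp: fin_def)
  have QS: "Q F \<le> S" if "fin F" for F
    unfolding S_def using that by (intro cSUP_upper bdd) auto
  \<comment> \<open>The margin is squared because \<open>nested\<close> expresses a squared norm as
    a difference of values of \<open>Q\<close>.\<close>
  have "\<exists>F. fin F \<and> S - (1 / real (Suc n))\<^sup>2 < Q F" for n
  proof -
    have "S - (1 / real (Suc n))\<^sup>2 < S"
      by simp
    then show ?thesis
      unfolding S_def less_cSUP_iff[OF ne bdd] by auto
  qed
  then obtain F where F: "\<And>n. fin (F n)" "\<And>n. S - (1 / real (Suc n))\<^sup>2 < Q (F n)"
    by metis
  have near: "nm (df (Y G) (Y (F n))) \<le> 1 / real (Suc n)" if "fin G" "F n \<subseteq> G" for G n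
  proof (rule power2_le_imp_le)
    show "(nm (df (Y G) (Y (F n))))\<^sup>2 \<le> (1 / real (Suc n))\<^sup>2"
      using nested[OF that] QS[OF that(1)] F(2)[of n] by simp
  qed simp
  define s where "s n = Y (F n)" for n
  have sC: "s n \<in> C" for n
    using YC F(1) by (simp add: s_def)
  \<comment> \<open>The sets \<open>F n\<close> need not increase, so two of them are compared
    through their union.\<close>
  have "nm (df (s m) (s n)) \<le> 1 / real (Suc m) + 1 / real (Suc n)" for m n
  proof -
    have fU: "fin (F m \<union> F n)"
      using F(1) by (simp add: fin_def)
    have "nm (df (s m) (s n)) \<le> nm (df (s m) (Y (F m \<union> F n))) + nm (df (Y (F m \<union> F n)) (s n))"
      using sC YC fU by (intro nm_diff_triangle) auto
    also have "nm (df (s m) (Y (F m \<union> F n))) = nm (df (Y (F m \<union> F n)) (s m))"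
      using sC YC fU by (intro nm_diff_commute) auto
    finally show ?thesis
      using near[OF fU, of m] near[OF fU, of n] by (simp add: s_def)
  qed
  note cau = this
  have "\<forall>e>0. \<exists>N. \<forall>m\<ge>N. \<forall>n\<ge>N. nm (df (s m) (s n)) < e"
  proof (intro allI impI)
    fix e :: real assume "e > 0"
    then obtain N where N: "1 / real (Suc N) < e / 2"
      using nat_approx_posE[of "e / 2"] by (metis half_gt_zero)
    have "nm (df (s m) (s n)) < e" if "m \<ge> N" "n \<ge> N" for m n
    proof -
      have "1 / real (Suc m) \<le> 1 / real (Suc N)" "1 / real (Suc n) \<le> 1 / real (Suc N)"
        using that by (auto intro!: divide_left_mono)
      then show ?thesis
        using cau[of m n] N by linarith
    qed
    then show "\<exists>N. \<forall>m\<ge>N. \<forall>n\<ge>N. nm (df (s m) (s n)) < e"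
      by blast
  qed
  from complete[OF sC this] obtain y where y: "y \<in> C" "\<And>e. e > 0 \<Longrightarrow> \<exists>N. \<forall>n\<ge>N. nm (df (s n) y) < e"
    by auto
  have approx: "\<exists>G. fin G \<and> (\<forall>F. fin F \<longrightarrow> G \<subseteq> F \<longrightarrow> nm (df (Y F) y) < e)" if "e > 0" for e
  proof -
    obtain N where N: "1 / real (Suc N) < e / 2"
      using nat_approx_posE[of "e / 2"] \<open>e > 0\<close> by (metis half_gt_zero)
    obtain M where M: "\<forall>n\<ge>M. nm (df (s n) y) < e / 2"
      using y(2)[of "e / 2"] \<open>e > 0\<close> by (metis half_gt_zero)
    define n where "n = max M N"
    have n: "1 / real (Suc n) \<le> 1 / real (Suc N)"
      by (auto intro!: divide_left_mono simp: n_def)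
    show ?thesis
    proof (intro exI conjI allI impI)
      fix G assume G: "fin G" "F n \<subseteq> G"
      have "nm (df (Y G) y) \<le> nm (df (Y G) (s n)) + nm (df (s n) y)"
        using YC G sC y by (intro nm_diff_triangle) auto
      moreover have "nm (df (s n) y) < e / 2"
        using M by (simp add: n_def)
      moreover have "nm (df (Y G) (s n)) < e / 2"
        using near[OF G] n N unfolding s_def by linarith
      ultimately show "nm (df (Y G) y) < e"
        by linarith
    qed (rule F)
  qed
  have sums: "((\<lambda>e. c e * ip e z) has_sum ip y z) E" if z: "z \<in> C" for z
    unfolding has_sum_def
  proof (rule tendstoI)
    fix e :: real assume e: "e > 0"
    define d where "d = e / (nm z + 1)"
    have d: "d > 0"
      using e nm_ge0[OF z] by (simp add: d_def add_nonneg_pos)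
    obtain G where G: "fin G" "\<And>F. fin F \<Longrightarrow> G \<subseteq> F \<Longrightarrow> nm (df (Y F) y) < d"
      using approx[OF d] by auto
    show "\<forall>\<^sub>F F in finite_subsets_at_top E. dist (\<Sum>e\<in>F. c e * ip e z) (ip y z) < e"
      unfolding eventually_finite_subsets_at_top
    proof (intro exI[of _ G] conjI allI impI)
      fix F assume "finite F \<and> G \<subseteq> F \<and> F \<subseteq> E"
      then have F: "fin F" "G \<subseteq> F"
        by (auto simp: fin_def)
      have "dist (\<Sum>e\<in>F. c e * ip e z) (ip y z) = cmod (ip (df (Y F) y) z)"
        using Y[OF F(1) z] YC[OF F(1)] y(1) z by (simp add: dist_norm)
      also have "\<dots> \<le> nm (df (Y F) y) * nm z"
        using YC[OF F(1)] y(1) z by (intro cauchy_schwarz) auto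
      also have "\<dots> \<le> d * nm z"
        using G(2)[OF F] nm_ge0[OF z] by (intro mult_right_mono) auto
      also have "\<dots> < e"
        using e nm_ge0[OF z] by (simp add: d_def field_simps)
      finally show "dist (\<Sum>e\<in>F. c e * ip e z) (ip y z) < e" .
    qed (use G in \<open>auto simp: fin_def\<close>)
  qed
  have "ip y e = c e" if e: "e \<in> E" for e
  proof -
    have "((\<lambda>f. c f * ip f e) has_sum (\<Sum>f\<in>{e}. c f * ip f e)) E"
      by (rule has_sum_finite_neutralI[of "{e}"]) (use E e in \<open>auto simp: orthonormal_def\<close>)
    moreover have "ip e e = 1"
      using E e by (simp add: orthonormal_def)
    moreover have "((\<lambda>f. c f * ip f e) has_sum ip y e) E"
      using sums e EC by blast
    ultimately show ?thesis
      using has_sum_unique by fastforce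
  qed
  with y sums show ?thesis
    by blast
qed

lemma basis_ext:
  assumes "orthonormal_basis H E" "x \<in> C" "y \<in> C" "\<And>e. e \<in> E \<Longrightarrow> ip x e = ip y e"
  shows "x = y"
proof -
  have "E \<subseteq> C" 
    using assms(1) by (simp add: orthonormal_basis_def)
  then have "\<forall>e\<in>E. ip (df x y) e = 0"
    using assms by auto
  then have "df x y = hzero H"
    using assms by (simp add: orthonormal_basis_def)
  then show ?thesis
    using assms by (intro nm_diff_eq0) auto
qed

text \<open>Riesz-Fischer applied to the coefficients of \<open>x\<close> yields a vector with the
  same coefficients, and a basis separates vectors.\<close>

lemma parseval:
  assumes E: "orthonormal_basis H E" and x: "x \<in> C" and z: "z \<in> C"
  shows "((\<lambda>e. ip x e * ip e z) has_sum ip x z) E"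
proof -
  have o: "orthonormal H E"
    using E by (rule orthonormal_basis_imp_orthonormal)
  have "\<exists>y\<in>C. (\<forall>z\<in>C. ((\<lambda>e. ip x e * ip e z) has_sum ip y z) E) \<and> (\<forall>e\<in>E. ip y e = ip x e)"
    using bessel[OF _ orthonormal_subset[OF o] x] by (intro riesz_fischer[OF o]) blast
  then obtain y where "y \<in> C" "((\<lambda>e. ip x e * ip e z) has_sum ip y z) E" "\<forall>e\<in>E. ip y e = ip x e"
    using z by blast
  moreover from this have "y = x"
    using basis_ext[OF E _ x] by blast
  ultimately show ?thesis
    by simp
qed

end

section \<open>Isometries with adjoints\<close>

text \<open>An isometry carried together with its adjoint. With the adjoint at hand, linearity of
  \<open>V\<close> follows by extensionality, and \<open>V \<circ> V'\<close> is the projection onto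
  the range.\<close>

definition isometry_pair :: "'w hspace \<Rightarrow> 'v hspace \<Rightarrow> ('w \<Rightarrow> 'v) \<Rightarrow> ('v \<Rightarrow> 'w) \<Rightarrow> bool" where
  "isometry_pair K H V V' \<longleftrightarrow>
     (\<forall>x\<in>hcarrier K. V x \<in> hcarrier H) \<and> (\<forall>y\<in>hcarrier H. V' y \<in> hcarrier K) \<and>
     (\<forall>x\<in>hcarrier K. \<forall>y\<in>hcarrier H. hinner H (V x) y = hinner K x (V' y)) \<and>
     (\<forall>x\<in>hcarrier K. V' (V x) = x)"

definition unitary_pair :: "'v hspace \<Rightarrow> ('v \<Rightarrow> 'v) \<Rightarrow> ('v \<Rightarrow> 'v) \<Rightarrow> bool" where
  "unitary_pair H U U' \<longleftrightarrow> isometry_pair H H U U' \<and> isometry_pair H H U' U"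

lemma isometry_pairD:
  assumes "isometry_pair K H V V'"
  shows "x \<in> hcarrier K \<Longrightarrow> V x \<in> hcarrier H"
    and "y \<in> hcarrier H \<Longrightarrow> V' y \<in> hcarrier K"
    and "x \<in> hcarrier K \<Longrightarrow> y \<in> hcarrier H \<Longrightarrow> hinner H (V x) y = hinner K x (V' y)"
    and "x \<in> hcarrier K \<Longrightarrow> V' (V x) = x"
  using assms unfolding isometry_pair_def by auto

lemma isometry_pair_inner:
  assumes "isometry_pair K H V V'" "x \<in> hcarrier K" "y \<in> hcarrier K"
  shows "hinner H (V x) (V y) = hinner K x y"
  using isometry_pairD[OF assms(1)] assms(2,3) by simp

lemma isometry_pair_comp:
  assumes "isometry_pair K H V V'" "isometry_pair H L W W'"
  shows "isometry_pair K L (W \<circ> V) (V' \<circ> W')"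
  using isometry_pairD[OF assms(1)] isometry_pairD[OF assms(2)] unfolding isometry_pair_def by simp

lemma unitary_pair_comp:
  assumes "unitary_pair H U U'" "unitary_pair H T T'"
  shows "unitary_pair H (T \<circ> U) (U' \<circ> T')"
  using assms isometry_pair_comp unfolding unitary_pair_def by blast

text \<open>\<open>V x\<close> is the sum of \<open>K.ip x e\<close> times \<open>g e\<close>, and
  \<open>V' y\<close> the sum of \<open>H.ip y (g e)\<close> times \<open>e\<close>; Bessel supplies
  the bounds that Riesz-Fischer asks for. The last clause records that the range lies in the closed
  span of the vectors \<open>g e\<close>.\<close>

lemma isometry_pair_exists:
  assumes "hilbert K" "hilbert H" and E: "orthonormal_basis K E"
    and g: "inj_on g E" "orthonormal H (g ` E)"
  shows "\<exists>V V'. isometry_pair K H V V' \<and>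
     (\<forall>x\<in>hcarrier K. \<forall>y\<in>hcarrier H. (\<forall>e\<in>E. hinner H (g e) y = 0) \<longrightarrow> hinner H (V x) y = 0)"
proof -
  interpret K: hilbert K by fact
  interpret H: hilbert H by fact
  have o: "orthonormal K E"
    using E by (rule orthonormal_basis_imp_orthonormal)
  have EC: "E \<subseteq> K.C" and gC: "\<And>e. e \<in> E \<Longrightarrow> g e \<in> H.C"
    using o g by (auto simp: orthonormal_def)
  have "\<forall>x\<in>K.C. \<exists>v. v \<in> H.C \<and> (\<forall>z\<in>H.C. ((\<lambda>e. K.ip x e * H.ip (g e) z) has_sum H.ip v z) E) \<and>
          (\<forall>e\<in>E. H.ip v (g e) = K.ip x e)"
  proof
    fix x assume x: "x \<in> K.C"
    \<comment> \<open>In \<open>H\<close> the series is indexed by the vectors \<open>g e\<close>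
      themselves, so the coefficients are pulled back along the inverse of \<open>g\<close>.\<close>
    define c where "c f = K.ip x (inv_into E g f)" for f
    have cg: "c (g e) = K.ip x e" if "e \<in> E" for e
      using g(1) that by (simp add: c_def)
    have "(\<Sum>f\<in>F. (cmod (c f))\<^sup>2) \<le> (K.nm x)\<^sup>2" if F: "finite F" "F \<subseteq> g ` E" for F
    proof -
      obtain F' where F': "F' \<subseteq> E" "F = g ` F'"
        using F(2) by (meson subset_imageE)
      have "inj_on g F'"
        using F' g inj_on_subset by blast
      then have "(\<Sum>f\<in>F. (cmod (c f))\<^sup>2) = (\<Sum>e\<in>F'. (cmod (K.ip x e))\<^sup>2)"
        using F' cg by (simp add: sum.reindex subset_iff)
      also have "\<dots> \<le> (K.nm x)\<^sup>2"
        using F F' \<open>inj_on g F'\<close> by (intro K.bessel orthonormal_subset[OF o] x) (auto dest: finite_imageD)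
      finally show ?thesis .
    qed
    from H.riesz_fischer[OF g(2) this] obtain v where v: "v \<in> H.C"
      "\<And>z. z \<in> H.C \<Longrightarrow> ((\<lambda>f. c f * H.ip f z) has_sum H.ip v z) (g ` E)" 
      "\<And>f. f \<in> g ` E \<Longrightarrow> H.ip v f = c f"
      by blast
    show "\<exists>v. v \<in> H.C \<and> (\<forall>z\<in>H.C. ((\<lambda>e. K.ip x e * H.ip (g e) z) has_sum H.ip v z) E) \<and>
          (\<forall>e\<in>E. H.ip v (g e) = K.ip x e)"
    proof (intro exI[of _ v] conjI ballI)
      fix z assume "z \<in> H.C"
      from v(2)[OF this] have "((\<lambda>e. c (g e) * H.ip (g e) z) has_sum H.ip v z) E"
        unfolding has_sum_reindex[OF g(1)] o_def .
      then show "((\<lambda>e. K.ip x e * H.ip (g e) z) has_sum H.ip v z) E"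
        by (rule has_sum_cong[THEN iffD1, rotated]) (simp add: cg)
    qed (use v cg in auto)
  qed
  from bchoice[OF this] obtain V where "\<forall>x\<in>K.C. V x \<in> H.C \<and>
      (\<forall>z\<in>H.C. ((\<lambda>e. K.ip x e * H.ip (g e) z) has_sum H.ip (V x) z) E) \<and>
      (\<forall>e\<in>E. H.ip (V x) (g e) = K.ip x e)"
    by (elim exE)
  then have V: "\<And>x. x \<in> K.C \<Longrightarrow> V x \<in> H.C"
    "\<And>x z. x \<in> K.C \<Longrightarrow> z \<in> H.C \<Longrightarrow> ((\<lambda>e. K.ip x e * H.ip (g e) z) has_sum H.ip (V x) z) E"
    "\<And>x e. x \<in> K.C \<Longrightarrow> e \<in> E \<Longrightarrow> H.ip (V x) (g e) = K.ip x e"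
    by simp_all
  have "\<forall>y\<in>H.C. \<exists>v. v \<in> K.C \<and> (\<forall>e\<in>E. K.ip v e = H.ip y (g e))"
  proof
    fix y assume y: "y \<in> H.C"
    have "\<exists>v\<in>K.C. (\<forall>z\<in>K.C. ((\<lambda>e. H.ip y (g e) * K.ip e z) has_sum K.ip v z) E) \<and>
          (\<forall>e\<in>E. K.ip v e = H.ip y (g e))"
  proof (rule K.riesz_fischer[OF o])
    fix F assume F: "finite F" "F \<subseteq> E"
    have "inj_on g F"
      using F g inj_on_subset by blast
    then have "(\<Sum>e\<in>F. (cmod (H.ip y (g e)))\<^sup>2) = (\<Sum>f\<in>g ` F. (cmod (H.ip y f))\<^sup>2)"
      by (simp add: sum.reindex)
    also have "\<dots> \<le> (H.nm y)\<^sup>2"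
      using F by (intro H.bessel orthonormal_subset[OF g(2)] y) auto
    finally show "(\<Sum>e\<in>F. (cmod (H.ip y (g e)))\<^sup>2) \<le> (H.nm y)\<^sup>2" .
  qed
    then show "\<exists>v. v \<in> K.C \<and> (\<forall>e\<in>E. K.ip v e = H.ip y (g e))"
      by (elim bexE conjE) (intro exI conjI)
  qed
  from bchoice[OF this] obtain V' where "\<forall>y\<in>H.C. V' y \<in> K.C \<and> (\<forall>e\<in>E. K.ip (V' y) e = H.ip y (g e))"
    by (elim exE)
  then have V': "\<And>y. y \<in> H.C \<Longrightarrow> V' y \<in> K.C"
    "\<And>y e. y \<in> H.C \<Longrightarrow> e \<in> E \<Longrightarrow> K.ip (V' y) e = H.ip y (g e)"
    by simp_all
  have "isometry_pair K H V V'"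
    unfolding isometry_pair_def
  proof (intro conjI ballI)
    fix x y assume x: "x \<in> K.C" and y: "y \<in> H.C"
    have "((\<lambda>e. K.ip x e * K.ip e (V' y)) has_sum K.ip x (V' y)) E"
      by (rule K.parseval[OF E x V'(1)[OF y]])
    moreover have "K.ip e (V' y) = H.ip (g e) y" if "e \<in> E" for e
      using K.inner_cnj[of "V' y" e] H.inner_cnj[of y "g e"] V'[OF y] that EC gC y by auto
    ultimately have "((\<lambda>e. K.ip x e * H.ip (g e) y) has_sum K.ip x (V' y)) E"
      by (subst has_sum_cong[where g = "\<lambda>e. K.ip x e * K.ip e (V' y)"]) auto
    then show "H.ip (V x) y = K.ip x (V' y)"
      using V(2)[OF x y] has_sum_unique by blast
  next
    fix x assume x: "x \<in> K.C"
    show "V' (V x) = x"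
      using V V' x by (intro K.basis_ext[OF E]) auto
  qed (use V V' in auto)
  moreover have "H.ip (V x) y = 0" if "x \<in> K.C" "y \<in> H.C" "\<forall>e\<in>E. H.ip (g e) y = 0" for x y
  proof -
    have "((\<lambda>e. K.ip x e * H.ip (g e) y) has_sum 0) E"
      using that by (intro has_sum_0) auto
    then show ?thesis
      using V(2)[OF that(1,2)] has_sum_unique by blast
  qed
  ultimately show ?thesis
    by blast
qed

text \<open>The Householder-type reflection \<open>x \<mapsto> x - \<langle>x, w\<rangle>/\<langle>u, w\<rangle> w\<close> with \<open>w = u - v\<close> maps
  \<open>u\<close> to \<open>v\<close>; it is unitary because \<open>\<langle>u, w\<rangle> + cnj \<langle>u, w\<rangle> = \<parallel>w\<parallel>\<^sup>2\<close> when \<open>\<parallel>u\<parallel> = \<parallel>v\<parallel> = 1\<close>.\<close>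

lemma (in ips) reflection_exists:
  assumes uv: "u \<in> C" "v \<in> C" "ip u u = 1" "ip v v = 1"
  shows "\<exists>U U'. unitary_pair H U U' \<and> U u = v \<and>
           (\<forall>x\<in>C. ip x u = 0 \<longrightarrow> ip x v = 0 \<longrightarrow> U x = x)"
proof (cases "u = v")
  case True
  have "unitary_pair H id id"
    by (simp add: unitary_pair_def isometry_pair_def)
  with True show ?thesis
    by (intro exI[of _ id]) auto
next
  case False
  define w where "w = df u v"
  define a where "a = ip u w"
  have w: "w \<in> C"
    using uv by (simp add: w_def)
  have vu: "ip v u = cnj (ip u v)"
    using uv by (intro inner_cnj)
  have a: "a = 1 - ip u v"
    using uv by (simp add: a_def w_def)
  have ww: "ip w w = a + cnj a"
    using uv w by (simp add: a w_def vu)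
  have a0: "a \<noteq> 0"
  proof
    assume "a = 0"
    then have "nm w = 0"
      using ww w by (simp add: hnorm_def)
    then show False
      using uv False nm_diff_eq0 by (simp add: w_def)
  qed
  have wx: "ip w x = cnj (ip x w)" if "x \<in> C" for x
    using inner_cnj[of x w] that w by simp
  define R where "R k x = df x (hscale H (ip x w / k) w)" for k x
  have R: "R k x \<in> C" "z \<in> C \<Longrightarrow> ip (R k x) z = ip x z - ip x w / k * ip w z"
     "z \<in> C \<Longrightarrow> ip z (R k x) = ip z x - cnj (ip x w / k) * ip z w" if "x \<in> C" for k x z
    using that w by (simp_all add: R_def)
  have adj: "ip (R k x) y = ip x (R (cnj k) y)" if "x \<in> C" "y \<in> C" for k x y
    using that w by (simp add: R wx[OF that(2)])
  \<comment> \<open>Both \<open>k = a\<close> and \<open>k = cnj a\<close> satisfy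
    \<open>k + cnj k = ip w w\<close>, so one computation gives both composites. The helper identity
    says that the multiples of \<open>w\<close> contributed by the two factors cancel.\<close>
  have inv: "R (cnj k) (R k x) = x" if k: "k = a \<or> k = cnj a" and x: "x \<in> C" for k x
  proof (rule inner_ext)
    fix z assume z: "z \<in> C"
    have k0: "k \<noteq> 0" and k2: "ip w w = k + cnj k"
      using k ww a0 by auto
    have *: "s - (p * t + (s' - p * (k + cnj k)) / cnj k * t) = s"
      if "p = s' / k" for s p t s'
      using k0 that by (simp add: divide_simps) (simp add: algebra_simps)
    show "ip (R (cnj k) (R k x)) z = ip x z"
      using *[OF refl, of "ip x z" "ip x w" "ip w z"] x z w R(1)[OF x, of k] 
      by (simp add: R(2) k2)
  qed (use x R in auto)
  have "unitary_pair H (R a) (R (cnj a))"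
    using adj[of _ _ a] adj[of _ _ "cnj a"] inv[of a] inv[of "cnj a"] R(1)
    unfolding unitary_pair_def isometry_pair_def by simp
  moreover have "R a u = v"
  proof (rule inner_ext)
    fix z assume "z \<in> C"
    then show "ip (R a u) z = ip v z"
      using uv w a0 by (simp add: R flip: a_def) (simp add: w_def)
  qed (use uv R in auto)
  moreover have "R a x = x" if "x \<in> C" "ip x u = 0" "ip x v = 0" for x
  proof (rule inner_ext)
    have "ip x w = 0"
      using that uv by (simp add: w_def)
    then show "ip (R a x) z = ip x z" if "z \<in> C" for z
      using \<open>x \<in> C\<close> that by (simp add: R)
  qed (use that R in auto)
  ultimately show ?thesis
    by blast
qed

section \<open>Approximating Gram matrices by unitaries\<close>

context semi_ips
begin

lemma cnj_inner: "\<lbrakk>x \<in> C; y \<in> C\<rbrakk> \<Longrightarrow> cnj (ip x y) = ip y x"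
  using inner_cnj[of x y] by simp

text \<open>One Gram-Schmidt step. The inner products of the remainder are spelled out in terms of
  those of \<open>x\<close>, so that limits of Gram matrices pass to remainders.\<close>

lemma orthogonal_remainder:
  assumes G: "finite G" "orthonormal H G" and x: "x \<in> C"
  shows "\<exists>y. y \<in> C \<and> (\<forall>z\<in>C. ip z y = ip z x - (\<Sum>g\<in>G. cnj (ip x g) * ip z g)) \<and>
           (\<forall>g\<in>G. ip y g = 0) \<and>
           ip y y = ip x x - (\<Sum>g\<in>G. cnj (ip x g) * ip x g)"
proof -
  have GC: "G \<subseteq> C"
    using G by (simp add: orthonormal_def)
  obtain v where v: "v \<in> C" "\<And>z. z \<in> C \<Longrightarrow> ip v z = (\<Sum>g\<in>G. ip x g * ip g z)"
    using ex_lincomb[OF G(1) GC] by metis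
  define y where "y = df x v"
  have y: "y \<in> C"
    using x v by (simp add: y_def)
  have l: "ip y z = ip x z - (\<Sum>g\<in>G. ip x g * ip g z)" if "z \<in> C" for z
    using x v that by (simp add: y_def)
  have r: "ip z y = ip z x - (\<Sum>g\<in>G. cnj (ip x g) * ip z g)" if z: "z \<in> C" for z
  proof -
    have "cnj (ip y z) = ip z x - (\<Sum>g\<in>G. cnj (ip x g) * ip z g)"
      unfolding l[OF z] using z x GC by (auto intro!: sum.cong simp: cnj_inner)
    then show ?thesis
      using y z by (simp add: cnj_inner)
  qed
  have o: "ip y g = 0" if "g \<in> G" for g
    using orthonormal_lincomb(1)[OF G v that] x v(1) GC that by (auto simp: y_def)
  have "ip y y = ip x y - (\<Sum>g\<in>G. ip x g * ip g y)"
    by (rule l[OF y])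
  also have "(\<Sum>g\<in>G. ip x g * ip g y) = 0"
    using o GC inner_cnj[OF y] by (intro sum.neutral) auto
  finally have "ip y y = ip x x - (\<Sum>g\<in>G. cnj (ip x g) * ip x g)"
    using r[OF x] by simp
  with y l r o show ?thesis
    by (intro exI[of _ y]) simp_all
qed

lemma tendsto_nm_diff_zero:
  assumes "\<And>p. y p \<in> C" "t \<in> C"
    and "((\<lambda>p. ip (y p) (y p)) \<longlongrightarrow> ip t t) F" "((\<lambda>p. ip (y p) t) \<longlongrightarrow> ip t t) F"
  shows "((\<lambda>p. nm (df (y p) t)) \<longlongrightarrow> 0) F"
proof -
  have "((\<lambda>p. sqrt (Re (ip (y p) (y p)) - 2 * Re (ip (y p) t) + Re (ip t t)))
      \<longlongrightarrow> sqrt (Re (ip t t) - 2 * Re (ip t t) + Re (ip t t))) F"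
    by (intro tendsto_intros assms)
  moreover have "nm (df (y p) t) = sqrt (Re (ip (y p) (y p)) - 2 * Re (ip (y p) t) + Re (ip t t))" for p
    using nm_diff_sq[of "y p" t] assms(1,2) by (intro real_sqrt_unique[symmetric]) (simp_all add: nm_sq)
  ultimately show ?thesis
    by simp
qed

end

text \<open>Vectors whose Gram matrix converges to that of \<open>t\<close> can be moved near \<open>t\<close> by unitaries. In
  the induction step one vector is moved exactly, by a reflection, to the line spanned by its target,
  modulo the vectors \<open>G\<close> already fixed; its unit vector then joins \<open>G\<close>.\<close>

lemma (in ips) unitaries_from_gram_convergence:
  fixes u :: "'i \<Rightarrow> 'x \<Rightarrow> 'v" and t :: "'i \<Rightarrow> 'v" and F :: "'x filter"
  assumes "finite I" "finite G" "orthonormal H G"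
    and "\<And>i. i \<in> I \<Longrightarrow> t i \<in> C" "\<And>i p. i \<in> I \<Longrightarrow> u i p \<in> C"
    and "\<And>i j. i \<in> I \<Longrightarrow> j \<in> I \<Longrightarrow> ((\<lambda>p. ip (u i p) (u j p)) \<longlongrightarrow> ip (t i) (t j)) F"
    and "\<And>i g. i \<in> I \<Longrightarrow> g \<in> G \<Longrightarrow> ((\<lambda>p. ip (u i p) g) \<longlongrightarrow> ip (t i) g) F"
  shows "\<exists>T T'. (\<forall>p. unitary_pair H (T p) (T' p) \<and> (\<forall>g\<in>G. T p g = g)) \<and>
           (\<forall>i\<in>I. ((\<lambda>p. nm (df (T p (u i p)) (t i))) \<longlongrightarrow> 0) F)"
  using assms
proof (induction I arbitrary: G u)
  case empty
  have "unitary_pair H id id"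
    by (simp add: unitary_pair_def isometry_pair_def)
  then show ?case
    by (intro exI[of _ "\<lambda>_. id"]) (simp add: id_def)
next
  case (insert k I)
  note G = insert.prems(1,2)
  note tC = insert.prems(3) and uC = insert.prems(4)
  note gram = insert.prems(5) and gramG = insert.prems(6)
  have GC: "g \<in> C" if "g \<in> G" for g
    using G that by (auto simp: orthonormal_def)
  have tk: "t k \<in> C" and uk: "u k p \<in> C" for p
    using tC uC by auto
  from orthogonal_remainder[OF G tk] obtain r where r: "r \<in> C" 
    "\<forall>z\<in>C. ip z r = ip z (t k) - (\<Sum>g\<in>G. cnj (ip (t k) g) * ip z g)"
    "ip r r = ip (t k) (t k) - (\<Sum>g\<in>G. cnj (ip (t k) g) * ip (t k) g)"
    and rG: "\<forall>g\<in>G. ip r g = 0" 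
    by (elim exE conjE) (rule that; assumption)
  have fixed: "ip (U x) g = ip x g" if "isometry_pair H H U U'" "U g = g" "x \<in> C" "g \<in> C" for U U' x g
    using isometry_pair_inner[OF that(1,3,4)] that(2) by simp
  show ?case
  proof (cases "nm r = 0")
    \<comment> \<open>Here \<open>t k\<close> behaves like a combination of \<open>G\<close>, so no
      reflection is called for: unitaries fixing \<open>G\<close> keep each
      \<open>ip (u k p) g\<close>, and convergence of these products and of the norm forces
      convergence to \<open>t k\<close>.\<close>
    case True
    have rz: "ip z r = 0" if "z \<in> C" for z
      using cauchy_schwarz[OF that r(1)] True by simp
    have tz: "ip z (t k) = (\<Sum>g\<in>G. cnj (ip (t k) g) * ip z g)" if "z \<in> C" for z
      using r(2) rz that by simp
    from insert.IH[OF G tC uC gram gramG]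
    obtain T T' where T: "\<forall>p. unitary_pair H (T p) (T' p) \<and> (\<forall>g\<in>G. T p g = g)"
      "\<forall>i\<in>I. ((\<lambda>p. nm (df (T p (u i p)) (t i))) \<longlongrightarrow> 0) F"
      by auto
    have iso: "isometry_pair H H (T p) (T' p)" for p
      using T(1) by (simp add: unitary_pair_def)
    have TC: "T p x \<in> C" if "x \<in> C" for p x
      using isometry_pairD(1)[OF iso that] .
    have Tg: "T p g = g" if "g \<in> G" for p g
      using T(1) that by simp
    have "((\<lambda>p. nm (df (T p (u k p)) (t k))) \<longlongrightarrow> 0) F"
    proof (rule tendsto_nm_diff_zero)
      show "((\<lambda>p. ip (T p (u k p)) (T p (u k p))) \<longlongrightarrow> ip (t k) (t k)) F"
        using gram[of k k] uk by (simp add: isometry_pair_inner[OF iso])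
      have "ip (T p (u k p)) (t k) = (\<Sum>g\<in>G. cnj (ip (t k) g) * ip (u k p) g)" for p
        unfolding tz[OF TC[OF uk]] using fixed[OF iso Tg uk GC] by (intro sum.cong) auto
      moreover have "((\<lambda>p. \<Sum>g\<in>G. cnj (ip (t k) g) * ip (u k p) g) \<longlongrightarrow> 
          (\<Sum>g\<in>G. cnj (ip (t k) g) * ip (t k) g)) F"
        by (intro tendsto_intros gramG) auto
      ultimately show "((\<lambda>p. ip (T p (u k p)) (t k)) \<longlongrightarrow> ip (t k) (t k)) F"
        using tz[OF tk] by simp
    qed (use TC uk tk in auto)
    with T show ?thesis
      by - (rule exI[of _ T], rule exI[of _ T'], simp)
  next
    case False
    have "\<forall>p. \<exists>y. y \<in> C \<and> (\<forall>z\<in>C. ip z y = ip z (u k p) - (\<Sum>g\<in>G. cnj (ip (u k p) g) * ip z g)) \<and>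
        (\<forall>g\<in>G. ip y g = 0) \<and>
           ip y y = ip (u k p) (u k p) - (\<Sum>g\<in>G. cnj (ip (u k p) g) * ip (u k p) g)"
      by (intro allI orthogonal_remainder[OF G uk])
    from choice[OF this] obtain s where s: "\<forall>p. s p \<in> C \<and>
      (\<forall>z\<in>C. ip z (s p) = ip z (u k p) - (\<Sum>g\<in>G. cnj (ip (u k p) g) * ip z g)) \<and>
        (\<forall>g\<in>G. ip (s p) g = 0) \<and>
           ip (s p) (s p) = ip (u k p) (u k p) - (\<Sum>g\<in>G. cnj (ip (u k p) g) * ip (u k p) g)" ..
    have sC: "s p \<in> C" and sz: "z \<in> C \<Longrightarrow> ip z (s p) = ip z (u k p) - (\<Sum>g\<in>G. cnj (ip (u k p) g) * ip z g)"
      and sG: "g \<in> G \<Longrightarrow> ip (s p) g = 0"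
      and ss: "ip (s p) (s p) = ip (u k p) (u k p) - (\<Sum>g\<in>G. cnj (ip (u k p) g) * ip (u k p) g)" for p z g
      using s by simp_all
    have "((\<lambda>p. sqrt (Re (ip (s p) (s p)))) \<longlongrightarrow> sqrt (Re (ip r r))) F"
      unfolding ss r(3) by (intro tendsto_intros gram gramG) auto
    then have nms: "((\<lambda>p. nm (s p)) \<longlongrightarrow> nm r) F"
      by (simp add: hnorm_def)
    have unit: "ip (hscale H (1 / complex_of_real (nm x)) x) (hscale H (1 / complex_of_real (nm x)) x) = 1"
      if "x \<in> C" "nm x \<noteq> 0" for x
      using that by (simp add: inner_self[OF that(1)] power2_eq_square)
    define f where "f = hscale H (1 / complex_of_real (nm r)) r"
    \<comment> \<open>The default \<open>f\<close> keeps \<open>w p\<close> a unit vector orthogonal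
      to \<open>G\<close> for every \<open>p\<close>. Eventually it does not occur, since
      \<open>nm (s p)\<close> tends to the nonzero \<open>nm r\<close>.\<close>
    define w where "w p = (if nm (s p) = 0 then f else hscale H (1 / complex_of_real (nm (s p))) (s p))" for p
    have f: "f \<in> C" "ip f f = 1" "\<And>g. g \<in> G \<Longrightarrow> ip f g = 0"
      unfolding f_def using r(1) rG False unit[of r] GC by auto
    have w: "w p \<in> C" "ip (w p) (w p) = 1" "g \<in> G \<Longrightarrow> ip (w p) g = 0" for p g
      unfolding w_def using f sC sG unit[of "s p"] GC by auto
    have G': "orthonormal H (insert f G)" "finite (insert f G)"
      using G f GC inner_cnj[OF f(1) GC] by (auto simp: orthonormal_def)
    have "\<forall>p. \<exists>U U'. unitary_pair H U U' \<and> U (w p) = f \<and> (\<forall>x\<in>C. ip x (w p) = 0 \<longrightarrow> ip x f = 0 \<longrightarrow> U x = x)"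
      by (intro allI reflection_exists w f)
    from choice[OF this] obtain R where "\<forall>p. \<exists>U'. unitary_pair H (R p) U' \<and> R p (w p) = f \<and>
        (\<forall>x\<in>C. ip x (w p) = 0 \<longrightarrow> ip x f = 0 \<longrightarrow> R p x = x)" ..
    from choice[OF this] obtain R' where R: "\<forall>p. unitary_pair H (R p) (R' p) \<and> R p (w p) = f \<and>
        (\<forall>x\<in>C. ip x (w p) = 0 \<longrightarrow> ip x f = 0 \<longrightarrow> R p x = x)" ..
    have Rw: "R p (w p) = f" for p
      using R by simp
    have Rg: "R p g = g" if "g \<in> G" for p g
    proof -
      have "ip g (w p) = 0" "ip g f = 0"
        using that f(3) w(3)[of g p] inner_cnj[OF f(1) GC] inner_cnj[OF w(1) GC] by auto
      then show ?thesis
        using R GC[OF that] by simp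
    qed
    have isoR: "isometry_pair H H (R p) (R' p)" for p
      using R by (simp add: unitary_pair_def)
    have RC: "R p x \<in> C" if "x \<in> C" for p x
      using isometry_pairD(1)[OF isoR that] .
    \<comment> \<open>The product of \<open>R p (u i p)\<close> with \<open>f\<close> is that of
      \<open>u i p\<close> with \<open>w p\<close>. This limit is therefore the condition that the
      induction hypothesis imposes for the new fixed vector \<open>f\<close>.\<close>
    have lim: "((\<lambda>p. ip (u i p) (w p)) \<longlongrightarrow> ip (t i) f) F" if i: "i \<in> insert k I" for i
    proof -
      have "((\<lambda>p. ip (u i p) (s p) / nm (s p)) \<longlongrightarrow> ip (t i) r / nm r) F"
        unfolding sz[OF uC[OF i]] bspec[OF r(2) tC[OF i]]
        by (intro tendsto_intros gram gramG nms i) (use False in auto)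
      moreover have "\<forall>\<^sub>F p in F. ip (u i p) (s p) / nm (s p) = ip (u i p) (w p)"
        using tendsto_imp_eventually_ne[OF nms False]
        by (rule eventually_mono) (use sC uC[OF i] in \<open>auto simp: w_def\<close>)
      moreover have "ip (t i) f = ip (t i) r / nm r"
        using r(1) tC[OF i] by (simp add: f_def)
      ultimately show ?thesis
        using Lim_transform_eventually by fastforce
    qed
    have "\<exists>T T'. (\<forall>p. unitary_pair H (T p) (T' p) \<and> (\<forall>g\<in>insert f G. T p g = g)) \<and>
           (\<forall>i\<in>I. ((\<lambda>p. nm (df (T p (R p (u i p))) (t i))) \<longlongrightarrow> 0) F)"
    proof (rule insert.IH[OF G'(2,1)])
      fix i j assume "i \<in> I" "j \<in> I"
      then show "((\<lambda>p. ip (R p (u i p)) (R p (u j p))) \<longlongrightarrow> ip (t i) (t j)) F"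
        using gram[of i j] uC by (simp add: isometry_pair_inner[OF isoR])
    next
      fix i g assume i: "i \<in> I" and g: "g \<in> insert f G"
      show "((\<lambda>p. ip (R p (u i p)) g) \<longlongrightarrow> ip (t i) g) F"
      proof (cases "g \<in> G")
        case True
        then show ?thesis
          using gramG[of i g] i uC fixed[OF isoR Rg _ GC] by simp
      next
        case False
        then have "g = f"
          using g by simp
        moreover have "ip (R p (u i p)) f = ip (u i p) (w p)" for p
          using isometry_pair_inner[OF isoR, of "u i p" "w p" p] Rw w(1) uC i by simp
        ultimately show ?thesis
          using lim[of i] i by simp
      qed
    qed (use tC uC RC in auto)
    then obtain S S' where S: "\<forall>p. unitary_pair H (S p) (S' p) \<and> (\<forall>g\<in>insert f G. S p g = g)"
      "\<forall>i\<in>I. ((\<lambda>p. nm (df (S p (R p (u i p))) (t i))) \<longlongrightarrow> 0) F"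
      by (elim exE conjE)
    define T where "T p = S p \<circ> R p" for p
    define T' where "T' p = R' p \<circ> S' p" for p
    have T: "unitary_pair H (T p) (T' p)" for p
      unfolding T_def T'_def using R S(1) by (intro unitary_pair_comp) simp_all
    have iso: "isometry_pair H H (T p) (T' p)" for p
      using T by (simp add: unitary_pair_def)
    have TC: "T p x \<in> C" if "x \<in> C" for p x
      using isometry_pairD(1)[OF iso that] .
    have Tg: "T p g = g" if "g \<in> G" for p g
      using S(1) Rg that by (simp add: T_def)
    have Tw: "T p (w p) = f" for p
      using S(1) Rw by (simp add: T_def)
    have "((\<lambda>p. nm (df (T p (u k p)) (t k))) \<longlongrightarrow> 0) F"
    proof (rule tendsto_nm_diff_zero)
      show "((\<lambda>p. ip (T p (u k p)) (T p (u k p))) \<longlongrightarrow> ip (t k) (t k)) F"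
        using gram[of k k] uk by (simp add: isometry_pair_inner[OF iso])
      \<comment> \<open>Pairing with \<open>t k\<close> involves only \<open>f\<close> and
        \<open>G\<close>. Since \<open>T p\<close> carries \<open>w p\<close> to \<open>f\<close>
        and fixes \<open>G\<close>, the unitary drops out of the limit.\<close>
      have eq: "ip z (t k) = nm r * ip z f + (\<Sum>g\<in>G. cnj (ip (t k) g) * ip z g)" if "z \<in> C" for z
        using r(1,2) that False by (simp add: f_def)
      have "ip (T p (u k p)) (t k) = nm r * ip (u k p) (w p) + (\<Sum>g\<in>G. cnj (ip (t k) g) * ip (u k p) g)" for p
        unfolding eq[OF TC[OF uk]] 
        using fixed[OF iso Tg uk GC] isometry_pair_inner[OF iso uk w(1), of p p p] Tw by simp
      moreover have "((\<lambda>p. nm r * ip (u k p) (w p) + (\<Sum>g\<in>G. cnj (ip (t k) g) * ip (u k p) g)) \<longlongrightarrow> 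
          nm r * ip (t k) f + (\<Sum>g\<in>G. cnj (ip (t k) g) * ip (t k) g)) F"
        by (intro tendsto_intros gramG lim) auto
      ultimately show "((\<lambda>p. ip (T p (u k p)) (t k)) \<longlongrightarrow> ip (t k) (t k)) F"
        unfolding eq[OF tk] by simp
    qed (use TC uk tk in auto)
    with S T Tg show ?thesis
      by - (rule exI[of _ T], rule exI[of _ T'], simp add: T_def o_def)
  qed
qed

section \<open>Positive functionals on C*-algebras\<close>

locale cstar =
  fixes cmult :: "complex \<Rightarrow> 'a::{real_normed_algebra_1,banach} \<Rightarrow> 'a" and star :: "'a \<Rightarrow> 'a"
  assumes cstar_algebra: "cstar_algebra cmult star"
begin

lemma cmult_of_real: "cmult (complex_of_real r) x = scaleR r x"
  and cmult_cmult: "cmult c (cmult d x) = cmult (c * d) x"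
  and cmult_mult_left: "cmult c x * y = cmult c (x * y)"
  and cmult_mult_right: "x * cmult c y = cmult c (x * y)"
  and star_star [simp]: "star (star x) = x"
  and star_add: "star (x + y) = star x + star y"
  and star_cmult: "star (cmult c x) = cmult (cnj c) (star x)"
  and star_mult: "star (x * y) = star y * star x"
  and norm_star_mult: "norm (star x * x) = norm x ^ 2"
  using cstar_algebra unfolding cstar_algebra_def by metis+

lemma cmult_one [simp]: "cmult 1 x = x"
  using cmult_of_real[of 1 x] by simp

lemma cmult_minus_one: "cmult (- 1) x = - x"
  using cmult_of_real[of "-1" x] by simp

lemma cmult_zero [simp]: "cmult 0 x = 0"
  using cmult_of_real[of 0 x] by simp

lemma star_zero [simp]: "star 0 = 0"
  using star_add[of 0 0] by simp

lemma star_minus: "star (- x) = - star x"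
  using star_cmult[of "-1" x] by (simp add: cmult_minus_one)

lemma star_diff: "star (x - y) = star x - star y"
  using star_add[of x "- y"] by (simp add: star_minus)

lemma star_scaleR: "star (r *\<^sub>R x) = r *\<^sub>R star x"
  using star_cmult[of "complex_of_real r" x] by (simp add: cmult_of_real)

lemma star_one [simp]: "star 1 = 1"
  using star_mult[of "star 1" 1] by simp

lemma norm_star [simp]: "norm (star x) = norm x"
proof -
  have le: "norm x \<le> norm (star x)" for x
  proof (cases "norm x = 0")
    case False
    have "norm x * norm x \<le> norm (star x) * norm x"
      using norm_star_mult[of x] norm_mult_ineq[of "star x" x] by (simp add: power2_eq_square)
    with False show ?thesis
      by simp
  qed simp
  show ?thesis
    using le[of x] le[of "star x"] by simp
qed

text \<open>The square root \<open>1 - y\<close> of \<open>1 - h\<close> is found by solving \<open>y = (h + y\<^sup>2) / 2\<close>, a contraction of the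
  self-adjoint part of the ball of radius \<open>1 - sqrt (1 - \<parallel>h\<parallel>)\<close>.\<close>

lemma one_minus_eq_square:
  assumes h: "star h = h" "norm h < 1"
  shows "\<exists>k. star k = k \<and> k * k = 1 - h"
proof -
  define r where "r = 1 - sqrt (1 - norm h)"
  have r: "0 \<le> r" "r < 1"
    using h(2) by (auto simp: r_def)
  \<comment> \<open>\<open>r\<close> is the smaller root of
    \<open>r\<^sup>2 - 2 * r + norm h = 0\<close>. This makes the ball of radius \<open>r\<close>
    invariant, and \<open>r < 1\<close> is also the Lipschitz constant on it.\<close>
  have req: "norm h + r\<^sup>2 = 2 * r"
    using h(2) by (simp add: r_def power2_diff)
  define S where "S = {y. norm y \<le> r \<and> star y = y}"
  have "bounded_linear star"
    by (rule bounded_linear_intro[of _ 1]) (auto simp: star_add star_scaleR)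
  then have "continuous_on UNIV star"
    by (rule linear_continuous_on)
  then have "closed S"
    unfolding S_def by (intro closed_Collect_conj closed_Collect_le closed_Collect_eq continuous_intros)
  then have "complete S"
    by (simp add: complete_eq_closed)
  define f where "f y = (1/2) *\<^sub>R (h + y * y)" for y
  have "\<exists>!y\<in>S. f y = y"
  proof (rule Banach_fix)
    show "S \<noteq> {}"
      using r by (auto simp: S_def intro!: exI[of _ 0])
    show "f ` S \<subseteq> S"
    proof (clarsimp simp: S_def, intro conjI)
      fix y assume y: "norm y \<le> r" "star y = y"
      have "norm (h + y * y) \<le> norm h + norm y * norm y"
        using norm_triangle_ineq[of h "y * y"] norm_mult_ineq[of y y] by linarith
      also have "norm y * norm y \<le> r * r"
        using y r by (intro mult_mono) auto
      finally show "norm (f y) \<le> r"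
        using req by (simp add: f_def power2_eq_square)
      show "star (f y) = f y"
        using y h by (simp add: f_def star_scaleR star_add star_mult)
    qed
    show "dist (f x) (f y) \<le> r * dist x y" if "x \<in> S" "y \<in> S" for x y
    proof -
      have "f x - f y = (1/2) *\<^sub>R (x * (x - y) + (x - y) * y)"
        by (simp add: f_def algebra_simps)
      then have "norm (f x - f y) = norm (x * (x - y) + (x - y) * y) / 2"
        by simp
      also have "\<dots> \<le> (norm x * norm (x - y) + norm (x - y) * norm y) / 2"
        using norm_triangle_ineq[of "x * (x - y)" "(x - y) * y"] norm_mult_ineq[of x "x - y"]
          norm_mult_ineq[of "x - y" y] by simp
      also have "\<dots> \<le> (r * norm (x - y) + norm (x - y) * r) / 2"
        using that by (intro divide_right_mono add_mono mult_mono) (auto simp: S_def r)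
      finally show ?thesis
        by (simp add: dist_norm)
    qed
  qed (use r \<open>complete S\<close> in auto)
  then obtain y where y: "star y = y" "f y = y"
    by (auto simp: S_def)
  have "h + y * y = 2 *\<^sub>R y"
    using arg_cong[OF y(2), of "\<lambda>y. 2 *\<^sub>R y"] by (simp add: f_def)
  then have "(1 - y) * (1 - y) = 1 - h"
    by (simp add: algebra_simps scaleR_2)
  moreover have "star (1 - y) = 1 - y"
    using y by (simp add: star_diff)
  ultimately show ?thesis
    by blast
qed

section \<open>Positive functionals and the GNS form\<close>

definition positive_functional :: "('a \<Rightarrow> complex) \<Rightarrow> bool" where
  "positive_functional \<phi> \<longleftrightarrow> (\<forall>a b. \<phi> (a + b) = \<phi> a + \<phi> b) \<and> (\<forall>c a. \<phi> (cmult c a) = c * \<phi> a) \<and>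
     (\<forall>a. Im (\<phi> (star a * a)) = 0 \<and> Re (\<phi> (star a * a)) \<ge> 0)"

context
  fixes \<phi> assumes pos: "positive_functional \<phi>"
begin

lemma pf_add: "\<phi> (a + b) = \<phi> a + \<phi> b"
  and pf_cmult: "\<phi> (cmult c a) = c * \<phi> a"
  and pf_Im: "Im (\<phi> (star a * a)) = 0"
  and pf_ge0: "0 \<le> Re (\<phi> (star a * a))"
  using pos unfolding positive_functional_def by auto

lemma pf_minus: "\<phi> (- a) = - \<phi> a"
  using pf_cmult[of "-1" a] by (simp add: cmult_minus_one)

lemma pf_diff: "\<phi> (a - b) = \<phi> a - \<phi> b"
  using pf_add[of a "- b"] by (simp add: pf_minus)

lemma pf_scaleR: "\<phi> (r *\<^sub>R a) = of_real r * \<phi> a"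
  using pf_cmult[of "of_real r" a] by (simp add: cmult_of_real)

text \<open>Hermitian symmetry comes from polarization: \<open>\<phi> ((a + c b)\<^sup>* (a + c b))\<close> is real for
  \<open>c = 1\<close> and \<open>c = \<i>\<close>.\<close>

lemma pf_hermitian: "\<phi> (star a * b) = cnj (\<phi> (star b * a))"
proof -
  have "\<phi> (star (a + cmult c b) * (a + cmult c b)) =
     \<phi> (star a * a) + c * \<phi> (star a * b) + cnj c * \<phi> (star b * a) + cnj c * c * \<phi> (star b * b)" for c
    by (simp add: star_add star_cmult algebra_simps cmult_mult_left cmult_mult_right pf_add pf_cmult cmult_cmult)
  note eq = this
  have "Im (c * \<phi> (star a * b) + cnj c * \<phi> (star b * a)) = 0" if "c = 1 \<or> c = \<i>" for c
    using pf_Im[of "a + cmult c b"] pf_Im[of a] pf_Im[of b] that unfolding eq by auto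
  from this[of 1] this[of \<i>] show ?thesis
    by (simp add: complex_eq_iff)
qed

text \<open>For \<open>N > M\<close> the element \<open>1 - h / N\<close> is the square of a
  self-adjoint \<open>k\<close>, and positivity at \<open>k * b\<close> rearranges to the bound with
  \<open>N\<close>. Strictness puts \<open>h / N\<close> into the open unit ball, where the square
  root exists; then \<open>N\<close> decreases to \<open>M\<close>.\<close>

lemma pf_conj_ge0:
  assumes h: "star h = h" "norm h \<le> M"
  shows "Re (\<phi> (star b * h * b)) \<le> M * Re (\<phi> (star b * b))"
proof -
  have "Re (\<phi> (star b * h * b)) \<le> N * Re (\<phi> (star b * b))" if "N > M" for N
  proof -
    have N: "N > 0"
      using that h(2) norm_ge_zero[of h] by linarith
    have "norm ((1/N) *\<^sub>R h) < 1"
      using N that h(2) by (simp add: field_simps)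
    then obtain k where k: "star k = k" "k * k = 1 - (1/N) *\<^sub>R h"
      using one_minus_eq_square[of "(1/N) *\<^sub>R h"] h(1) by (auto simp: star_scaleR)
    have "star (k * b) * (k * b) = star b * (k * k) * b"
      using k(1) by (simp add: star_mult mult.assoc)
    also have "\<dots> = star b * b - (1/N) *\<^sub>R (star b * h * b)"
      unfolding k(2) by (simp add: algebra_simps)
    finally have "0 \<le> Re (\<phi> (star b * b - (1/N) *\<^sub>R (star b * h * b)))"
      using pf_ge0[of "k * b"] by simp
    then show ?thesis
      using N by (simp add: pf_diff pf_scaleR field_simps)
  qed
  note le = this
  let ?P = "Re (\<phi> (star b * b))"
  have P: "0 \<le> ?P"
    by (rule pf_ge0)
  show ?thesis
  proof (rule field_le_epsilon)
    fix e :: real assume e: "e > 0"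
    have "Re (\<phi> (star b * h * b)) \<le> (M + e / (?P + 1)) * ?P"
      using e P by (intro le) (simp add: add_nonneg_pos)
    also have "\<dots> = M * ?P + e * (?P / (?P + 1))"
      by (simp add: algebra_simps)
    also have "\<dots> \<le> M * ?P + e"
      using e P by (intro add_left_mono mult_left_le) (auto simp: divide_le_eq_1)
    finally show "Re (\<phi> (star b * h * b)) \<le> M * ?P + e" .
  qed
qed

text \<open>The C*-identity turns the bound for \<open>h = star a * a\<close> into one with
  \<open>(norm a)\<^sup>2\<close>. This is the boundedness of left multiplication in the GNS
  seminorm; for vector functionals it makes representations contractive.\<close>

lemma pf_mult_bound: "Re (\<phi> (star (a * b) * (a * b))) \<le> (norm a)\<^sup>2 * Re (\<phi> (star b * b))"
  using pf_conj_ge0[of "star a * a" "(norm a)\<^sup>2" b] norm_star_mult[of a]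
  by (simp add: star_mult mult.assoc)

text \<open>The form may have null vectors, so only a \<open>semi_ips\<close> results. The order
  \<open>star b * a\<close> makes it linear in the first argument.\<close>

definition pre_gns :: "'a hspace" where
  "pre_gns = \<lparr>hcarrier = UNIV, hadd = (+), hscale = cmult, hzero = 0, hinner = (\<lambda>a b. \<phi> (star b * a))\<rparr>"

lemma pre_gns_simps [simp]:
  "hcarrier pre_gns = UNIV" "hadd pre_gns = (+)" "hscale pre_gns = cmult" "hzero pre_gns = 0"
  "hinner pre_gns a b = \<phi> (star b * a)" "hdiff pre_gns a b = a - b"
  by (simp_all add: pre_gns_def hdiff_def cmult_minus_one)

lemma semi_ips_pre_gns: "semi_ips pre_gns"
proof
  show "hinner pre_gns y x = cnj (hinner pre_gns x y)" for x y
    using pf_hermitian[of x y] by simp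
  show "hinner pre_gns (hzero pre_gns) z = 0" for z
    using pf_cmult[of 0 0] by simp
qed (simp_all add: distrib_left pf_add cmult_mult_right pf_cmult pf_Im pf_ge0)

lemma pf_bound: "cmod (\<phi> a) \<le> Re (\<phi> 1) * norm a"
proof -
  interpret semi_ips pre_gns
    by (rule semi_ips_pre_gns)
  have "cmod (\<phi> a) \<le> nm a * nm 1"
    using cauchy_schwarz[of a 1] by simp
  also have "(nm a)\<^sup>2 \<le> (norm a * nm 1)\<^sup>2"
    using pf_mult_bound[of a 1] by (simp add: nm_sq power_mult_distrib)
  then have "nm a \<le> norm a * nm 1"
    by (rule power2_le_imp_le) simp
  then have "nm a * nm 1 \<le> norm a * nm 1 * nm 1"
    using nm_ge0[of 1] by (intro mult_right_mono) auto
  also have "\<dots> = norm a * (nm 1)\<^sup>2"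
    by (simp add: power2_eq_square)
  also have "(nm 1)\<^sup>2 = Re (\<phi> 1)"
    by (simp add: nm_sq)
  finally show ?thesis
    by (simp add: mult.commute)
qed

end

text \<open>By \<open>pf_bound\<close>, which is Cauchy-Schwarz against \<open>1\<close>, the
  supremum over the unit ball is attained at \<open>1\<close>. As \<open>\<phi> 1\<close> is real
  and nonnegative, norm one means value one.\<close>

lemma states_iff: "\<phi> \<in> states cmult star \<longleftrightarrow> positive_functional \<phi> \<and> \<phi> 1 = 1"
proof -
  have key: "(bdd_above ((\<lambda>a. cmod (\<phi> a)) ` {a. norm a \<le> 1}) \<and>
     (SUP a\<in>{a. norm a \<le> 1}. cmod (\<phi> a)) = 1) \<longleftrightarrow> \<phi> 1 = 1" if pos: "positive_functional \<phi>"
  proof -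
    have re: "0 \<le> Re (\<phi> 1)" "Im (\<phi> 1) = 0"
      using pf_ge0[OF pos, of 1] pf_Im[OF pos, of 1] by simp_all
    have b: "cmod (\<phi> a) \<le> cmod (\<phi> 1)" if "norm a \<le> 1" for a
    proof -
      have "cmod (\<phi> a) \<le> Re (\<phi> 1) * norm a"
        by (rule pf_bound[OF pos])
      also have "\<dots> \<le> Re (\<phi> 1) * 1"
        using re that by (intro mult_left_mono) auto
      finally show ?thesis
        using complex_Re_le_cmod[of "\<phi> 1"] by simp
    qed
    have bdd: "bdd_above ((\<lambda>a. cmod (\<phi> a)) ` {a. norm a \<le> 1})"
      using b by (intro bdd_aboveI[of _ "cmod (\<phi> 1)"]) auto
    have "(SUP a\<in>{a. norm a \<le> 1}. cmod (\<phi> a)) = cmod (\<phi> 1)"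
      using b by (intro cSup_eq_maximum) auto
    moreover have "cmod (\<phi> 1) = 1 \<longleftrightarrow> \<phi> 1 = 1"
      using re by (auto simp: cmod_eq_Re complex_eq_iff)
    ultimately show ?thesis
      using bdd by simp
  qed
  then show ?thesis
    unfolding states_def positive_functional_def mem_Collect_eq by argo
qed

end

section \<open>Completion of a semi-inner product space\<close>

text \<open>Classes modulo null vectors are represented by chosen elements, which keeps the quotient
  in the type of \<open>S\<close>. The choice depends only on the class, because the predicate under
  \<open>SOME\<close> does.\<close>

definition null_rep :: "'v hspace \<Rightarrow> 'v \<Rightarrow> 'v" where
  "null_rep S x = (SOME y. y \<in> hcarrier S \<and> hnorm S (hdiff S x y) = 0)"

definition null_quotient :: "'v hspace \<Rightarrow> 'v hspace" where
  "null_quotient S = \<lparr>hcarrier = null_rep S ` hcarrier S,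
     hadd = (\<lambda>x y. null_rep S (hadd S x y)), hscale = (\<lambda>c x. null_rep S (hscale S c x)),
     hzero = null_rep S (hzero S), hinner = hinner S\<rparr>"

text \<open>Sequences at distance zero are not identified here; \<open>null_quotient\<close> does
  that afterwards. The \<open>lim\<close> is meaningful on the carrier, where the inner products
  converge.\<close>

definition cauchy_space :: "'v hspace \<Rightarrow> (nat \<Rightarrow> 'v) hspace" where
  "cauchy_space S =
     \<lparr>hcarrier = {s. (\<forall>n. s n \<in> hcarrier S) \<and>
        (\<forall>e>0. \<exists>N. \<forall>m\<ge>N. \<forall>n\<ge>N. hnorm S (hdiff S (s m) (s n)) < e)},
      hadd = (\<lambda>s t n. hadd S (s n) (t n)), hscale = (\<lambda>c s n. hscale S c (s n)),
      hzero = (\<lambda>n. hzero S), hinner = (\<lambda>s t. lim (\<lambda>n. hinner S (s n) (t n)))\<rparr>"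

lemma null_quotient_simps:
  "hcarrier (null_quotient S) = null_rep S ` hcarrier S"
  "hadd (null_quotient S) x y = null_rep S (hadd S x y)"
  "hscale (null_quotient S) c x = null_rep S (hscale S c x)"
  "hzero (null_quotient S) = null_rep S (hzero S)"
  "hinner (null_quotient S) x y = hinner S x y"
  "hnorm (null_quotient S) x = hnorm S x"
  by (simp_all add: null_quotient_def hnorm_def)

lemma cauchy_space_simps:
  "s \<in> hcarrier (cauchy_space S) \<longleftrightarrow> (\<forall>n. s n \<in> hcarrier S) \<and>
        (\<forall>e>0. \<exists>N. \<forall>m\<ge>N. \<forall>n\<ge>N. hnorm S (hdiff S (s m) (s n)) < e)"
  "hadd (cauchy_space S) s t = (\<lambda>n. hadd S (s n) (t n))"
  "hscale (cauchy_space S) c s = (\<lambda>n. hscale S c (s n))"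
  "hzero (cauchy_space S) = (\<lambda>n. hzero S)"
  "hinner (cauchy_space S) s t = lim (\<lambda>n. hinner S (s n) (t n))"
  "hdiff (cauchy_space S) s t = (\<lambda>n. hdiff S (s n) (t n))"
  by (simp_all add: cauchy_space_def hdiff_def)

lemma cauchy_spaceD:
  "\<lbrakk>s \<in> hcarrier (cauchy_space S); 0 < e\<rbrakk> \<Longrightarrow> \<exists>N. \<forall>m\<ge>N. \<forall>n\<ge>N. hnorm S (hdiff S (s m) (s n)) < e"
  by (simp add: cauchy_space_simps)

context semi_ips
begin

lemma nm_diff_self [simp]: "x \<in> C \<Longrightarrow> nm (df x x) = 0"
  using nm_cong[of "df x x" "hzero H"] by simp

section \<open>The quotient by null vectors\<close>

lemma null_rep_spec:
  assumes "x \<in> C"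
  shows "null_rep H x \<in> C" "nm (df x (null_rep H x)) = 0"
proof -
  have "\<exists>y. y \<in> C \<and> nm (df x y) = 0"
    using assms by (intro exI[of _ x]) simp
  from someI_ex[OF this] show "null_rep H x \<in> C" "nm (df x (null_rep H x)) = 0"
    unfolding null_rep_def by auto
qed

lemma inner_null_rep [simp]:
  assumes "x \<in> C" "z \<in> C"
  shows "ip (null_rep H x) z = ip x z" "ip z (null_rep H x) = ip z x"
proof -
  show *: "ip (null_rep H x) z = ip x z"
    using cauchy_schwarz[of "df x (null_rep H x)" z] null_rep_spec assms by simp
  show "ip z (null_rep H x) = ip z x"
    using * inner_cnj[of "null_rep H x" z] inner_cnj[of x z] null_rep_spec assms by simp
qed

lemma null_rep_cong:
  assumes "x \<in> C" "y \<in> C" "\<And>z. z \<in> C \<Longrightarrow> ip x z = ip y z"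
  shows "null_rep H x = null_rep H y"
proof -
  have "nm (df x w) = nm (df y w)" if "w \<in> C" for w
    using that assms by (intro nm_cong) auto
  then have "(\<lambda>w. w \<in> C \<and> nm (df x w) = 0) = (\<lambda>w. w \<in> C \<and> nm (df y w) = 0)"
    by auto
  then show ?thesis
    unfolding null_rep_def by simp
qed

lemma null_quotient_in: "x \<in> hcarrier (null_quotient H) \<Longrightarrow> x \<in> C"
  and null_rep_in_quotient: "x \<in> C \<Longrightarrow> null_rep H x \<in> hcarrier (null_quotient H)"
  by (auto simp: null_quotient_simps null_rep_spec)

lemma null_rep_idem: "x \<in> hcarrier (null_quotient H) \<Longrightarrow> null_rep H x = x"
  unfolding null_quotient_simps by (auto intro!: null_rep_cong simp: null_rep_spec)

lemma ips_null_quotient: "ips (null_quotient H)"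
proof
  fix x y assume xy: "x \<in> hcarrier (null_quotient H)" "y \<in> hcarrier (null_quotient H)"
    "\<And>z. z \<in> hcarrier (null_quotient H) \<Longrightarrow> hinner (null_quotient H) x z = hinner (null_quotient H) y z"
  have "ip x z = ip y z" if z: "z \<in> C" for z
    using xy(3)[OF null_rep_in_quotient[OF z]] z xy(1,2)[THEN null_quotient_in]
    by (simp add: null_quotient_simps)
  then have "null_rep H x = null_rep H y"
    using xy(1,2)[THEN null_quotient_in] by (intro null_rep_cong)
  then show "x = y"
    using xy null_rep_idem by simp
next
  fix x y assume "x \<in> hcarrier (null_quotient H)" "y \<in> hcarrier (null_quotient H)"
  then show "hinner (null_quotient H) y x = cnj (hinner (null_quotient H) x y)"
    unfolding null_quotient_simps(5) by (intro inner_cnj null_quotient_in)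
qed (auto simp: null_quotient_simps null_rep_spec)

lemma nm_diff_quotient:
  assumes "x \<in> hcarrier (null_quotient H)" "y \<in> hcarrier (null_quotient H)"
  shows "hnorm (null_quotient H) (hdiff (null_quotient H) x y) = nm (df x y)"
  using assms[THEN null_quotient_in] null_rep_spec
  by (auto simp: null_quotient_simps hdiff_def intro!: nm_cong)

text \<open>Limits are found before the quotient is taken; replacing a limit by its representative
  changes no distance.\<close>

lemma hilbert_null_quotient:
  assumes complete: "\<And>s. \<lbrakk>\<And>n. s n \<in> C; \<forall>e>0. \<exists>N. \<forall>m\<ge>N. \<forall>n\<ge>N. nm (df (s m) (s n)) < e\<rbrakk>
    \<Longrightarrow> \<exists>l\<in>C. \<forall>e>0. \<exists>N. \<forall>n\<ge>(N::nat). nm (df (s n) l) < e"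
  shows "hilbert (null_quotient H)"
proof -
  interpret Q: ips "null_quotient H"
    by (rule ips_null_quotient)
  show ?thesis
  proof
    fix s :: "nat \<Rightarrow> 'v"
    assume s: "\<And>n. s n \<in> Q.C" and cau: "\<forall>e>0. \<exists>N. \<forall>m\<ge>N. \<forall>n\<ge>N. Q.nm (Q.df (s m) (s n)) < e"
    have sC: "s n \<in> C" for n
      using s null_quotient_in by simp
    have "\<forall>e>0. \<exists>N. \<forall>m\<ge>N. \<forall>n\<ge>N. nm (df (s m) (s n)) < e"
      using cau s by (simp add: nm_diff_quotient)
    from complete[OF sC this] obtain l where l: "l \<in> C" "\<forall>e>0. \<exists>N. \<forall>n\<ge>N. nm (df (s n) l) < e"
      by auto
    have "Q.nm (Q.df (s n) (null_rep H l)) = nm (df (s n) l)" for n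
      unfolding nm_diff_quotient[OF s null_rep_in_quotient[OF l(1)]]
      using sC l null_rep_spec by (intro nm_cong) auto
    with l show "\<exists>l\<in>Q.C. \<forall>e>0. \<exists>N. \<forall>n\<ge>N. Q.nm (Q.df (s n) l) < e"
      by (intro bexI[of _ "null_rep H l"] null_rep_in_quotient) simp_all
  qed
qed

section \<open>The space of Cauchy sequences\<close>

lemma cauchy_nm_bounded:
  assumes "s \<in> hcarrier (cauchy_space H)"
  shows "\<exists>B>0. \<forall>n. nm (s n) \<le> B"
proof -
  have sC: "s n \<in> C" for n
    using assms by (simp add: cauchy_space_simps)
  have "\<exists>N. \<forall>m\<ge>N. \<forall>n\<ge>N. nm (df (s m) (s n)) < 1"
    by (rule cauchy_spaceD[OF assms]) simp
  then obtain N where N: "\<forall>m\<ge>N. \<forall>n\<ge>N. nm (df (s m) (s n)) < 1" ..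
  define B where "B = Max ((\<lambda>n. nm (s n)) ` {..N}) + 1"
  have le: "nm (s n) \<le> B" for n
  proof (cases "n \<le> N")
    case True
    then have "nm (s n) \<le> Max ((\<lambda>n. nm (s n)) ` {..N})"
      by (intro Max_ge) auto
    then show ?thesis
      by (simp add: B_def)
  next
    case False
    have "nm (s N) \<le> Max ((\<lambda>n. nm (s n)) ` {..N})"
      by (intro Max_ge) auto
    moreover have "nm (df (s n) (s N)) < 1"
      using N False by simp
    ultimately show ?thesis
      using nm_le_diff[OF sC sC, of n N] unfolding B_def by linarith
  qed
  have "B > 0"
  proof -
    have "0 \<le> nm (s 0)"
      using sC by simp
    also have "nm (s 0) \<le> Max ((\<lambda>n. nm (s n)) ` {..N})"
      by (intro Max_ge) auto
    finally show ?thesis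
      unfolding B_def by linarith
  qed
  with le show ?thesis
    by blast
qed

lemma cauchy_inner_convergent:
  assumes s: "s \<in> hcarrier (cauchy_space H)" and t: "t \<in> hcarrier (cauchy_space H)"
  shows "(\<lambda>n. ip (s n) (t n)) \<longlonglongrightarrow> hinner (cauchy_space H) s t"
proof -
  have sC: "s n \<in> C" and tC: "t n \<in> C" for n
    using s t by (auto simp: cauchy_space_simps)
  obtain B where B: "B > 0" "\<And>n. nm (s n) \<le> B"
    using cauchy_nm_bounded[OF s] by auto
  obtain D where D: "D > 0" "\<And>n. nm (t n) \<le> D"
    using cauchy_nm_bounded[OF t] by auto
  have "Cauchy (\<lambda>n. ip (s n) (t n))"
  proof (rule metric_CauchyI)
    fix e :: real assume e: "e > 0"
    have "\<exists>N. \<forall>m\<ge>N. \<forall>n\<ge>N. nm (df (s m) (s n)) < e / (2 * D)"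
      using e D by (intro cauchy_spaceD[OF s]) simp
    then obtain N where N: "\<forall>m\<ge>N. \<forall>n\<ge>N. nm (df (s m) (s n)) < e / (2 * D)" ..
    have "\<exists>N. \<forall>m\<ge>N. \<forall>n\<ge>N. nm (df (t m) (t n)) < e / (2 * B)"
      using e B by (intro cauchy_spaceD[OF t]) simp
    then obtain M where M: "\<forall>m\<ge>M. \<forall>n\<ge>M. nm (df (t m) (t n)) < e / (2 * B)" ..
    have "dist (ip (s m) (t m)) (ip (s n) (t n)) < e" if mn: "m \<ge> max M N" "n \<ge> max M N" for m n
    proof -
      have "ip (s m) (t m) - ip (s n) (t n) = ip (df (s m) (s n)) (t m) + ip (s n) (df (t m) (t n))"
        using sC tC by simp
      then have "dist (ip (s m) (t m)) (ip (s n) (t n))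
          \<le> cmod (ip (df (s m) (s n)) (t m)) + cmod (ip (s n) (df (t m) (t n)))"
        by (metis dist_norm norm_triangle_ineq)
      also have "\<dots> \<le> nm (df (s m) (s n)) * nm (t m) + nm (s n) * nm (df (t m) (t n))"
        using sC tC by (intro add_mono cauchy_schwarz) auto
      also have "\<dots> \<le> nm (df (s m) (s n)) * D + B * nm (df (t m) (t n))"
        using sC tC B D by (intro add_mono mult_left_mono mult_right_mono) auto
      also have "\<dots> < e / (2 * D) * D + B * (e / (2 * B))"
        using N M mn B(1) D(1) by (intro add_strict_mono mult_strict_left_mono mult_strict_right_mono) auto
      also have "\<dots> = e"
        using B(1) D(1) by simp
      finally show ?thesis .
    qed
    then show "\<exists>M. \<forall>m\<ge>M. \<forall>n\<ge>M. dist (ip (s m) (t m)) (ip (s n) (t n)) < e"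
      by blast
  qed
  then show ?thesis
    unfolding cauchy_space_simps by (simp add: Cauchy_convergent_iff convergent_LIMSEQ_iff)
qed

lemma cauchy_space_eqI:
  assumes "s \<in> hcarrier (cauchy_space H)" "t \<in> hcarrier (cauchy_space H)" "(\<lambda>n. ip (s n) (t n)) \<longlonglongrightarrow> l"
  shows "hinner (cauchy_space H) s t = l"
  using cauchy_inner_convergent[OF assms(1,2)] assms(3) LIMSEQ_unique by auto

lemma cauchy_space_add_in:
  assumes s: "s \<in> hcarrier (cauchy_space H)" and t: "t \<in> hcarrier (cauchy_space H)"
  shows "hadd (cauchy_space H) s t \<in> hcarrier (cauchy_space H)"
proof -
  have sC: "s n \<in> C" and tC: "t n \<in> C" for n
    using s t by (auto simp: cauchy_space_simps)
  have "\<exists>N. \<forall>m\<ge>N. \<forall>n\<ge>N. nm (df (hadd H (s m) (t m)) (hadd H (s n) (t n))) < e" if e: "e > 0" for e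
  proof -
    have "\<exists>N. \<forall>m\<ge>N. \<forall>n\<ge>N. nm (df (s m) (s n)) < e / 2"
      using e by (intro cauchy_spaceD[OF s]) (simp add: add_nonneg_pos)
    then obtain N where N: "\<forall>m\<ge>N. \<forall>n\<ge>N. nm (df (s m) (s n)) < e / 2" ..
    have "\<exists>N. \<forall>m\<ge>N. \<forall>n\<ge>N. nm (df (t m) (t n)) < e / 2"
      using e by (intro cauchy_spaceD[OF t]) simp
    then obtain M where M: "\<forall>m\<ge>M. \<forall>n\<ge>M. nm (df (t m) (t n)) < e / 2" ..
    have "nm (df (hadd H (s m) (t m)) (hadd H (s n) (t n))) < e" if "m \<ge> max M N" "n \<ge> max M N" for m n
    proof -
      have "nm (df (hadd H (s m) (t m)) (hadd H (s n) (t n))) = nm (hadd H (df (s m) (s n)) (df (t m) (t n)))"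
        using sC tC by (intro nm_cong) auto
      also have "\<dots> \<le> nm (df (s m) (s n)) + nm (df (t m) (t n))"
        using sC tC by (intro nm_add) auto
      also have "\<dots> < e / 2 + e / 2"
        using M N that by (intro add_strict_mono) auto
      finally show ?thesis
        by simp
    qed
    then show ?thesis
      by blast
  qed
  then show ?thesis
    using sC tC by (simp add: cauchy_space_simps)
qed

text \<open>Lipschitz maps act termwise on Cauchy sequences. This serves scalar multiplication and,
  in the GNS space, left multiplication by an algebra element.\<close>

lemma cauchy_space_image_in:
  assumes s: "s \<in> hcarrier (cauchy_space H)"
    and f: "\<And>x. x \<in> C \<Longrightarrow> f x \<in> C" "\<And>x y. \<lbrakk>x \<in> C; y \<in> C\<rbrakk> \<Longrightarrow> nm (df (f x) (f y)) \<le> B * nm (df x y)"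
  shows "(\<lambda>n. f (s n)) \<in> hcarrier (cauchy_space H)"
proof -
  have sC: "s n \<in> C" for n
    using s by (auto simp: cauchy_space_simps)
  have "\<exists>N. \<forall>m\<ge>N. \<forall>n\<ge>N. nm (df (f (s m)) (f (s n))) < e" if e: "e > 0" for e
  proof -
    \<comment> \<open>Dividing by \<open>\<bar>B\<bar> + 1\<close> keeps the tolerance positive
      whatever the real number \<open>B\<close> is.\<close>
    have "\<exists>N. \<forall>m\<ge>N. \<forall>n\<ge>N. nm (df (s m) (s n)) < e / (\<bar>B\<bar> + 1)"
      using e by (intro cauchy_spaceD[OF s]) (simp add: add_nonneg_pos)
    then obtain N where N: "\<forall>m\<ge>N. \<forall>n\<ge>N. nm (df (s m) (s n)) < e / (\<bar>B\<bar> + 1)" ..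
    have "nm (df (f (s m)) (f (s n))) < e" if "m \<ge> N" "n \<ge> N" for m n
    proof -
      have "nm (df (f (s m)) (f (s n))) \<le> B * nm (df (s m) (s n))"
        using sC by (intro f)
      also have "\<dots> \<le> (\<bar>B\<bar> + 1) * nm (df (s m) (s n))"
        using sC by (intro mult_right_mono) auto
      also have "\<dots> < (\<bar>B\<bar> + 1) * (e / (\<bar>B\<bar> + 1))"
        using N that by (intro mult_strict_left_mono) auto
      finally show ?thesis
        by (simp add: add_nonneg_eq_0_iff)
    qed
    then show ?thesis
      by blast
  qed
  then show ?thesis
    using sC f by (simp add: cauchy_space_simps)
qed

lemma const_in_cauchy_space: "x \<in> C \<Longrightarrow> (\<lambda>n. x) \<in> hcarrier (cauchy_space H)"
  by (simp add: cauchy_space_simps)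

lemma semi_ips_cauchy_space: "semi_ips (cauchy_space H)"
proof
  let ?H = "cauchy_space H"
  have C: "s n \<in> C" if "s \<in> hcarrier ?H" for s n
    using that by (simp add: cauchy_space_simps)
  show zero: "hzero ?H \<in> hcarrier ?H"
    by (simp add: cauchy_space_simps)
  show add: "hadd ?H x y \<in> hcarrier ?H" if "x \<in> hcarrier ?H" "y \<in> hcarrier ?H" for x y
    using that by (rule cauchy_space_add_in)
  show scale: "hscale ?H c x \<in> hcarrier ?H" if "x \<in> hcarrier ?H" for x c
    unfolding cauchy_space_simps(3)
  proof (rule cauchy_space_image_in[OF that, where B = "cmod c"])
    fix x y assume "x \<in> C" "y \<in> C"
    then have "nm (df (hscale H c x) (hscale H c y)) = nm (hscale H c (df x y))"
      by (intro nm_cong) (auto simp: algebra_simps)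
    then show "nm (df (hscale H c x) (hscale H c y)) \<le> cmod c * nm (df x y)"
      using \<open>x \<in> C\<close> \<open>y \<in> C\<close> by (simp add: nm_scale)
  qed auto
  show "hinner ?H (hzero ?H) z = 0" if "z \<in> hcarrier ?H" for z
    using C that by (intro cauchy_space_eqI zero) (simp_all add: cauchy_space_simps(4))
  show "hinner ?H (hadd ?H x y) z = hinner ?H x z + hinner ?H y z"
    if xyz: "x \<in> hcarrier ?H" "y \<in> hcarrier ?H" "z \<in> hcarrier ?H" for x y z
    using tendsto_add[OF cauchy_inner_convergent cauchy_inner_convergent, OF xyz(1,3,2,3)] C xyz
    by (intro cauchy_space_eqI add) (simp_all add: cauchy_space_simps(2))
  show "hinner ?H (hscale ?H c x) z = c * hinner ?H x z"
    if xz: "x \<in> hcarrier ?H" "z \<in> hcarrier ?H" for x z c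
    using tendsto_mult_left[OF cauchy_inner_convergent[OF xz], of c] C xz
    by (intro cauchy_space_eqI scale) (simp_all add: cauchy_space_simps(3))
  show "hinner ?H y x = cnj (hinner ?H x y)"
    if xy: "x \<in> hcarrier ?H" "y \<in> hcarrier ?H" for x y
  proof (rule cauchy_space_eqI[OF xy(2,1)])
    have "(\<lambda>n. cnj (ip (x n) (y n))) \<longlonglongrightarrow> cnj (hinner ?H x y)"
      by (intro tendsto_cnj cauchy_inner_convergent xy)
    then show "(\<lambda>n. ip (y n) (x n)) \<longlonglongrightarrow> cnj (hinner ?H x y)"
      using C xy by (simp add: cnj_inner)
  qed
  fix x assume x: "x \<in> hcarrier ?H"
  have l: "(\<lambda>n. ip (x n) (x n)) \<longlonglongrightarrow> hinner ?H x x"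
    by (rule cauchy_inner_convergent[OF x x])
  have "(\<lambda>n. Im (ip (x n) (x n))) \<longlonglongrightarrow> Im (hinner ?H x x)"
    by (intro tendsto_intros l)
  then show "Im (hinner ?H x x) = 0"
    using C[OF x] LIMSEQ_unique[of "\<lambda>n. 0"] by auto
  have "(\<lambda>n. Re (ip (x n) (x n))) \<longlonglongrightarrow> Re (hinner ?H x x)"
    by (intro tendsto_intros l)
  then show "0 \<le> Re (hinner ?H x x)"
    using C[OF x] by (intro LIMSEQ_le_const) auto
qed

lemma cauchy_space_nm:
  assumes x: "x \<in> hcarrier (cauchy_space H)"
  shows "(\<lambda>n. nm (x n)) \<longlonglongrightarrow> hnorm (cauchy_space H) x"
  unfolding hnorm_def by (intro tendsto_intros cauchy_inner_convergent x)

lemma cauchy_space_nm_le: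
  assumes x: "x \<in> hcarrier (cauchy_space H)" and le: "\<And>n. n \<ge> N \<Longrightarrow> nm (x n) \<le> e"
  shows "hnorm (cauchy_space H) x \<le> e"
  using le by (intro LIMSEQ_le_const2[OF cauchy_space_nm[OF x]]) blast

text \<open>Constant sequences are dense. Completeness rests on this, and so does the cyclicity of
  the class of \<open>1\<close> in the GNS space.\<close>

lemma cauchy_space_approx:
  assumes x: "x \<in> hcarrier (cauchy_space H)" and e: "e > 0"
  shows "\<exists>N. \<forall>k\<ge>N. hnorm (cauchy_space H) (hdiff (cauchy_space H) (\<lambda>n. x k) x) \<le> e"
proof -
  interpret S: semi_ips "cauchy_space H"
    by (rule semi_ips_cauchy_space)
  have xC: "x n \<in> C" for n
    using x by (simp add: cauchy_space_simps)
  have "\<exists>N. \<forall>m\<ge>N. \<forall>n\<ge>N. nm (df (x m) (x n)) < e"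
    by (rule cauchy_spaceD[OF x e])
  then obtain N where N: "\<forall>m\<ge>N. \<forall>n\<ge>N. nm (df (x m) (x n)) < e" ..
  have "S.nm (S.df (\<lambda>n. x k) x) \<le> e" if "k \<ge> N" for k
  proof (rule cauchy_space_nm_le)
    show "S.df (\<lambda>n. x k) x \<in> S.C"
      using x xC by (intro S.diff_in const_in_cauchy_space)
    show "nm (S.df (\<lambda>n. x k) x n) \<le> e" if "n \<ge> N" for n
      using N that \<open>k \<ge> N\<close> by (simp add: cauchy_space_simps(6) less_imp_le)
  qed
  then show ?thesis
    by blast
qed

text \<open>From each sequence \<open>s k\<close> one term \<open>l k\<close> is taken whose
  constant sequence is within \<open>1 / real (Suc k)\<close> of \<open>s k\<close>. The sequence
  \<open>l\<close> of these terms is Cauchy and is the limit.\<close>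

lemma cauchy_space_complete:
  assumes s: "\<And>n. s n \<in> hcarrier (cauchy_space H)"
    and cau: "\<forall>e>0. \<exists>N. \<forall>m\<ge>N. \<forall>n\<ge>N. hnorm (cauchy_space H) (hdiff (cauchy_space H) (s m) (s n)) < e"
  shows "\<exists>l\<in>hcarrier (cauchy_space H). \<forall>e>0. \<exists>N. \<forall>n\<ge>(N::nat). hnorm (cauchy_space H) (hdiff (cauchy_space H) (s n) l) < e"
proof -
  interpret S: semi_ips "cauchy_space H"
    by (rule semi_ips_cauchy_space)
  have sC: "s k n \<in> C" for k n
    using s[of k] by (simp add: cauchy_space_simps)
  have "\<forall>k. \<exists>i. S.nm (S.df (\<lambda>n. s k i) (s k)) \<le> 1 / real (Suc k)"
    using cauchy_space_approx[OF s] by (metis order_refl of_nat_0_less_iff zero_less_Suc zero_less_divide_1_iff)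
  then obtain i where i: "\<And>k. S.nm (S.df (\<lambda>n. s k (i k)) (s k)) \<le> 1 / real (Suc k)"
    by metis
  define l where "l k = s k (i k)" for k
  have lC: "l k \<in> C" for k
    using sC by (simp add: l_def)
  have near: "S.nm (S.df (\<lambda>n. l k) (s k)) \<le> 1 / real (Suc k)" for k
    using i by (simp add: l_def)
  have const: "S.nm (\<lambda>n. x) = nm x" if "x \<in> C" for x
    using cauchy_space_nm[OF const_in_cauchy_space[OF that]] LIMSEQ_unique tendsto_const by blast
  have lin: "(\<lambda>n. l k) \<in> S.C" for k
    by (rule const_in_cauchy_space[OF lC])
  have small: "\<exists>N. \<forall>k\<ge>N. 1 / real (Suc k) < e" if "e > 0" for e :: real
  proof -
    obtain N where N: "1 / real (Suc N) < e"
      by (rule nat_approx_posE[OF \<open>e > 0\<close>])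
    have "1 / real (Suc k) \<le> 1 / real (Suc N)" if "k \<ge> N" for k
      using that by (auto intro!: divide_left_mono)
    with N show ?thesis
      by (intro exI[of _ N]) (meson le_less_trans)
  qed
  have l: "l \<in> S.C"
    unfolding cauchy_space_simps
  proof (intro conjI allI impI lC)
    fix e :: real assume e: "e > 0"
    obtain N where N: "\<forall>k\<ge>N. 1 / real (Suc k) < e / 3"
      using small[of "e / 3"] e by auto
    have "\<exists>N. \<forall>m\<ge>N. \<forall>n\<ge>N. S.nm (S.df (s m) (s n)) < e / 3"
      by (rule cau[rule_format]) (use e in simp)
    then obtain M where M: "\<forall>m\<ge>M. \<forall>n\<ge>M. S.nm (S.df (s m) (s n)) < e / 3" ..
    have "nm (df (l m) (l n)) < e" if "m \<ge> max M N" "n \<ge> max M N" for m n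
    proof -
      have "nm (df (l m) (l n)) = S.nm (S.df (\<lambda>k. l m) (\<lambda>k. l n))"
        using const[of "df (l m) (l n)"] lC by (simp add: cauchy_space_simps(6))
      also have "\<dots> \<le> S.nm (S.df (\<lambda>k. l m) (s m)) + S.nm (S.df (s m) (\<lambda>k. l n))"
        by (intro S.nm_diff_triangle lin s)
      also have "S.nm (S.df (s m) (\<lambda>k. l n)) \<le> S.nm (S.df (s m) (s n)) + S.nm (S.df (s n) (\<lambda>k. l n))"
        by (intro S.nm_diff_triangle lin s)
      also have "S.nm (S.df (s n) (\<lambda>k. l n)) = S.nm (S.df (\<lambda>k. l n) (s n))"
        by (intro S.nm_diff_commute lin s)
      finally have "nm (df (l m) (l n)) \<le> 1 / real (Suc m) + (S.nm (S.df (s m) (s n)) + 1 / real (Suc n))"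
        using near[of m] near[of n] by linarith
      moreover have "1 / real (Suc m) < e / 3" "1 / real (Suc n) < e / 3" "S.nm (S.df (s m) (s n)) < e / 3"
        using M N that by auto
      ultimately show ?thesis
        by linarith
    qed
    then show "\<exists>N. \<forall>m\<ge>N. \<forall>n\<ge>N. nm (df (l m) (l n)) < e"
      by blast
  qed
  show ?thesis
  proof (intro bexI[of _ l] l allI impI)
    fix e :: real assume e: "e > 0"
    obtain N where N: "\<forall>k\<ge>N. 1 / real (Suc k) < e / 3"
      using small[of "e / 3"] e by auto
    obtain M where M: "\<forall>k\<ge>M. S.nm (S.df (\<lambda>n. l k) l) \<le> e / 3"
      using cauchy_space_approx[OF l, of "e / 3"] e by auto
    have "S.nm (S.df (s k) l) < e" if "k \<ge> max M N" for k
    proof -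
      have "S.nm (S.df (s k) l) \<le> S.nm (S.df (s k) (\<lambda>n. l k)) + S.nm (S.df (\<lambda>n. l k) l)"
        by (intro S.nm_diff_triangle lin l s)
      also have "S.nm (S.df (s k) (\<lambda>n. l k)) = S.nm (S.df (\<lambda>n. l k) (s k))"
        by (intro S.nm_diff_commute lin s)
      finally have "S.nm (S.df (s k) l) \<le> 1 / real (Suc k) + S.nm (S.df (\<lambda>n. l k) l)"
        using near[of k] by linarith
      moreover have "1 / real (Suc k) < e / 3" "S.nm (S.df (\<lambda>n. l k) l) \<le> e / 3"
        using M N that by auto
      ultimately show ?thesis
        using e by linarith
    qed
    then show "\<exists>N. \<forall>n\<ge>N. S.nm (S.df (s n) l) < e"
      by blast
  qed
qed

lemma hilbert_completion: "hilbert (null_quotient (cauchy_space H))"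
  by (intro semi_ips.hilbert_null_quotient semi_ips_cauchy_space cauchy_space_complete)

end

section \<open>Representations and the GNS construction\<close>

text \<open>Conjugation by an isometry, extended by zero on the complement of its range: a unital
  \<open>\<rho>\<close> becomes a possibly degenerate representation whose unit acts as the
  projection \<open>V \<circ> V'\<close>. The value off the carrier follows the normalisation in
  \<open>bounded_op\<close>.\<close>

definition transport_rep :: "'v hspace \<Rightarrow> ('w \<Rightarrow> 'v) \<Rightarrow> ('v \<Rightarrow> 'w) \<Rightarrow> ('a \<Rightarrow> 'w \<Rightarrow> 'w) \<Rightarrow> 'a \<Rightarrow> 'v \<Rightarrow> 'v" where
  "transport_rep H V V' \<rho> = (\<lambda>a x. if x \<in> hcarrier H then V (\<rho> a (V' x)) else hzero H)"

locale cstar_rep = cstar cmult star + ips H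
  for cmult :: "complex \<Rightarrow> 'a::{real_normed_algebra_1,banach} \<Rightarrow> 'a" and star :: "'a \<Rightarrow> 'a"
    and H :: "'v hspace" +
  fixes \<pi> :: "'a \<Rightarrow> 'v \<Rightarrow> 'v"
  assumes rep: "is_rep cmult star H \<pi>"
begin

lemma rep_in [simp]: "x \<in> C \<Longrightarrow> \<pi> a x \<in> C"
  and rep_off: "x \<notin> C \<Longrightarrow> \<pi> a x = hzero H"
  using rep by (auto simp: is_rep_def bounded_op_def)

lemma rep_mult: "x \<in> C \<Longrightarrow> \<pi> (a * b) x = \<pi> a (\<pi> b x)"
  using rep by (simp add: is_rep_def)

lemma rep_star: "\<lbrakk>x \<in> C; y \<in> C\<rbrakk> \<Longrightarrow> ip (\<pi> (star a) x) y = ip x (\<pi> a y)"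
  using rep by (simp add: is_rep_def)

lemma rep_adjoint: "\<lbrakk>x \<in> C; y \<in> C\<rbrakk> \<Longrightarrow> ip (\<pi> a x) y = ip x (\<pi> (star a) y)"
  using rep_star[of x y "star a"] by simp

lemma inner_rep_add: "\<lbrakk>x \<in> C; y \<in> C\<rbrakk> \<Longrightarrow> ip (\<pi> (a + b) x) y = ip (\<pi> a x) y + ip (\<pi> b x) y"
  using rep by (simp add: is_rep_def)

lemma inner_rep_cmult: "\<lbrakk>x \<in> C; y \<in> C\<rbrakk> \<Longrightarrow> ip (\<pi> (cmult c a) x) y = c * ip (\<pi> a x) y"
  using rep by (simp add: is_rep_def)

lemma rep_gram: "\<lbrakk>x \<in> C; y \<in> C\<rbrakk> \<Longrightarrow> ip (\<pi> a x) (\<pi> b y) = ip (\<pi> (star b * a) x) y"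
  by (simp add: rep_mult rep_star)

lemma rep_diff: "\<lbrakk>x \<in> C; y \<in> C\<rbrakk> \<Longrightarrow> \<pi> a (df x y) = df (\<pi> a x) (\<pi> a y)"
  by (rule inner_ext) (simp_all add: rep_adjoint)

lemma positive_functional_vector_state: "x \<in> C \<Longrightarrow> positive_functional (\<lambda>a. ip (\<pi> a x) x)"
  by (simp add: positive_functional_def inner_rep_add inner_rep_cmult flip: rep_gram)

text \<open>\<open>\<pi> 1\<close> is contractive because the square of
  \<open>nm (\<pi> 1 x)\<close> is \<open>Re (ip (\<pi> 1 x) x)\<close>, to which Cauchy-Schwarz
  applies. \<open>pf_mult_bound\<close> for the vector functional of \<open>x\<close> then handles a
  general \<open>a\<close>.\<close>

lemma rep_nm_le:
  assumes x: "x \<in> C"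
  shows "nm (\<pi> a x) \<le> norm a * nm x"
proof -
  have sq: "(nm (\<pi> b x))\<^sup>2 = Re (ip (\<pi> (star b * b) x) x)" for b
    using x by (simp add: nm_sq rep_gram)
  have "nm (\<pi> 1 x) * nm (\<pi> 1 x) \<le> nm (\<pi> 1 x) * nm x"
    using sq[of 1] cauchy_schwarz[OF rep_in[OF x] x, of 1] complex_Re_le_cmod[of "ip (\<pi> 1 x) x"]
    by (simp add: power2_eq_square)
  then have one: "nm (\<pi> 1 x) \<le> nm x"
    using x nm_ge0[OF x] nm_ge0[OF rep_in[OF x], of 1] by (cases "nm (\<pi> 1 x) = 0") auto
  have "(nm (\<pi> a x))\<^sup>2 \<le> (norm a)\<^sup>2 * (nm (\<pi> 1 x))\<^sup>2"
    using pf_mult_bound[OF positive_functional_vector_state[OF x], of a 1] by (simp add: sq)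
  also have "\<dots> \<le> (norm a)\<^sup>2 * (nm x)\<^sup>2"
    using one x by (intro mult_left_mono power_mono) auto
  finally have "(nm (\<pi> a x))\<^sup>2 \<le> (norm a * nm x)\<^sup>2"
    by (simp add: power_mult_distrib)
  then show ?thesis
    by (rule power2_le_imp_le) (simp add: x)
qed

text \<open>A vector nearly annihilated by the unit is nearly annihilated by every algebra element.
  It therefore suffices to control \<open>\<sigma> 1\<close> on the vectors orthogonal to the range
  of \<open>\<pi> 1\<close>.\<close>

lemma nm_rep_le_unit_part:
  assumes "x \<in> C"
  shows "nm (\<pi> a x) \<le> norm a * nm (\<pi> 1 x)"
  using rep_nm_le[OF rep_in[OF assms], of a 1] rep_mult[OF assms, of a 1] by simp

lemma vector_state_in_states:
  assumes x: "x \<in> C" "nm x = 1" "\<pi> 1 x = x"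
  shows "vector_state H x \<pi> \<in> states cmult star"
  using positive_functional_vector_state[OF x(1)] x
  by (simp add: states_iff vector_state_def inner_self)

text \<open>\<open>\<pi> 1\<close> is idempotent, so its range consists of its fixed points.\<close>

lemma rep_one_range_iff:
  assumes x: "x \<in> C"
  shows "(\<exists>y\<in>C. \<pi> 1 y = x) \<longleftrightarrow> \<pi> 1 x = x"
  using rep_mult[of _ 1 1] x by auto

end

section \<open>Transport of representations and the GNS space\<close>

context cstar
begin

text \<open>Everything is tested against a second vector, and linearity of the single operators
  comes out of the adjoint law \<open>st\<close>.\<close>

lemma is_repI:
  assumes "ips H"
    and rin: "\<And>a x. x \<in> hcarrier H \<Longrightarrow> \<pi> a x \<in> hcarrier H"
    and off: "\<And>a x. x \<notin> hcarrier H \<Longrightarrow> \<pi> a x = hzero H"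
    and add: "\<And>a b x y. \<lbrakk>x \<in> hcarrier H; y \<in> hcarrier H\<rbrakk> \<Longrightarrow>
        hinner H (\<pi> (a + b) x) y = hinner H (\<pi> a x) y + hinner H (\<pi> b x) y"
    and cm: "\<And>c a x y. \<lbrakk>x \<in> hcarrier H; y \<in> hcarrier H\<rbrakk> \<Longrightarrow>
        hinner H (\<pi> (cmult c a) x) y = c * hinner H (\<pi> a x) y"
    and mul: "\<And>a b x y. \<lbrakk>x \<in> hcarrier H; y \<in> hcarrier H\<rbrakk> \<Longrightarrow>
        hinner H (\<pi> (a * b) x) y = hinner H (\<pi> a (\<pi> b x)) y"
    and st: "\<And>a x y. \<lbrakk>x \<in> hcarrier H; y \<in> hcarrier H\<rbrakk> \<Longrightarrow>
        hinner H (\<pi> (star a) x) y = hinner H x (\<pi> a y)"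
    and bound: "\<And>a. \<exists>B. \<forall>x\<in>hcarrier H. hnorm H (\<pi> a x) \<le> B * hnorm H x"
  shows "is_rep cmult star H \<pi>"
proof -
  interpret ips H by fact
  have st': "ip (\<pi> a x) y = ip x (\<pi> (star a) y)" if "x \<in> C" "y \<in> C" for a x y
    using st[OF that, of "star a"] by simp
  have "bounded_op H (\<pi> a)" for a
    unfolding bounded_op_def
    by (intro conjI ballI allI impI bound inner_ext) (simp_all add: rin off st')
  then show ?thesis
    unfolding is_rep_def
    by (intro conjI ballI allI impI inner_ext) (simp_all add: rin add cm mul st)
qed

lemma is_rep_transport:
  assumes K: "ips K" and H: "ips H" and V: "isometry_pair K H V V'" and rho: "is_rep cmult star K \<rho>"
  shows "is_rep cmult star H (transport_rep H V V' \<rho>)"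
proof -
  interpret K: cstar_rep cmult star K \<rho>
    by (intro cstar_rep.intro cstar_axioms K cstar_rep_axioms.intro rho)
  interpret H: ips H by fact
  note V1 = isometry_pairD(1)[OF V] and V2 = isometry_pairD(2)[OF V] and V3 = isometry_pairD(3)[OF V]
    and V4 = isometry_pairD(4)[OF V]
  have VK: "H.nm (V x) = K.nm x" if "x \<in> K.C" for x
    using isometry_pair_inner[OF V that that] by (simp add: hnorm_def)
  have V'K: "K.nm (V' y) \<le> H.nm y" if y: "y \<in> H.C" for y
  proof -
    have "K.nm (V' y) * K.nm (V' y) = Re (H.ip (V (V' y)) y)"
      using V3[OF V2[OF y] y] K.nm_sq[OF V2[OF y]] by (simp add: power2_eq_square)
    also have "\<dots> \<le> H.nm (V (V' y)) * H.nm y"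
      using H.cauchy_schwarz[OF V1[OF V2[OF y]] y] complex_Re_le_cmod order_trans by blast
    finally show ?thesis
      using VK[OF V2[OF y]] K.nm_ge0[OF V2[OF y]] H.nm_ge0[OF y] by (cases "K.nm (V' y) = 0") auto
  qed
  show ?thesis
  proof (rule is_repI[OF H])
    fix a
    have "H.nm (transport_rep H V V' \<rho> a x) \<le> norm a * H.nm x" if x: "x \<in> H.C" for x
    proof -
      have "H.nm (transport_rep H V V' \<rho> a x) \<le> norm a * K.nm (V' x)"
        using K.rep_nm_le[OF V2[OF x], of a] VK[OF K.rep_in[OF V2[OF x]]] x by (simp add: transport_rep_def)
      also have "\<dots> \<le> norm a * H.nm x"
        using V'K[OF x] by (intro mult_left_mono) auto
      finally show ?thesis .
    qed
    then show "\<exists>B. \<forall>x\<in>H.C. H.nm (transport_rep H V V' \<rho> a x) \<le> B * H.nm x"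
      by auto
  next
    fix a x y assume xy: "x \<in> H.C" "y \<in> H.C"
    have "H.ip (V (\<rho> (star a) (V' x))) y = K.ip (V' x) (\<rho> a (V' y))"
      using xy by (simp add: V1 V2 V3 K.rep_star)
    also have "\<dots> = cnj (K.ip (\<rho> a (V' y)) (V' x))"
      using xy by (simp add: K.cnj_inner V2)
    also have "\<dots> = cnj (H.ip (V (\<rho> a (V' y))) x)"
      using xy by (simp add: V1 V2 V3)
    finally show "H.ip (transport_rep H V V' \<rho> (star a) x) y = H.ip x (transport_rep H V V' \<rho> a y)"
      using xy by (simp add: transport_rep_def H.cnj_inner V1 V2)
  qed (simp_all add: transport_rep_def V1 V2 V3 V4 K.inner_rep_add K.inner_rep_cmult K.rep_mult)
qed

text \<open>Algebra elements act on Cauchy sequences by termwise left multiplication, which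
  \<open>pf_mult_bound\<close> makes Lipschitz, and the class of \<open>1\<close> is cyclic. Density
  is stated again for \<open>\<eta>\<close> because \<open>cyclic_rep\<close> hides its vector
  behind a quantifier.\<close>

lemma gns:
  assumes \<phi>: "\<phi> \<in> states cmult star"
  shows "\<exists>(K :: (nat \<Rightarrow> 'a) hspace) \<pi> \<eta>. cyclic_rep cmult star K \<pi> \<and> \<eta> \<in> hcarrier K \<and>
    (\<forall>a. hinner K (\<pi> a \<eta>) \<eta> = \<phi> a) \<and>
    (\<forall>x\<in>hcarrier K. \<forall>e>0. \<exists>a. hnorm K (hdiff K (\<pi> a \<eta>) x) < e)"
proof -
  have pf: "positive_functional \<phi>"
    using \<phi> by (simp add: states_iff)
  define P where "P = pre_gns \<phi>"
  have P: "hcarrier P = UNIV" "hadd P = (+)" "hscale P = cmult" "hzero P = 0"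
    "hinner P = (\<lambda>a b. \<phi> (star b * a))" "hdiff P = (-)"
    by (auto simp: P_def pre_gns_simps[OF pf] fun_eq_iff)
  interpret P: semi_ips P
    unfolding P_def by (rule semi_ips_pre_gns[OF pf])
  define S where "S = cauchy_space P"
  interpret S: semi_ips S
    unfolding S_def by (rule P.semi_ips_cauchy_space)
  define K where "K = null_quotient S"
  interpret K: hilbert K
    unfolding K_def S_def by (rule P.hilbert_completion)
  have Kip: "K.ip = S.ip" and Knm: "K.nm = S.nm"
    by (auto simp: K_def null_quotient_simps fun_eq_iff)
  have KS: "x \<in> S.C" if "x \<in> K.C" for x
    using that S.null_quotient_in by (simp add: K_def)
  have rK: "null_rep S x \<in> K.C" if "x \<in> S.C" for x
    using that S.null_rep_in_quotient by (simp add: K_def)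
  have left: "(\<lambda>n. a * x n) \<in> S.C" if "x \<in> S.C" for a x
    unfolding S_def
  proof (rule P.cauchy_space_image_in[where B = "norm a" and f = "\<lambda>u. a * u"])
    fix u v
    have "(P.nm (a * (u - v)))\<^sup>2 \<le> (norm a)\<^sup>2 * (P.nm (u - v))\<^sup>2"
      using pf_mult_bound[OF pf, of a "u - v"] by (simp add: P.nm_sq P)
    then have "(P.nm (a * (u - v)))\<^sup>2 \<le> (norm a * P.nm (u - v))\<^sup>2"
      by (simp add: power_mult_distrib)
    then have "P.nm (a * (u - v)) \<le> norm a * P.nm (u - v)"
      by (rule power2_le_imp_le) (simp add: P)
    then show "P.nm (P.df (a * u) (a * v)) \<le> norm a * P.nm (P.df u v)"
      by (simp add: P right_diff_distrib)
  qed (use that in \<open>simp_all add: S_def P\<close>)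
  have const: "(\<lambda>n. a) \<in> S.C" for a
    unfolding S_def by (rule P.const_in_cauchy_space) (simp add: P)
  have lim: "(\<lambda>n. \<phi> (star (y n) * x n)) \<longlonglongrightarrow> S.ip x y" if "x \<in> S.C" "y \<in> S.C" for x y
    using P.cauchy_inner_convergent[of x y] that by (simp add: S_def P)
  have eqI: "S.ip x y = l" if "x \<in> S.C" "y \<in> S.C" "(\<lambda>n. \<phi> (star (y n) * x n)) \<longlonglongrightarrow> l" for x y l
    using lim[OF that(1,2)] that(3) LIMSEQ_unique by blast
  define \<pi> where "\<pi> a x = (if x \<in> K.C then null_rep S (\<lambda>n. a * x n) else hzero K)" for a x
  have \<pi>K: "\<pi> a x \<in> K.C" if "x \<in> K.C" for a x
    using that by (simp add: \<pi>_def rK left KS)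
  have \<pi>ip: "K.ip (\<pi> a x) y = S.ip (\<lambda>n. a * x n) y" if "x \<in> K.C" "y \<in> K.C" for a x y
    using that by (simp add: Kip \<pi>_def left KS)
  have star_left: "S.ip (\<lambda>n. star a * x n) y = S.ip x (\<lambda>n. a * y n)" if "x \<in> S.C" "y \<in> S.C" for a x y
    by (rule eqI) (use that lim[OF that(1) left[OF that(2)], of a] in \<open>auto simp: left star_mult mult.assoc\<close>)
  have \<pi>star: "K.ip (\<pi> (star a) x) y = K.ip x (\<pi> a y)" if "x \<in> K.C" "y \<in> K.C" for a x y
    unfolding \<pi>ip[OF that] using that by (simp add: star_left KS Kip \<pi>_def left)
  have \<pi>nm: "K.nm (\<pi> a x) \<le> norm a * K.nm x" if x: "x \<in> K.C" for a x
  proof -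
    have "K.nm (\<pi> a x) = S.nm (\<lambda>n. a * x n)"
      unfolding Knm using x by (intro S.nm_cong) (simp_all add: \<pi>_def S.null_rep_spec left KS)
    also have "\<dots> \<le> norm a * S.nm x"
    proof (rule LIMSEQ_le)
      show "(\<lambda>n. P.nm (a * x n)) \<longlonglongrightarrow> S.nm (\<lambda>n. a * x n)"
        unfolding S_def by (rule P.cauchy_space_nm[OF left[OF KS[OF x], unfolded S_def]])
      show "(\<lambda>n. norm a * P.nm (x n)) \<longlonglongrightarrow> norm a * S.nm x"
        unfolding S_def by (intro tendsto_intros P.cauchy_space_nm[OF KS[OF x, unfolded S_def]])
      have "P.nm (a * u) \<le> norm a * P.nm u" for u
      proof (rule power2_le_imp_le)
        show "(P.nm (a * u))\<^sup>2 \<le> (norm a * P.nm u)\<^sup>2"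
          using pf_mult_bound[OF pf, of a u] by (simp add: P.nm_sq P power_mult_distrib)
      qed (simp add: P)
      then show "\<exists>N. \<forall>n\<ge>N. P.nm (a * x n) \<le> norm a * P.nm (x n)"
        by blast
    qed
    finally show ?thesis
      by (simp add: Knm)
  qed
  have rep: "is_rep cmult star K \<pi>"
  proof (rule is_repI[OF K.ips_axioms])
    fix a b x y assume xy: "x \<in> K.C" "y \<in> K.C"
    note xy' = xy[THEN KS]
    show "K.ip (\<pi> (a + b) x) y = K.ip (\<pi> a x) y + K.ip (\<pi> b x) y"
      unfolding \<pi>ip[OF xy]
      by (rule eqI) (use left[OF xy'(1), of "a + b"] xy' tendsto_add[OF lim[OF left[OF xy'(1)] xy'(2)] lim[OF left[OF xy'(1)] xy'(2)], of a b]
          in \<open>simp_all add: left pf_add[OF pf] distrib_left distrib_right\<close>)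
    show "K.ip (\<pi> (cmult c a) x) y = c * K.ip (\<pi> a x) y" for c
      unfolding \<pi>ip[OF xy]
      by (rule eqI) (use left[OF xy'(1), of "cmult c a"] xy' tendsto_mult_left[OF lim[OF left[OF xy'(1)] xy'(2)], of c a]
          in \<open>simp_all add: left pf_cmult[OF pf] cmult_mult_left cmult_mult_right\<close>)
    show "K.ip (\<pi> (a * b) x) y = K.ip (\<pi> a (\<pi> b x)) y"
    proof -
      \<comment> \<open>The inner vector \<open>\<pi> b x\<close> is only a representative of the
        sequence of products, so \<open>a\<close> is moved to the other side before the
        representative is replaced.\<close>
      have "K.ip (\<pi> a (\<pi> b x)) y = K.ip (\<pi> b x) (\<pi> (star a) y)"
        using \<pi>star[OF \<pi>K[OF xy(1)] xy(2), of "star a" b] by simp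
      also have "\<dots> = S.ip (\<lambda>n. b * x n) (\<lambda>n. star a * y n)"
        unfolding \<pi>ip[OF xy(1) \<pi>K[OF xy(2)]] using xy by (simp add: \<pi>_def left KS)
      also have "\<dots> = S.ip (\<lambda>n. a * b * x n) y"
        using star_left[OF left[OF xy'(1)] xy'(2), of "star a" b] by (simp add: mult.assoc)
      finally show ?thesis
        by (simp add: \<pi>ip[OF xy])
    qed
  next
    show "\<exists>B. \<forall>x\<in>K.C. K.nm (\<pi> a x) \<le> B * K.nm x" for a
      using \<pi>nm by (intro exI[of _ "norm a"]) simp
  qed (use \<pi>K \<pi>star in \<open>simp_all add: \<pi>_def\<close>)
  define \<eta> where "\<eta> = null_rep S (\<lambda>n. 1)"
  have \<eta>: "\<eta> \<in> K.C"
    unfolding \<eta>_def by (intro rK const)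
  \<comment> \<open>\<open>\<eta>\<close> is only some representative of the constant sequence
    \<open>1\<close>, so \<open>a * \<eta> n\<close> need not be \<open>a\<close>. With
    \<open>a\<close> shifted to the other argument, \<open>\<eta>\<close> stands alone and can be
    replaced.\<close>
  have \<pi>\<eta>: "S.ip (\<pi> a \<eta>) z = S.ip (\<lambda>n. a) z" if z: "z \<in> S.C" for a z
  proof -
    have "S.ip (\<pi> a \<eta>) z = S.ip (\<lambda>n. a * \<eta> n) z"
      using \<eta> z by (simp add: \<pi>_def left KS)
    also have "\<dots> = S.ip \<eta> (\<lambda>n. star a * z n)"
      using star_left[OF KS[OF \<eta>] z, of "star a"] by simp
    also have "\<dots> = S.ip (\<lambda>n. 1) (\<lambda>n. star a * z n)"
      unfolding \<eta>_def by (intro S.inner_null_rep const left z)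
    also have "\<dots> = S.ip (\<lambda>n. a) z"
      using star_left[OF const z, of "star a" 1] by simp
    finally show ?thesis .
  qed
  have state: "K.ip (\<pi> a \<eta>) \<eta> = \<phi> a" for a
  proof -
    have "K.ip (\<pi> a \<eta>) \<eta> = S.ip (\<lambda>n. a) (\<lambda>n. 1)"
      unfolding Kip \<pi>\<eta>[OF KS[OF \<eta>]] unfolding \<eta>_def by (intro S.inner_null_rep const)
    also have "\<dots> = \<phi> a"
      by (rule eqI) (auto simp: const)
    finally show ?thesis .
  qed
  have dense: "\<exists>a. K.nm (K.df (\<pi> a \<eta>) x) < e" if x: "x \<in> K.C" and e: "e > 0" for x e
  proof -
    obtain N where N: "\<forall>k\<ge>N. S.nm (S.df (\<lambda>n. x k) x) \<le> e / 2"
      using P.cauchy_space_approx[of x "e / 2"] KS[OF x] e by (auto simp: S_def)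
    have "K.nm (K.df (\<pi> (x N) \<eta>) x) = S.nm (S.df (\<pi> (x N) \<eta>) x)"
      using S.nm_diff_quotient[of "\<pi> (x N) \<eta>" x] x \<pi>K[OF \<eta>] by (simp add: K_def)
    also have "\<dots> = S.nm (S.df (\<lambda>n. x N) x)"
      using x \<eta> by (intro S.nm_cong) (simp_all add: \<pi>\<eta> const KS \<pi>K)
    also have "\<dots> \<le> e / 2"
      using N by simp
    finally show ?thesis
      using e by (intro exI[of _ "x N"]) simp
  qed
  have "cyclic_rep cmult star K \<pi>"
    unfolding cyclic_rep_def using K.hilbert_space rep \<eta> dense by (intro conjI) auto
  then show ?thesis
    using \<eta> state dense by blast
qed

end

section \<open>Lifting states to representations\<close>

text \<open>An infinite set is equinumerous with the disjoint union of two copies of itself; the two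
  summands give \<open>f\<close> and \<open>g\<close>.\<close>

lemma infinite_disjoint_copies:
  assumes "infinite E"
  shows "\<exists>f g. inj_on f E \<and> inj_on g E \<and> f ` E \<subseteq> E \<and> g ` E \<subseteq> E \<and> f ` E \<inter> g ` E = {}"
proof -
  obtain h where h: "bij_betw h (E <+> E) E"
    using card_of_Plus_infinite[OF assms card_of_refl[THEN ordIso_imp_ordLeq]] card_of_ordIso[of "E <+> E" E]
    by blast
  then have inj: "inj_on h (E <+> E)" and im: "h ` (E <+> E) = E"
    by (auto simp: bij_betw_def)
  show ?thesis
  proof (rule exI[of _ "h \<circ> Inl"], rule exI[of _ "h \<circ> Inr"], intro conjI)
    show "(h \<circ> Inl) ` E \<inter> (h \<circ> Inr) ` E = {}"
      using inj by (auto dest!: inj_onD)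
  qed (use inj im in \<open>auto simp: inj_on_def\<close>)
qed

lemma (in ips) isometry_pair_zero:
  assumes "isometry_pair H L V V'" "ips L"
  shows "V (hzero H) = hzero L"
proof -
  interpret L: ips L by fact
  show ?thesis
    by (rule L.inner_ext) (use isometry_pairD[OF assms(1)] in simp_all)
qed

lemma (in ips) isometry_pair_nm_diff:
  assumes V: "isometry_pair H L V V'" and L: "ips L" and xy: "x \<in> C" "y \<in> C"
  shows "hnorm L (hdiff L (V x) (V y)) = nm (df x y)"
proof -
  interpret L: ips L by fact
  have "L.df (V x) (V y) = V (df x y)"
    by (rule L.inner_ext) (use isometry_pairD[OF V] xy in simp_all)
  then show ?thesis
    using isometry_pair_inner[OF V, of "df x y" "df x y"] xy by (simp add: hnorm_def)
qed

context cstar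
begin

section \<open>Embedding GNS spaces into H\<close>

text \<open>\<open>\<rho> 1\<close> fixes all vectors \<open>\<rho> a \<eta>\<close>, and being
  contractive it fixes their limits.\<close>

lemma cyclic_rep_one:
  assumes "hilbert K" and "is_rep cmult star K \<rho>" and \<eta>: "\<eta> \<in> hcarrier K"
    and dense: "\<forall>x\<in>hcarrier K. \<forall>e>0. \<exists>a. hnorm K (hdiff K (\<rho> a \<eta>) x) < e"
    and x: "x \<in> hcarrier K"
  shows "\<rho> 1 x = x"
proof -
  interpret K: hilbert K by fact
  interpret K: cstar_rep cmult star K \<rho>
    by (intro cstar_rep.intro cstar_axioms K.ips_axioms cstar_rep_axioms.intro assms)
  have "K.nm (K.df (\<rho> 1 x) x) \<le> 0 + e" if e: "e > 0" for e
  proof -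
    have "e / 2 > 0"
      using e by simp
    then obtain a where a: "K.nm (K.df (\<rho> a \<eta>) x) < e / 2"
      using dense x by blast
    have in1: "\<rho> a \<eta> \<in> K.C"
      using \<eta> by simp
    have one: "\<rho> 1 (\<rho> a \<eta>) = \<rho> a \<eta>"
      using K.rep_mult[OF \<eta>, of 1 a] by simp
    have "K.nm (K.df (\<rho> 1 x) x) \<le> K.nm (K.df (\<rho> 1 x) (\<rho> a \<eta>)) + K.nm (K.df (\<rho> a \<eta>) x)"
      using x in1 by (intro K.nm_diff_triangle) auto
    also have "K.df (\<rho> 1 x) (\<rho> a \<eta>) = \<rho> 1 (K.df x (\<rho> a \<eta>))"
      using K.rep_diff[OF x in1, of 1] one by simp
    also have "K.nm (\<rho> 1 (K.df x (\<rho> a \<eta>))) \<le> K.nm (K.df x (\<rho> a \<eta>))"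
      using K.rep_nm_le[of "K.df x (\<rho> a \<eta>)" 1] x in1 by simp
    also have "K.nm (K.df x (\<rho> a \<eta>)) = K.nm (K.df (\<rho> a \<eta>) x)"
      using x in1 by (intro K.nm_diff_commute) auto
    finally show ?thesis
      using a by simp
  qed
  then have "K.nm (K.df (\<rho> 1 x) x) \<le> 0"
    by (rule field_le_epsilon)
  then have "K.nm (K.df (\<rho> 1 x) x) = 0"
    using x by (intro antisym) simp_all
  then show ?thesis
    using x by (intro K.nm_diff_eq0) auto
qed

text \<open>When \<open>H\<close> is infinite-dimensional, the representation can be placed in a subspace whose
  complement contains an isometric copy \<open>W H\<close> of the whole space.\<close>

lemma state_lift:
  assumes "hilbert H"
    and dim_ge: "\<forall>(K :: (nat \<Rightarrow> 'a) hspace) \<pi>. cyclic_rep cmult star K \<pi> \<longrightarrow> hdim_le K H"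
    and xi: "\<xi> \<in> hcarrier H" "hnorm H \<xi> = 1"
    and \<phi>: "\<phi> \<in> states cmult star"
  shows "\<exists>\<pi>. is_rep cmult star H \<pi> \<and> \<pi> 1 \<xi> = \<xi> \<and> vector_state H \<xi> \<pi> = \<phi> \<and>
      (\<forall>x\<in>hcarrier H. \<forall>e>0. \<exists>a. hnorm H (hdiff H (\<pi> a \<xi>) (\<pi> 1 x)) < e) \<and>
      ((\<nexists>E. orthonormal_basis H E \<and> finite E) \<longrightarrow>
        (\<exists>W W'. isometry_pair H H W W' \<and> (\<forall>x\<in>hcarrier H. \<pi> 1 (W x) = hzero H)))"
proof -
  interpret H: hilbert H by fact
  obtain K :: "(nat \<Rightarrow> 'a) hspace" and \<rho> \<eta> where cyc: "cyclic_rep cmult star K \<rho>" and \<eta>: "\<eta> \<in> hcarrier K"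
    and state: "\<forall>a. hinner K (\<rho> a \<eta>) \<eta> = \<phi> a"
    and dense: "\<forall>x\<in>hcarrier K. \<forall>e>0. \<exists>a. hnorm K (hdiff K (\<rho> a \<eta>) x) < e"
    using gns[OF \<phi>] by (elim exE conjE)
  interpret K: hilbert K
    using cyc by (intro hilbert_space_imp_hilbert) (simp add: cyclic_rep_def)
  interpret K: cstar_rep cmult star K \<rho>
    using cyc by (intro cstar_rep.intro cstar_axioms K.ips_axioms cstar_rep_axioms.intro)
      (simp add: cyclic_rep_def)
  have one: "\<rho> 1 x = x" if "x \<in> K.C" for x
    by (rule cyclic_rep_one[OF K.hilbert_axioms K.rep \<eta> dense that])
  have "hdim_le K H"
    by (rule dim_ge[rule_format, OF cyc])
  then obtain E1 E2 g where E1: "orthonormal_basis K E1" and E2: "orthonormal_basis H E2"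
    and g: "inj_on g E1" "g ` E1 \<subseteq> E2"
    unfolding hdim_le_def by (elim exE conjE)
  have o2: "orthonormal H E2"
    using E2 by (rule orthonormal_basis_imp_orthonormal)
  have "\<exists>V V'. isometry_pair K H V V' \<and> ((\<nexists>E. orthonormal_basis H E \<and> finite E) \<longrightarrow>
        (\<exists>W W'. isometry_pair H H W W' \<and> (\<forall>x\<in>K.C. \<forall>y\<in>H.C. H.ip (V x) (W y) = 0)))"
  proof (cases "finite E2")
    case True
    then have *: "\<exists>E. orthonormal_basis H E \<and> finite E"
      using E2 by (intro exI[of _ E2]) simp
    obtain V V' where "isometry_pair K H V V'"
      using isometry_pair_exists[OF K.hilbert_axioms H.hilbert_axioms E1 g(1) orthonormal_subset[OF o2 g(2)]]
      by (elim exE conjE)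
    then show ?thesis
      using * by (intro exI conjI impI) simp_all
  next
    case False
    \<comment> \<open>\<open>i\<close> and \<open>j\<close> place the basis into two disjoint parts
      of itself: \<open>K\<close> is embedded along \<open>i \<circ> g\<close> and the whole of
      \<open>H\<close> along \<open>j\<close>, with orthogonal ranges.\<close>
    then obtain i j where ij: "inj_on i E2" "inj_on j E2" "i ` E2 \<subseteq> E2" "j ` E2 \<subseteq> E2" "i ` E2 \<inter> j ` E2 = {}"
      using infinite_disjoint_copies by metis
    have gi: "inj_on (i \<circ> g) E1" "(i \<circ> g) ` E1 \<subseteq> E2"
      using g ij by (auto intro!: comp_inj_on intro: inj_on_subset)
    obtain V V' where V: "isometry_pair K H V V'" 
      "\<forall>x\<in>K.C. \<forall>y\<in>H.C. (\<forall>e\<in>E1. H.ip ((i \<circ> g) e) y = 0) \<longrightarrow> H.ip (V x) y = 0"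
      using isometry_pair_exists[OF K.hilbert_axioms H.hilbert_axioms E1 gi(1) orthonormal_subset[OF o2 gi(2)]]
      by (elim exE conjE)
    obtain W W' where W: "isometry_pair H H W W'" 
      "\<forall>x\<in>H.C. \<forall>y\<in>H.C. (\<forall>e\<in>E2. H.ip (j e) y = 0) \<longrightarrow> H.ip (W x) y = 0"
      using isometry_pair_exists[OF H.hilbert_axioms H.hilbert_axioms E2 ij(2) orthonormal_subset[OF o2 ij(4)]]
      by (elim exE conjE)
    have "H.ip (V x) (W y) = 0" if xy: "x \<in> K.C" "y \<in> H.C" for x y
    proof -
      have WC: "W y \<in> H.C"
        using isometry_pairD(1)[OF W(1) xy(2)] .
      have "H.ip (i (g e)) (W y) = 0" if e: "e \<in> E1" for e
      proof -
        have ge: "i (g e) \<in> E2" "i (g e) \<in> i ` E2" "i (g e) \<in> H.C"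
          using gi(2) e g(2) o2 by (auto simp: orthonormal_def)
        have "H.ip (j f) (i (g e)) = 0" if "f \<in> E2" for f
        proof -
          have "j f \<in> j ` E2"
            using that by simp
          with ij(4,5) ge(2) have "j f \<in> E2" "j f \<noteq> i (g e)"
            by - (metis subsetD, metis disjoint_iff)
          then show ?thesis
            using o2 ge by (simp add: orthonormal_def)
        qed
        then have "H.ip (W y) (i (g e)) = 0"
          using W(2) xy(2) ge by simp
        then show ?thesis
          using H.inner_cnj[OF WC ge(3)] by simp
      qed
      then show ?thesis
        using V(2) xy(1) WC by simp
    qed
    then have "\<forall>x\<in>K.C. \<forall>y\<in>H.C. H.ip (V x) (W y) = 0"
      by simp
    with V(1) W(1) show ?thesis
      by (intro exI conjI impI)
  qed
  then obtain V0 V0' where V0: "isometry_pair K H V0 V0'" 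
    and W0: "(\<nexists>E. orthonormal_basis H E \<and> finite E) \<longrightarrow>
        (\<exists>W W'. isometry_pair H H W W' \<and> (\<forall>x\<in>K.C. \<forall>y\<in>H.C. H.ip (V0 x) (W y) = 0))"
    by (elim exE conjE)
  have "K.ip \<eta> \<eta> = 1"
    using state[rule_format, of 1] one[OF \<eta>] \<phi> by (simp add: states_iff)
  then have "H.ip (V0 \<eta>) (V0 \<eta>) = 1"
    using isometry_pair_inner[OF V0 \<eta> \<eta>] by simp
  \<comment> \<open>The embedding so far knows nothing of \<open>\<xi>\<close>. As
    \<open>\<phi> 1 = 1\<close>, the image of \<open>\<eta>\<close> is a unit vector, and a
    reflection takes it to \<open>\<xi>\<close>.\<close>
  then obtain U U' where U: "unitary_pair H U U'" "U (V0 \<eta>) = \<xi>"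
    using H.reflection_exists[OF isometry_pairD(1)[OF V0 \<eta>] xi(1)] xi by (auto simp: H.inner_self)
  then have isoU: "isometry_pair H H U U'"
    by (simp add: unitary_pair_def)
  define V where "V = U \<circ> V0"
  define V' where "V' = V0' \<circ> U'"
  have V: "isometry_pair K H V V'"
    unfolding V_def V'_def by (rule isometry_pair_comp[OF V0 isoU])
  note VC = isometry_pairD(1)[OF V] and V'C = isometry_pairD(2)[OF V]
  have V\<eta>: "V \<eta> = \<xi>"
    using U by (simp add: V_def)
  then have V'\<xi>: "V' \<xi> = \<eta>"
    using isometry_pairD(4)[OF V \<eta>] by simp
  define \<pi> where "\<pi> = transport_rep H V V' \<rho>"
  have \<pi>: "is_rep cmult star H \<pi>"
    unfolding \<pi>_def by (rule is_rep_transport[OF K.ips_axioms H.ips_axioms V K.rep])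
  have \<pi>\<xi>: "\<pi> a \<xi> = V (\<rho> a \<eta>)" for a
    using xi by (simp add: \<pi>_def transport_rep_def V'\<xi>)
  have \<pi>1: "\<pi> 1 x = V (V' x)" if "x \<in> H.C" for x
    using that one V'C by (simp add: \<pi>_def transport_rep_def)
  have "\<pi> 1 \<xi> = \<xi>"
    using \<pi>\<xi> one \<eta> V\<eta> by simp
  moreover have "vector_state H \<xi> \<pi> = \<phi>"
    using isometry_pair_inner[OF V K.rep_in[OF \<eta>] \<eta>] state
    by (auto simp: vector_state_def \<pi>\<xi> V\<eta>)
  moreover have "\<exists>a. H.nm (H.df (\<pi> a \<xi>) (\<pi> 1 x)) < e" if x: "x \<in> H.C" and e: "e > 0" for x e
  proof -
    obtain a where "K.nm (K.df (\<rho> a \<eta>) (V' x)) < e"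
      using dense V'C[OF x] e by auto
    then show ?thesis
      using K.isometry_pair_nm_diff[OF V H.ips_axioms K.rep_in[OF \<eta>] V'C[OF x], of a]
      by (intro exI[of _ a]) (simp add: \<pi>\<xi> \<pi>1[OF x])
  qed
  moreover have "\<exists>W W'. isometry_pair H H W W' \<and> (\<forall>x\<in>H.C. \<pi> 1 (W x) = hzero H)"
    if inf: "\<nexists>E. orthonormal_basis H E \<and> finite E"
  proof -
    obtain W W' where W: "isometry_pair H H W W'" "\<forall>x\<in>K.C. \<forall>y\<in>H.C. H.ip (V0 x) (W y) = 0"
      using W0 inf by (elim impE exE conjE)
    \<comment> \<open>The spare copy is rotated by the same \<open>U\<close>, so that it stays
      orthogonal to the range of \<open>V\<close>.\<close>
    have iso: "isometry_pair H H (U \<circ> W) (W' \<circ> U')"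
      by (rule isometry_pair_comp[OF W(1) isoU])
    have "\<pi> 1 ((U \<circ> W) x) = hzero H" if x: "x \<in> H.C" for x
    proof -
      have in1: "U (W x) \<in> H.C" "W x \<in> H.C"
        using isometry_pairD(1)[OF iso x] isometry_pairD(1)[OF W(1) x] by simp_all
      have "V' (U (W x)) = hzero K"
      proof (rule K.inner_ext)
        fix u assume u: "u \<in> K.C"
        have "K.ip u (V' (U (W x))) = H.ip (V u) (U (W x))"
          using isometry_pairD(3)[OF V u in1(1)] by simp
        also have "\<dots> = H.ip (V0 u) (W x)"
          using isometry_pair_inner[OF isoU isometry_pairD(1)[OF V0 u] in1(2)] by (simp add: V_def)
        also have "\<dots> = 0"
          using W(2) u x by simp
        finally have "K.ip u (V' (U (W x))) = 0" .
        then show "K.ip (V' (U (W x))) u = K.ip (hzero K) u"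
          using K.inner_cnj[OF u V'C[OF in1(1)]] u by simp
      qed (use V'C in1 in auto)
      then show ?thesis
        using \<pi>1[OF in1(1)] K.isometry_pair_zero[OF V H.ips_axioms] by simp
    qed
    with iso show ?thesis
      by (intro exI conjI ballI)
  qed
  ultimately show ?thesis
    using \<pi> by (intro exI[of _ \<pi>]) simp
qed

text \<open>\<open>A\<close> lists the elements whose action on \<open>\<xi>\<close> is to be
  followed, \<open>Z\<close> the vectors that must stay nearly annihilated. Each lift is conjugated
  by a unitary fixing \<open>\<xi>\<close>, which leaves its vector state exactly
  \<open>\<psi>\<close>. \<open>F\<close> will be the neighbourhood filter of the state of
  \<open>\<pi>\<close>.\<close>

lemma nearby_lifts:
  assumes "hilbert H"
    and dim_ge: "\<forall>(K :: (nat \<Rightarrow> 'a) hspace) \<pi>. cyclic_rep cmult star K \<pi> \<longrightarrow> hdim_le K H"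
    and inf: "\<nexists>E. orthonormal_basis H E \<and> finite E"
    and xi: "\<xi> \<in> hcarrier H" "hnorm H \<xi> = 1"
    and \<pi>: "is_rep cmult star H \<pi>" "\<pi> 1 \<xi> = \<xi>"
    and lim: "\<And>a. ((\<lambda>\<psi>. \<psi> a) \<longlongrightarrow> vector_state H \<xi> \<pi> a) F"
    and ev: "eventually (\<lambda>\<psi>. \<psi> \<in> states cmult star) F"
    and A: "finite A"
    and Z: "finite Z" "Z \<subseteq> hcarrier H" "\<And>z. z \<in> Z \<Longrightarrow> \<pi> 1 z = hzero H"
  shows "\<exists>\<sigma>. (\<forall>\<psi>\<in>states cmult star. is_rep cmult star H (\<sigma> \<psi>) \<and> \<sigma> \<psi> 1 \<xi> = \<xi> \<and> vector_state H \<xi> (\<sigma> \<psi>) = \<psi>) \<and>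
      (\<forall>a\<in>A. ((\<lambda>\<psi>. hnorm H (hdiff H (\<sigma> \<psi> a \<xi>) (\<pi> a \<xi>))) \<longlongrightarrow> 0) F) \<and>
      (\<forall>z\<in>Z. ((\<lambda>\<psi>. hnorm H (\<sigma> \<psi> 1 z)) \<longlongrightarrow> 0) F)"
proof -
  interpret H: hilbert H by fact
  interpret P: cstar_rep cmult star H \<pi>
    by (intro cstar_rep.intro cstar_axioms H.ips_axioms cstar_rep_axioms.intro \<pi>)
  let ?\<phi> = "vector_state H \<xi> \<pi>"
  let ?S = "states cmult star"
  have \<phi>: "?\<phi> \<in> ?S"
    by (rule P.vector_state_in_states[OF xi \<pi>(2)])
  define good where "good \<rho> W W' \<psi> \<longleftrightarrow> is_rep cmult star H \<rho> \<and> \<rho> 1 \<xi> = \<xi> \<and> vector_state H \<xi> \<rho> = \<psi> \<and>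
      isometry_pair H H W W' \<and> (\<forall>x\<in>H.C. \<rho> 1 (W x) = hzero H)" for \<rho> W W' \<psi>
  have "\<forall>\<psi>\<in>?S. \<exists>\<rho> W W'. good \<rho> W W' \<psi>"
  proof
    fix \<psi> assume "\<psi> \<in> ?S"
    from state_lift[OF \<open>hilbert H\<close> dim_ge xi this] inf show "\<exists>\<rho> W W'. good \<rho> W W' \<psi>"
      unfolding good_def by auto
  qed
  from bchoice[OF this] obtain r0 where "\<forall>\<psi>\<in>?S. \<exists>W W'. good (r0 \<psi>) W W' \<psi>" ..
  from bchoice[OF this] obtain W0 where "\<forall>\<psi>\<in>?S. \<exists>W'. good (r0 \<psi>) (W0 \<psi>) W' \<psi>" ..
  from bchoice[OF this] obtain W0' where r0: "\<forall>\<psi>\<in>?S. good (r0 \<psi>) (W0 \<psi>) (W0' \<psi>) \<psi>" ..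
  \<comment> \<open>The unitaries are obtained for all indices at once, so functionals that are not
    states are sent to the state of \<open>\<pi>\<close>.\<close>
  define s where "s \<psi> = (if \<psi> \<in> ?S then \<psi> else ?\<phi>)" for \<psi>
  have sS: "s \<psi> \<in> ?S" for \<psi>
    using \<phi> by (simp add: s_def)
  define \<rho> where "\<rho> \<psi> = r0 (s \<psi>)" for \<psi>
  define W where "W \<psi> = W0 (s \<psi>)" for \<psi>
  define W' where "W' \<psi> = W0' (s \<psi>)" for \<psi>
  have good: "good (\<rho> \<psi>) (W \<psi>) (W' \<psi>) (s \<psi>)" for \<psi>
    using r0 sS by (simp add: \<rho>_def W_def W'_def)
  have rep: "is_rep cmult star H (\<rho> \<psi>)" and r1: "\<rho> \<psi> 1 \<xi> = \<xi>" and rs: "vector_state H \<xi> (\<rho> \<psi>) a = s \<psi> a"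
    and iso: "isometry_pair H H (W \<psi>) (W' \<psi>)" and rW: "x \<in> H.C \<Longrightarrow> \<rho> \<psi> 1 (W \<psi> x) = hzero H" for \<psi> x a
    using good[of \<psi>] unfolding good_def by auto
  have R: "cstar_rep cmult star H (\<rho> \<psi>)" for \<psi>
    by (intro cstar_rep.intro cstar_axioms H.ips_axioms cstar_rep_axioms.intro rep)
  note RC = cstar_rep.rep_in[OF R] and WC = isometry_pairD(1)[OF iso]
  have Winner: "H.ip (W \<psi> x) (W \<psi> y) = H.ip x y" if "x \<in> H.C" "y \<in> H.C" for \<psi> x y
    using isometry_pair_inner[OF iso that] .
  have rgram: "H.ip (\<rho> \<psi> a \<xi>) (\<rho> \<psi> b \<xi>) = s \<psi> (star b * a)" for \<psi> a b
    unfolding cstar_rep.rep_gram[OF R xi(1) xi(1)] using rs by (simp add: vector_state_def)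
  have rperp: "H.ip (\<rho> \<psi> a \<xi>) (W \<psi> x) = 0" if x: "x \<in> H.C" for \<psi> a x
  proof -
    have "H.ip (\<rho> \<psi> a \<xi>) (W \<psi> x) = H.ip (\<rho> \<psi> a \<xi>) (\<rho> \<psi> 1 (W \<psi> x))"
      by (simp add: cstar_rep.rep_gram[OF R xi(1) WC[OF x]])
    also have "\<dots> = 0"
      using rW[OF x] RC[OF xi(1)] by simp
    finally show ?thesis .
  qed
  have pperp: "H.ip (\<pi> a \<xi>) z = 0" if z: "z \<in> Z" for a z
    using P.rep_gram[of \<xi> z a 1] Z z xi by (simp add: subset_iff)
  have slim: "((\<lambda>\<psi>. s \<psi> a) \<longlongrightarrow> ?\<phi> a) F" for a
    using lim[of a] by (rule Lim_transform_eventually) (use ev in \<open>auto simp: s_def elim: eventually_mono\<close>)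
  \<comment> \<open>Two kinds of vectors share one Gram matrix: \<open>\<rho> \<psi> a \<xi>\<close>
    aims at \<open>\<pi> a \<xi>\<close>, and \<open>W \<psi> z\<close>, which
    \<open>\<rho> \<psi> 1\<close> kills, aims at \<open>z\<close>. Mixed entries vanish on both
    sides and those among the \<open>z\<close> agree exactly, so only values of the state have to
    converge.\<close>
  define I where "I = Inl ` A \<union> Inr ` Z"
  define t where "t i = (case i of Inl a \<Rightarrow> \<pi> a \<xi> | Inr z \<Rightarrow> z)" for i
  define u where "u i \<psi> = (case i of Inl a \<Rightarrow> \<rho> \<psi> a \<xi> | Inr z \<Rightarrow> W \<psi> z)" for i \<psi>
  have cnj0: "H.ip y x = 0" if "H.ip x y = 0" "x \<in> H.C" "y \<in> H.C" for x y
    using H.inner_cnj[OF that(2,3)] that(1) by simp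
  have \<xi>\<xi>: "H.ip \<xi> \<xi> = 1"
    using xi by (simp add: H.inner_self)
  have "\<exists>T T'. (\<forall>\<psi>. unitary_pair H (T \<psi>) (T' \<psi>) \<and> (\<forall>g\<in>{\<xi>}. T \<psi> g = g)) \<and>
           (\<forall>i\<in>I. ((\<lambda>\<psi>. H.nm (H.df (T \<psi> (u i \<psi>)) (t i))) \<longlongrightarrow> 0) F)"
  proof (rule H.unitaries_from_gram_convergence)
    show "finite I"
      using A Z by (simp add: I_def)
    show "finite {\<xi>}" "orthonormal H {\<xi>}"
      using xi \<xi>\<xi> by (auto simp: orthonormal_def)
    show "t i \<in> H.C" if "i \<in> I" for i
      using that Z xi by (auto simp: I_def t_def)
    show "u i \<psi> \<in> H.C" if "i \<in> I" for i \<psi>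
      using that Z xi RC WC by (auto simp: I_def u_def)
    show "((\<lambda>\<psi>. H.ip (u i \<psi>) (u j \<psi>)) \<longlongrightarrow> H.ip (t i) (t j)) F" if ij: "i \<in> I" "j \<in> I" for i j
    proof (cases i)
      case (Inl a)
      show ?thesis
      proof (cases j)
        fix b assume "j = Inl b"
        then show ?thesis
          using slim[of "star b * a"] xi
          by (simp add: Inl t_def u_def rgram P.rep_gram vector_state_def)
      next
        fix z assume "j = Inr z"
        then show ?thesis
          using Inl ij Z rperp pperp by (auto simp: I_def t_def u_def subset_iff)
      qed
    next
      case (Inr z)
      then have z: "z \<in> Z" "z \<in> H.C"
        using ij Z by (auto simp: I_def)
      show ?thesis
      proof (cases j)
        fix b assume "j = Inl b"
        then show ?thesis
          using cnj0[OF rperp[OF z(2)] RC[OF xi(1)] WC[OF z(2)]] cnj0[OF pperp[OF z(1)] P.rep_in[OF xi(1)] z(2)]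
          by (simp add: Inr t_def u_def)
      next
        fix y assume j: "j = Inr y"
        then have "y \<in> H.C"
          using ij Z by (auto simp: I_def)
        then show ?thesis
          using j Winner z by (simp add: Inr t_def u_def)
      qed
    qed
    show "((\<lambda>\<psi>. H.ip (u i \<psi>) g) \<longlongrightarrow> H.ip (t i) g) F" if i: "i \<in> I" and g: "g \<in> {\<xi>}" for i g
    proof (cases i)
      case (Inl a)
      then show ?thesis
        using slim[of a] rs g by (simp add: t_def u_def vector_state_def)
    next
      case (Inr z)
      then have z: "z \<in> Z" "z \<in> H.C"
        using i Z by (auto simp: I_def)
      have "H.ip (W \<psi> z) \<xi> = 0" for \<psi>
        using cnj0[OF rperp[OF z(2), where a = 1 and \<psi> = \<psi>] RC[OF xi(1)] WC[OF z(2)]] r1 by simp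
      moreover have "H.ip z \<xi> = 0"
        using cnj0[OF pperp[OF z(1), where a = 1] P.rep_in[OF xi(1)] z(2)] \<pi>(2) by simp
      ultimately show ?thesis
        using g by (simp add: Inr t_def u_def)
    qed
  qed
  then obtain T T' where T: "\<forall>\<psi>. unitary_pair H (T \<psi>) (T' \<psi>) \<and> (\<forall>g\<in>{\<xi>}. T \<psi> g = g)"
    and Tlim: "\<forall>i\<in>I. ((\<lambda>\<psi>. H.nm (H.df (T \<psi> (u i \<psi>)) (t i))) \<longlongrightarrow> 0) F"
    by (elim exE conjE)
  have isoT: "isometry_pair H H (T \<psi>) (T' \<psi>)" "isometry_pair H H (T' \<psi>) (T \<psi>)" and T\<xi>: "T \<psi> \<xi> = \<xi>" for \<psi>
    using T by (simp_all add: unitary_pair_def)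
  have T'\<xi>: "T' \<psi> \<xi> = \<xi>" for \<psi>
    using isometry_pairD(4)[OF isoT(1) xi(1), of \<psi>] T\<xi> by simp
  define \<sigma> where "\<sigma> \<psi> = transport_rep H (T \<psi>) (T' \<psi>) (\<rho> \<psi>)" for \<psi>
  have \<sigma>: "is_rep cmult star H (\<sigma> \<psi>)" for \<psi>
    unfolding \<sigma>_def by (rule is_rep_transport[OF H.ips_axioms H.ips_axioms isoT(1) rep])
  have \<sigma>\<xi>: "\<sigma> \<psi> a \<xi> = T \<psi> (\<rho> \<psi> a \<xi>)" for \<psi> a
    using xi by (simp add: \<sigma>_def transport_rep_def T'\<xi>)
  have "vector_state H \<xi> (\<sigma> \<psi>) = \<psi>" if "\<psi> \<in> ?S" for \<psi>
  proof
    fix a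
    have "H.ip (T \<psi> (\<rho> \<psi> a \<xi>)) \<xi> = H.ip (\<rho> \<psi> a \<xi>) \<xi>"
      by (simp add: isometry_pairD(3)[OF isoT(1) RC[OF xi(1)] xi(1)] T'\<xi>)
    then show "vector_state H \<xi> (\<sigma> \<psi>) a = \<psi> a"
      using rs[of \<psi> a] that by (simp add: vector_state_def \<sigma>\<xi> s_def)
  qed
  moreover have "((\<lambda>\<psi>. H.nm (H.df (\<sigma> \<psi> a \<xi>) (\<pi> a \<xi>))) \<longlongrightarrow> 0) F" if "a \<in> A" for a
    using Tlim[rule_format, of "Inl a"] that by (simp add: I_def u_def t_def \<sigma>\<xi>)
  moreover have "((\<lambda>\<psi>. H.nm (\<sigma> \<psi> 1 z)) \<longlongrightarrow> 0) F" if z: "z \<in> Z" for z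
  proof (rule tendsto_sandwich[OF _ _ tendsto_const])
    have zC: "z \<in> H.C"
      using z Z by auto
    show "((\<lambda>\<psi>. H.nm (H.df (T \<psi> (W \<psi> z)) z)) \<longlongrightarrow> 0) F"
      using Tlim[rule_format, of "Inr z"] z by (simp add: I_def u_def t_def)
    \<comment> \<open>As \<open>\<rho> \<psi> 1\<close> annihilates \<open>W \<psi> z\<close>, this
      vector may be subtracted from \<open>T' \<psi> z\<close> before contractivity is
      applied.\<close>
    have le: "H.nm (\<sigma> \<psi> 1 z) \<le> H.nm (H.df (T \<psi> (W \<psi> z)) z)" for \<psi>
    proof -
      note T'z = isometry_pairD(1)[OF isoT(2) zC, of \<psi>] and Wz = WC[OF zC, of \<psi>]
      have T'T: "T' \<psi> (T \<psi> (W \<psi> z)) = W \<psi> z"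
        using isometry_pairD(4)[OF isoT(1) Wz] .
      have TW: "T \<psi> (W \<psi> z) \<in> H.C"
        using isometry_pairD(1)[OF isoT(1) Wz] .
      have "H.nm (\<sigma> \<psi> 1 z) = H.nm (\<rho> \<psi> 1 (T' \<psi> z))"
        using isometry_pair_inner[OF isoT(1) RC[OF T'z] RC[OF T'z]] zC
        by (simp add: \<sigma>_def transport_rep_def hnorm_def)
      also have "\<rho> \<psi> 1 (T' \<psi> z) = H.df (\<rho> \<psi> 1 (T' \<psi> z)) (\<rho> \<psi> 1 (W \<psi> z))"
        by (rule H.inner_ext) (use rW[OF zC] RC[OF T'z] in simp_all)
      also have "\<dots> = \<rho> \<psi> 1 (H.df (T' \<psi> z) (W \<psi> z))"
        using cstar_rep.rep_diff[OF R T'z Wz, of \<psi> 1] by simp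
      also have "H.nm \<dots> \<le> H.nm (H.df (T' \<psi> z) (W \<psi> z))"
        using cstar_rep.rep_nm_le[OF R H.diff_in[OF T'z Wz], of \<psi> 1] by simp
      also have "\<dots> = H.nm (H.df z (T \<psi> (W \<psi> z)))"
        using H.isometry_pair_nm_diff[OF isoT(2) H.ips_axioms zC TW, of \<psi>] T'T by simp
      also have "\<dots> = H.nm (H.df (T \<psi> (W \<psi> z)) z)"
        by (rule H.nm_diff_commute[OF zC TW])
      finally show ?thesis .
    qed
    show "\<forall>\<^sub>F \<psi> in F. H.nm (\<sigma> \<psi> 1 z) \<le> H.nm (H.df (T \<psi> (W \<psi> z)) z)"
      by (intro always_eventually allI le)
    have "\<sigma> \<psi> 1 z \<in> H.C" for \<psi>
      using cstar_rep.rep_in[OF cstar_rep.intro[OF cstar_axioms H.ips_axioms cstar_rep_axioms.intro[OF \<sigma>]] zC] .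
    then show "\<forall>\<^sub>F \<psi> in F. 0 \<le> H.nm (\<sigma> \<psi> 1 z)"
      by (intro always_eventually allI H.nm_ge0)
  qed
  moreover have "\<sigma> \<psi> 1 \<xi> = \<xi>" for \<psi>
    using \<sigma>\<xi> r1 T\<xi> by simp
  ultimately show ?thesis
    using \<sigma> by (intro exI[of _ \<sigma>]) simp
qed

end

section \<open>The quotient map\<close>

lemma topspace_rep_topology:
  assumes "ips H"
  shows "topspace (rep_topology cmult star H) = reps cmult star H"
proof -
  interpret ips H by fact
  have "reps cmult star H \<in> {{\<pi> \<in> reps cmult star H. ip (\<pi> a x) y \<in> U} | a x y U. x \<in> C \<and> y \<in> C \<and> open U}"
    by (intro CollectI) (rule exI[of _ 0], rule exI[of _ "hzero H"], rule exI[of _ "hzero H"], rule exI[of _ UNIV], simp)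
  from Union_upper[OF this] show ?thesis
    unfolding rep_topology_def topology_generated_by_topspace by (intro equalityI) auto
qed

lemma openin_rep_topology:
  assumes "x \<in> hcarrier H" "y \<in> hcarrier H" "open U"
  shows "openin (rep_topology cmult star H) {\<pi> \<in> reps cmult star H. hinner H (\<pi> a x) y \<in> U}"
  unfolding rep_topology_def by (rule topology_generated_by_Basis) (use assms in auto)

lemma topspace_weak_star: "topspace (weak_star_topology cmult star) = states cmult star"
proof -
  have "{\<phi> \<in> states cmult star. \<phi> 0 \<in> UNIV} \<in> {{\<phi> \<in> states cmult star. \<phi> a \<in> U} | a U. open U}"
    by (intro CollectI) (rule exI[of _ 0], rule exI[of _ UNIV], simp)
  then show ?thesis
    unfolding weak_star_topology_def by auto
qed

lemma openin_weak_star: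
  assumes "open U"
  shows "openin (weak_star_topology cmult star) {\<phi> \<in> states cmult star. \<phi> a \<in> U}"
  unfolding weak_star_topology_def by (rule topology_generated_by_Basis) (use assms in auto)

lemma Hausdorff_weak_star: "Hausdorff_space (weak_star_topology cmult star)"
  unfolding Hausdorff_space_def topspace_weak_star
proof (intro allI impI)
  fix \<phi> \<psi> assume *: "\<phi> \<in> states cmult star \<and> \<psi> \<in> states cmult star \<and> \<phi> \<noteq> \<psi>"
  then obtain a where "\<phi> a \<noteq> \<psi> a"
    by auto
  then obtain U V where UV: "open U" "open V" "\<phi> a \<in> U" "\<psi> a \<in> V" "U \<inter> V = {}"
    using hausdorff by metis
  show "\<exists>U V. openin (weak_star_topology cmult star) U \<and> openin (weak_star_topology cmult star) V \<and>
      \<phi> \<in> U \<and> \<psi> \<in> V \<and> disjnt U V"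
    by (rule exI[of _ "{\<phi> \<in> states cmult star. \<phi> a \<in> U}"], rule exI[of _ "{\<phi> \<in> states cmult star. \<phi> a \<in> V}"])
      (use * UV openin_weak_star in \<open>auto simp: disjnt_def\<close>)
qed

lemma tendsto_nhdsin_weak_star:
  "((\<lambda>\<psi>. \<psi> a) \<longlongrightarrow> \<phi> a) (nhdsin (weak_star_topology cmult star) \<phi>)"
proof (rule topological_tendstoI)
  fix U :: "complex set" assume "open U" "\<phi> a \<in> U"
  then show "\<forall>\<^sub>F \<psi> in nhdsin (weak_star_topology cmult star) \<phi>. \<psi> a \<in> U"
    unfolding eventually_nhdsin topspace_weak_star
    using openin_weak_star[of U cmult star a] by auto
qed

lemma eventually_states_nhdsin:
  "\<forall>\<^sub>F \<psi> in nhdsin (weak_star_topology cmult star) \<phi>. \<psi> \<in> states cmult star"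
  unfolding eventually_nhdsin
  using openin_topspace[of "weak_star_topology cmult star"] topspace_weak_star[of cmult star] by auto

text \<open>Induction over the generation of the topology with \<open>\<pi>\<close> fixed: an
  intersection unites the test triples and takes the smaller tolerance.\<close>

lemma rep_topology_nbhd:
  assumes W: "openin (rep_topology cmult star H) W" and \<pi>: "\<pi> \<in> W"
  shows "\<exists>T e. finite T \<and> T \<subseteq> UNIV \<times> hcarrier H \<times> hcarrier H \<and> e > 0 \<and>
    (\<forall>\<sigma>\<in>reps cmult star H. (\<forall>(a, x, y)\<in>T. cmod (hinner H (\<sigma> a x) y - hinner H (\<pi> a x) y) < e) \<longrightarrow> \<sigma> \<in> W)"
proof -
  define P where "P W T e \<longleftrightarrow> finite T \<and> T \<subseteq> UNIV \<times> hcarrier H \<times> hcarrier H \<and> (e::real) > 0 \<and>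
    (\<forall>\<sigma>\<in>reps cmult star H. (\<forall>(a, x, y)\<in>T. cmod (hinner H (\<sigma> a x) y - hinner H (\<pi> a x) y) < e) \<longrightarrow> \<sigma> \<in> W)"
    for W T e
  have "generate_topology_on {{\<pi> \<in> reps cmult star H. hinner H (\<pi> a x) y \<in> U} | a x y U.
        x \<in> hcarrier H \<and> y \<in> hcarrier H \<and> open U} W"
    using W unfolding rep_topology_def by (rule openin_topology_generated_by)
  then have "\<exists>T e. P W T e"
    using \<pi>
  proof (induction rule: generate_topology_on.induct)
    case Empty
    then show ?case
      by simp
  next
    case (Int a b)
    then obtain T e T' e' where "P a T e" "P b T' e'"
      by auto
    then have "P (a \<inter> b) (T \<union> T') (min e e')"
      unfolding P_def by (auto simp: ball_Un)
    then show ?case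
      by blast
  next
    case (UN K)
    then obtain k T e where "k \<in> K" "P k T e"
      by (metis UnionE)
    then have "P (\<Union>K) T e"
      unfolding P_def by blast
    then show ?case
      by blast
  next
    case (Basis s)
    then obtain a x y U where s: "s = {\<pi> \<in> reps cmult star H. hinner H (\<pi> a x) y \<in> U}"
      "x \<in> hcarrier H" "y \<in> hcarrier H" "open U"
      by auto
    then have "hinner H (\<pi> a x) y \<in> U"
      using Basis by auto
    then obtain e where e: "e > 0" "ball (hinner H (\<pi> a x) y) e \<subseteq> U"
      using s(4) open_contains_ball by blast
    then have "P s {(a, x, y)} e"
      unfolding P_def s by (auto simp: s subset_iff dist_norm norm_minus_commute)
    then show ?case
      by blast
  qed
  then show ?thesis
    unfolding P_def .
qed

context cstar
begin

text \<open>The chain runs from \<open>\<sigma> a x\<close> through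
  \<open>\<sigma> a (\<pi> 1 x)\<close>, \<open>\<sigma> a (\<pi> c \<xi>)\<close>,
  \<open>\<sigma> (a * c) \<xi>\<close> and \<open>\<pi> (a * c) \<xi>\<close> to
  \<open>\<pi> a x\<close>. Replacing \<open>\<pi> 1 x\<close> by \<open>\<pi> c \<xi>\<close> is
  paid for once under \<open>\<sigma>\<close> and once under \<open>\<pi>\<close>, whence the factor
  2.\<close>

lemma matrix_coefficient_diff_le:
  assumes "ips H" and \<pi>: "is_rep cmult star H \<pi>" and \<sigma>: "is_rep cmult star H \<sigma>"
    and x: "x \<in> hcarrier H" and y: "y \<in> hcarrier H" and \<xi>: "\<xi> \<in> hcarrier H"
  shows "cmod (hinner H (\<sigma> a x) y - hinner H (\<pi> a x) y) \<le>
    (norm a * hnorm H (\<sigma> 1 (hdiff H x (\<pi> 1 x))) + 2 * norm a * hnorm H (hdiff H (\<pi> c \<xi>) (\<pi> 1 x)) +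
     norm a * hnorm H (hdiff H (\<sigma> c \<xi>) (\<pi> c \<xi>)) +
     hnorm H (hdiff H (\<sigma> (a * c) \<xi>) (\<pi> (a * c) \<xi>))) * hnorm H y"
proof -
  interpret P: cstar_rep cmult star H \<pi>
    by (intro cstar_rep.intro cstar_axioms assms cstar_rep_axioms.intro)
  interpret S: cstar_rep cmult star H \<sigma>
    by (intro cstar_rep.intro cstar_axioms assms cstar_rep_axioms.intro)
  let ?p = "\<pi> 1 x" and ?q = "\<pi> c \<xi>" and ?r = "\<sigma> c \<xi>"
  have 1: "P.nm (P.df (\<sigma> a x) (\<sigma> a ?p)) \<le> norm a * P.nm (\<sigma> 1 (P.df x ?p))"
    using S.nm_rep_le_unit_part[of "P.df x ?p" a] S.rep_diff[of x ?p a] x by simp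
  have 2: "P.nm (P.df (\<sigma> a ?p) (\<sigma> a ?q)) \<le> norm a * P.nm (P.df ?q ?p)"
    using S.rep_nm_le[of "P.df ?p ?q" a] S.rep_diff[of ?p ?q a] P.nm_diff_commute[of ?p ?q] x \<xi> by simp
  have 3: "P.nm (P.df (\<sigma> a ?q) (\<sigma> (a * c) \<xi>)) \<le> norm a * P.nm (P.df ?r ?q)"
    using S.rep_nm_le[of "P.df ?q ?r" a] S.rep_diff[of ?q ?r a] P.nm_diff_commute[of ?q ?r] x \<xi>
    by (simp add: S.rep_mult)
  have 4: "P.nm (P.df (\<pi> (a * c) \<xi>) (\<pi> a x)) \<le> norm a * P.nm (P.df ?q ?p)"
    using P.rep_nm_le[of "P.df ?q ?p" a] P.rep_diff[of ?q ?p a] x \<xi> P.rep_mult[of x a 1]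
    by (simp add: P.rep_mult)
  have "P.nm (P.df (\<sigma> a x) (\<pi> a x)) \<le> P.nm (P.df (\<sigma> a x) (\<sigma> a ?p)) + P.nm (P.df (\<sigma> a ?p) (\<pi> a x))"
    using x \<xi> by (intro P.nm_diff_triangle) auto
  also have "P.nm (P.df (\<sigma> a ?p) (\<pi> a x)) \<le> P.nm (P.df (\<sigma> a ?p) (\<sigma> a ?q)) + P.nm (P.df (\<sigma> a ?q) (\<pi> a x))"
    using x \<xi> by (intro P.nm_diff_triangle) auto
  also have "P.nm (P.df (\<sigma> a ?q) (\<pi> a x)) \<le> P.nm (P.df (\<sigma> a ?q) (\<sigma> (a * c) \<xi>)) + P.nm (P.df (\<sigma> (a * c) \<xi>) (\<pi> a x))"
    using x \<xi> by (intro P.nm_diff_triangle) auto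
  also have "P.nm (P.df (\<sigma> (a * c) \<xi>) (\<pi> a x)) \<le>
      P.nm (P.df (\<sigma> (a * c) \<xi>) (\<pi> (a * c) \<xi>)) + P.nm (P.df (\<pi> (a * c) \<xi>) (\<pi> a x))"
    using x \<xi> by (intro P.nm_diff_triangle) auto
  finally have *: "P.nm (P.df (\<sigma> a x) (\<pi> a x)) \<le> norm a * P.nm (\<sigma> 1 (P.df x ?p)) + 2 * norm a * P.nm (P.df ?q ?p) +
     norm a * P.nm (P.df ?r ?q) + P.nm (P.df (\<sigma> (a * c) \<xi>) (\<pi> (a * c) \<xi>))"
    using 1 2 3 4 by linarith
  have "cmod (P.ip (\<sigma> a x) y - P.ip (\<pi> a x) y) = cmod (P.ip (P.df (\<sigma> a x) (\<pi> a x)) y)"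
    using x y by simp
  also have "\<dots> \<le> P.nm (P.df (\<sigma> a x) (\<pi> a x)) * P.nm y"
    using x y by (intro P.cauchy_schwarz) auto
  finally show ?thesis
    using mult_right_mono[OF * P.nm_ge0[OF y]] by linarith
qed

section \<open>The quotient property\<close>

context
  fixes H :: "'v hspace" and \<xi> :: 'v
  assumes hil: "hilbert H"
    and dim_ge: "\<forall>(K :: (nat \<Rightarrow> 'a) hspace) \<pi>. cyclic_rep cmult star K \<pi> \<longrightarrow> hdim_le K H"
    and xi: "\<xi> \<in> hcarrier H" "hnorm H \<xi> = 1"
begin

interpretation H: hilbert H by (rule hil)

lemma rep_intro: "is_rep cmult star H \<pi> \<Longrightarrow> cstar_rep cmult star H \<pi>"
  by (intro cstar_rep.intro cstar_axioms H.ips_axioms cstar_rep_axioms.intro)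

abbreviation RX where "RX \<equiv> {\<pi> \<in> reps cmult star H. \<exists>\<eta>\<in>hcarrier H. \<pi> 1 \<eta> = \<xi>}"

lemma RX_iff: "\<pi> \<in> RX \<longleftrightarrow> is_rep cmult star H \<pi> \<and> \<pi> 1 \<xi> = \<xi>"
  using cstar_rep.rep_one_range_iff[OF rep_intro xi(1)] by (auto simp: reps_def)

lemma topspace_RX: "topspace (subtopology (rep_topology cmult star H) RX) = RX"
  unfolding topspace_subtopology topspace_rep_topology[OF H.ips_axioms] by auto

lemma vector_state_image: "vector_state H \<xi> ` RX = states cmult star"
proof (intro equalityI subsetI)
  fix \<phi> assume "\<phi> \<in> vector_state H \<xi> ` RX"
  then obtain \<pi> where "\<pi> \<in> RX" "\<phi> = vector_state H \<xi> \<pi>"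
    by blast
  then show "\<phi> \<in> states cmult star"
    using cstar_rep.vector_state_in_states[OF rep_intro xi] unfolding RX_iff by simp
next
  fix \<phi> assume "\<phi> \<in> states cmult star"
  from state_lift[OF hil dim_ge xi this] obtain \<pi> where "is_rep cmult star H \<pi>" "\<pi> 1 \<xi> = \<xi>" "vector_state H \<xi> \<pi> = \<phi>"
    by (elim exE conjE)
  then show "\<phi> \<in> vector_state H \<xi> ` RX"
    using RX_iff by (intro image_eqI[of _ _ \<pi>]) simp_all
qed

lemma continuous_vector_state:
  "continuous_map (subtopology (rep_topology cmult star H) RX) (weak_star_topology cmult star) (vector_state H \<xi>)"
  unfolding weak_star_topology_def
proof (rule continuous_on_generated_topo)
  show "vector_state H \<xi> ` topspace (subtopology (rep_topology cmult star H) RX)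
      \<subseteq> \<Union> {{\<phi> \<in> states cmult star. \<phi> a \<in> U} |a U. open U}"
    unfolding topspace_RX vector_state_image
    using topspace_weak_star[of cmult star] unfolding weak_star_topology_def by simp
  fix V assume "V \<in> {{\<phi> \<in> states cmult star. \<phi> a \<in> U} |a U. open U}"
  then obtain a U where V: "V = {\<phi> \<in> states cmult star. \<phi> a \<in> U}" "open U"
    by blast
  have "vector_state H \<xi> \<pi> \<in> states cmult star" if "\<pi> \<in> RX" for \<pi>
    using vector_state_image that by blast
  then have "vector_state H \<xi> -` V \<inter> RX = {\<pi> \<in> reps cmult star H. H.ip (\<pi> a \<xi>) \<xi> \<in> U} \<inter> RX"
    unfolding V(1) by (auto simp: vector_state_def)
  then show "openin (subtopology (rep_topology cmult star H) RX)
      (vector_state H \<xi> -` V \<inter> topspace (subtopology (rep_topology cmult star H) RX))"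
    unfolding topspace_RX openin_subtopology using openin_rep_topology[OF xi(1) xi(1) V(2)] by blast
qed

lemma quotient_map_infinite:
  assumes inf: "\<nexists>E. orthonormal_basis H E \<and> finite E"
  shows "quotient_map (subtopology (rep_topology cmult star H) RX) (weak_star_topology cmult star) (vector_state H \<xi>)"
  unfolding quotient_map_def topspace_RX topspace_weak_star
proof (intro conjI allI impI iffI)
  let ?Y = "weak_star_topology cmult star"
  show "vector_state H \<xi> ` RX = states cmult star"
    by (rule vector_state_image)
  fix U assume U: "U \<subseteq> states cmult star"
  {
    assume "openin ?Y U"
    then show "openin (subtopology (rep_topology cmult star H) RX) {\<pi> \<in> RX. vector_state H \<xi> \<pi> \<in> U}"
      using openin_continuous_map_preimage[OF continuous_vector_state] unfolding topspace_RX by blast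
  next
    assume "openin (subtopology (rep_topology cmult star H) RX) {\<pi> \<in> RX. vector_state H \<xi> \<pi> \<in> U}"
    then obtain W where W: "openin (rep_topology cmult star H) W" "{\<pi> \<in> RX. vector_state H \<xi> \<pi> \<in> U} = W \<inter> RX"
      unfolding openin_subtopology by blast
    have "\<exists>T. openin ?Y T \<and> \<phi> \<in> T \<and> T \<subseteq> U" if \<phi>U: "\<phi> \<in> U" for \<phi>
    proof -
      have \<phi>: "\<phi> \<in> states cmult star"
        using U \<phi>U by blast
      \<comment> \<open>An arbitrary preimage of \<open>\<phi>\<close> would not do: the density of
        the vectors \<open>\<pi> a \<xi>\<close> in the range of \<open>\<pi> 1\<close> is used
        below.\<close>
      from state_lift[OF hil dim_ge xi this] obtain \<pi>
        where \<pi>: "is_rep cmult star H \<pi>" "\<pi> 1 \<xi> = \<xi>" "vector_state H \<xi> \<pi> = \<phi>"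
        and dense: "\<forall>x\<in>H.C. \<forall>e>0. \<exists>a. H.nm (H.df (\<pi> a \<xi>) (\<pi> 1 x)) < e"
        by (elim exE conjE)
      interpret P: cstar_rep cmult star H \<pi>
        by (rule rep_intro[OF \<pi>(1)])
      have "\<pi> \<in> W"
        using W(2) \<pi> \<phi>U RX_iff by blast
      from rep_topology_nbhd[OF W(1) this] obtain T e where T: "finite T" "T \<subseteq> UNIV \<times> H.C \<times> H.C" and e: "e > 0"
        and TW: "\<forall>\<sigma>\<in>reps cmult star H. (\<forall>(a, x, y)\<in>T. cmod (H.ip (\<sigma> a x) y - H.ip (\<pi> a x) y) < e) \<longrightarrow> \<sigma> \<in> W"
        by (elim exE conjE)
      \<comment> \<open>The density error is the one term that does not tend to zero. This bound
        keeps its contribution \<open>2 * norm a * H.nm y * d t\<close> below \<open>e\<close>; the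
        \<open>+ 1\<close> avoids division by zero and makes the inequality strict.\<close>
      define d where "d t = (case t of (a, x, y) \<Rightarrow> e / (2 * norm a * H.nm y + 1))" for t :: "'a \<times> 'v \<times> 'v"
      have "\<forall>t\<in>T. \<exists>c. H.nm (H.df (\<pi> c \<xi>) (\<pi> 1 (fst (snd t)))) < d t"
      proof
        fix t assume t: "t \<in> T"
        then have "fst (snd t) \<in> H.C" "snd (snd t) \<in> H.C"
          using T by auto
        moreover from this have "d t > 0"
          using e by (auto simp: d_def split: prod.splits intro!: divide_pos_pos add_nonneg_pos)
        ultimately show "\<exists>c. H.nm (H.df (\<pi> c \<xi>) (\<pi> 1 (fst (snd t)))) < d t"
          using dense by blast
      qed
      from bchoice[OF this] obtain c where c: "\<forall>t\<in>T. H.nm (H.df (\<pi> (c t) \<xi>) (\<pi> 1 (fst (snd t)))) < d t" ..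
      \<comment> \<open>The estimate compares \<open>\<sigma> \<psi>\<close> with
        \<open>\<pi>\<close> on \<open>\<xi>\<close> at both \<open>c t\<close> and
        \<open>fst t * c t\<close>. \<open>Z\<close> collects the parts of the test vectors that
        \<open>\<pi>\<close> annihilates.\<close>
      define A where "A = c ` T \<union> (\<lambda>t. fst t * c t) ` T"
      define Z where "Z = (\<lambda>t. H.df (fst (snd t)) (\<pi> 1 (fst (snd t)))) ` T"
      let ?F = "nhdsin ?Y \<phi>"
      have "\<exists>\<sigma>. (\<forall>\<psi>\<in>states cmult star. is_rep cmult star H (\<sigma> \<psi>) \<and> \<sigma> \<psi> 1 \<xi> = \<xi> \<and> vector_state H \<xi> (\<sigma> \<psi>) = \<psi>) \<and>
          (\<forall>a\<in>A. ((\<lambda>\<psi>. H.nm (H.df (\<sigma> \<psi> a \<xi>) (\<pi> a \<xi>))) \<longlongrightarrow> 0) ?F) \<and>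
          (\<forall>z\<in>Z. ((\<lambda>\<psi>. H.nm (\<sigma> \<psi> 1 z)) \<longlongrightarrow> 0) ?F)"
      proof (rule nearby_lifts[OF hil dim_ge inf xi \<pi>(1,2)])
        show "((\<lambda>\<psi>. \<psi> a) \<longlongrightarrow> vector_state H \<xi> \<pi> a) ?F" for a
          unfolding \<pi>(3) by (rule tendsto_nhdsin_weak_star)
        show "\<forall>\<^sub>F \<psi> in ?F. \<psi> \<in> states cmult star"
          by (rule eventually_states_nhdsin)
        show "finite A" "finite Z"
          using T by (auto simp: A_def Z_def)
        have "fst (snd t) \<in> H.C" if "t \<in> T" for t
          using T that by auto
        then show "Z \<subseteq> H.C"
          by (auto simp: Z_def)
        fix z assume "z \<in> Z"
        then obtain x where x: "x \<in> H.C" "z = H.df x (\<pi> 1 x)"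
          using T by (auto simp: Z_def)
        have "\<pi> 1 z = H.df (\<pi> 1 x) (\<pi> 1 x)"
          unfolding x(2) P.rep_diff[OF x(1) P.rep_in[OF x(1)]] using P.rep_mult[OF x(1), of 1 1] by simp
        also have "\<dots> = hzero H"
          using x(1) by (intro H.inner_ext) simp_all
        finally show "\<pi> 1 z = hzero H" .
      qed
      then obtain \<sigma> where \<sigma>: "\<forall>\<psi>\<in>states cmult star. is_rep cmult star H (\<sigma> \<psi>) \<and> \<sigma> \<psi> 1 \<xi> = \<xi> \<and> vector_state H \<xi> (\<sigma> \<psi>) = \<psi>"
        and limA: "\<forall>a\<in>A. ((\<lambda>\<psi>. H.nm (H.df (\<sigma> \<psi> a \<xi>) (\<pi> a \<xi>))) \<longlongrightarrow> 0) ?F"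
        and limZ: "\<forall>z\<in>Z. ((\<lambda>\<psi>. H.nm (\<sigma> \<psi> 1 z)) \<longlongrightarrow> 0) ?F"
        by (elim exE conjE)
      have "\<forall>\<^sub>F \<psi> in ?F. \<psi> \<in> states cmult star \<longrightarrow> (\<lambda>(a, x, y). cmod (H.ip (\<sigma> \<psi> a x) y - H.ip (\<pi> a x) y) < e) t"
        if t: "t \<in> T" for t
      proof -
        obtain a x y where axy: "t = (a, x, y)"
          by (cases t)
        have x: "x \<in> H.C" and y: "y \<in> H.C"
          using t T axy by auto
        let ?b = "\<lambda>\<psi>. (norm a * H.nm (\<sigma> \<psi> 1 (H.df x (\<pi> 1 x))) + 2 * norm a * H.nm (H.df (\<pi> (c t) \<xi>) (\<pi> 1 x)) +
          norm a * H.nm (H.df (\<sigma> \<psi> (c t) \<xi>) (\<pi> (c t) \<xi>)) + H.nm (H.df (\<sigma> \<psi> (a * c t) \<xi>) (\<pi> (a * c t) \<xi>))) * H.nm y"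
        have "H.df x (\<pi> 1 x) \<in> Z" "c t \<in> A" "a * c t \<in> A"
          using t unfolding Z_def A_def by (auto simp: axy image_iff intro!: bexI[of _ "(a, x, y)"])
        then have "(?b \<longlongrightarrow> (norm a * 0 + 2 * norm a * H.nm (H.df (\<pi> (c t) \<xi>) (\<pi> 1 x)) + norm a * 0 + 0) * H.nm y) ?F"
          by (intro tendsto_intros limA[rule_format] limZ[rule_format])
        moreover have "(norm a * 0 + 2 * norm a * H.nm (H.df (\<pi> (c t) \<xi>) (\<pi> 1 x)) + norm a * 0 + 0) * H.nm y < e"
        proof -
          have "0 \<le> 2 * norm a * H.nm y"
            using y by simp
          have "H.nm (H.df (\<pi> (c t) \<xi>) (\<pi> 1 x)) \<le> e / (2 * norm a * H.nm y + 1)"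
            using c t by (auto simp: axy d_def)
          then have "2 * norm a * H.nm y * H.nm (H.df (\<pi> (c t) \<xi>) (\<pi> 1 x))
              \<le> 2 * norm a * H.nm y * (e / (2 * norm a * H.nm y + 1))"
            using y by (intro mult_left_mono) auto
          also have "\<dots> < e"
            using e \<open>0 \<le> 2 * norm a * H.nm y\<close> by (simp add: field_simps add_nonneg_pos)
          finally show ?thesis
            by (simp add: mult_ac)
        qed
        ultimately have "\<forall>\<^sub>F \<psi> in ?F. ?b \<psi> < e"
          by (rule order_tendstoD(2))
        then show ?thesis
        proof (rule eventually_mono, intro impI)
          fix \<psi> assume b: "?b \<psi> < e" and \<psi>: "\<psi> \<in> states cmult star"
          have "is_rep cmult star H (\<sigma> \<psi>)"
            using \<sigma> \<psi> by simp
          from matrix_coefficient_diff_le[OF H.ips_axioms \<pi>(1) this x y xi(1), of a "c t"] b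
          show "(\<lambda>(a, x, y). cmod (H.ip (\<sigma> \<psi> a x) y - H.ip (\<pi> a x) y) < e) t"
            by (simp add: axy)
        qed
      qed
      then have "\<forall>\<^sub>F \<psi> in ?F. \<forall>t\<in>T. \<psi> \<in> states cmult star \<longrightarrow> (\<lambda>(a, x, y). cmod (H.ip (\<sigma> \<psi> a x) y - H.ip (\<pi> a x) y) < e) t"
        using T(1) by (intro eventually_ball_finite) auto
      with eventually_states_nhdsin have "\<forall>\<^sub>F \<psi> in ?F. \<psi> \<in> U"
      proof eventually_elim
        fix \<psi> assume \<psi>: "\<psi> \<in> states cmult star"
          and near: "\<forall>t\<in>T. \<psi> \<in> states cmult star \<longrightarrow> (\<lambda>(a, x, y). cmod (H.ip (\<sigma> \<psi> a x) y - H.ip (\<pi> a x) y) < e) t"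
        have "\<sigma> \<psi> \<in> W"
          using TW \<sigma> \<psi> near by (simp add: reps_def)
        moreover have "\<sigma> \<psi> \<in> RX"
          using \<sigma> \<psi> unfolding RX_iff by simp
        ultimately show "\<psi> \<in> U"
          using W(2) \<sigma> \<psi> by force
      qed
      then show ?thesis
        unfolding eventually_nhdsin topspace_weak_star using \<phi> by blast
    qed
    then show "openin ?Y U"
      by (subst openin_subopen) blast
  }
qed

text \<open>The representations are determined by their matrix coefficients, which range over a closed
  subset of a product of discs.\<close>

lemma compact_space_RX:
  assumes E: "orthonormal_basis H E" and fin: "finite E"
  shows "compact_space (subtopology (rep_topology cmult star H) RX)"
proof -
  have EC: "E \<subseteq> H.C"
    using E by (simp add: orthonormal_basis_def)
  have expand: "H.ip x y = (\<Sum>e\<in>E. H.ip x e * H.ip e y)" if "x \<in> H.C" "y \<in> H.C" for x y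
    using H.parseval[OF E that] has_sum_finite_iff fin by (metis (no_types, lifting))
  \<comment> \<open>Contractivity bounds the coefficients of every representation by these radii.
    Coordinates outside the carrier are forced to zero, so the product over the whole type is
    compact.\<close>
  define r where "r = (\<lambda>(a::'a, x, y). if x \<in> H.C \<and> y \<in> H.C then norm a * H.nm x * H.nm y else 0)"
  define B where "B = PiE UNIV (\<lambda>i. cball (0::complex) (r i))"
  \<comment> \<open>The first relation makes each row the functional of a vector. Every relation
    involves finitely many coordinates and is therefore closed; for products this is the effect of
    the finite basis, over which \<open>ip (\<pi> b x) (\<pi> (star a) y)\<close> is
    expanded.\<close>
  define Q where "Q m \<longleftrightarrow> (\<forall>a b c x y. x \<in> H.C \<longrightarrow> y \<in> H.C \<longrightarrow>
      m (a, x, y) = (\<Sum>e\<in>E. m (a, x, e) * H.ip e y) \<and>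
      m (a + b, x, y) = m (a, x, y) + m (b, x, y) \<and>
      m (cmult c a, x, y) = c * m (a, x, y) \<and>
      m (star a, x, y) = cnj (m (a, y, x)) \<and>
      m (a * b, x, y) = (\<Sum>e\<in>E. m (b, x, e) * cnj (m (star a, y, e))) \<and>
      m (1, \<xi>, y) = H.ip \<xi> y)" for m :: "'a \<times> 'v \<times> 'v \<Rightarrow> complex"
  define M where "M = B \<inter> Collect Q"
  have cont: "continuous_on UNIV (\<lambda>m::'a \<times> 'v \<times> 'v \<Rightarrow> complex. m i)" for i
    by simp
  have "compact B"
    unfolding B_def compactin_euclidean_iff[symmetric] euclidean_product_topology[symmetric]
    by (subst compactin_PiE) auto
  moreover have "closed (Collect Q)"
    unfolding Q_def
    by (intro closed_Collect_all closed_Collect_imp open_Collect_const closed_Collect_conj closed_Collect_eq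
        continuous_intros cont)
  ultimately have M: "compact M"
    unfolding M_def by (rule compact_Int_closed)
  have "\<exists>v. v \<in> H.C \<and> (\<forall>y\<in>H.C. H.ip v y = m (a, x, y))" if m: "m \<in> M" and x: "x \<in> H.C" for m a x
  proof -
    obtain v where "v \<in> H.C" "\<forall>y\<in>H.C. H.ip v y = (\<Sum>e\<in>E. m (a, x, e) * H.ip e y)"
      using H.ex_lincomb[OF fin EC, of "\<lambda>e. m (a, x, e)"] by blast
    moreover have "m (a, x, y) = (\<Sum>e\<in>E. m (a, x, e) * H.ip e y)" if "y \<in> H.C" for y
      using m x that unfolding M_def Q_def by blast
    ultimately show ?thesis
      by (intro exI[of _ v]) simp
  qed
  then have ex: "\<forall>t\<in>M \<times> UNIV \<times> H.C. \<exists>v. v \<in> H.C \<and> (\<forall>y\<in>H.C. H.ip v y = fst t (fst (snd t), snd (snd t), y))"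
    by auto
  obtain v where v: "\<forall>t\<in>M \<times> UNIV \<times> H.C. v t \<in> H.C \<and> (\<forall>y\<in>H.C. H.ip (v t) y = fst t (fst (snd t), snd (snd t), y))"
    using bchoice[OF ex] ..
  define R where "R m a x = (if x \<in> H.C then v (m, a, x) else hzero H)" for m a x
  have RC: "R m a x \<in> H.C" and Rip: "y \<in> H.C \<Longrightarrow> H.ip (R m a x) y = m (a, x, y)"
    if "m \<in> M" "x \<in> H.C" for m a x y
    using v[rule_format, of "(m, a, x)"] that by (simp_all add: R_def)
  have R_RX: "R m \<in> RX" if m: "m \<in> M" for m
    unfolding RX_iff
  proof
    have Q: "m (a + b, x, y) = m (a, x, y) + m (b, x, y)" "m (cmult c a, x, y) = c * m (a, x, y)"
      "m (star a, x, y) = cnj (m (a, y, x))"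
      "m (a * b, x, y) = (\<Sum>e\<in>E. m (b, x, e) * cnj (m (star a, y, e)))" "m (1, \<xi>, y) = H.ip \<xi> y"
      if "x \<in> H.C" "y \<in> H.C" for a b c x y
      using m that unfolding M_def Q_def by blast+
    have bound: "cmod (m (a, x, y)) \<le> norm a * H.nm x * H.nm y" if "x \<in> H.C" "y \<in> H.C" for a x y
    proof -
      have "m (a, x, y) \<in> cball 0 (r (a, x, y))"
        using m unfolding M_def B_def by blast
      then show ?thesis
        using that by (simp add: r_def)
    qed
    show "is_rep cmult star H (R m)"
    proof (rule is_repI[OF H.ips_axioms])
      fix a b x y assume xy: "x \<in> H.C" "y \<in> H.C"
      show "H.ip (R m (star a) x) y = H.ip x (R m a y)"
        using H.cnj_inner[OF RC[OF m xy(2)] xy(1), of a] xy m by (simp add: Rip Q)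
      \<comment> \<open>The vector \<open>R m b x\<close> occurs as an index of \<open>m\<close>,
        where the product relation does not reach it. The star relation moves it into the second
        argument, and the basis expansion then applies.\<close>
      have "H.ip (R m a (R m b x)) y = m (a, R m b x, y)"
        by (simp add: Rip m RC xy)
      also have "\<dots> = cnj (m (star a, y, R m b x))"
        using Q(3)[OF RC[OF m xy(1)] xy(2), of "star a" b] by simp
      also have "\<dots> = cnj (H.ip (R m (star a) y) (R m b x))"
        by (simp add: Rip m RC xy)
      also have "\<dots> = H.ip (R m b x) (R m (star a) y)"
        by (simp add: H.cnj_inner m RC xy)
      also have "\<dots> = (\<Sum>e\<in>E. m (b, x, e) * cnj (m (star a, y, e)))"
        unfolding expand[OF RC[OF m xy(1)] RC[OF m xy(2)]]
      proof (rule sum.cong)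
        fix e assume "e \<in> E"
        then have e: "e \<in> H.C"
          using EC by blast
        show "H.ip (R m b x) e * H.ip e (R m (star a) y) = m (b, x, e) * cnj (m (star a, y, e))"
          using H.cnj_inner[OF RC[OF m xy(2)] e, of "star a"] m xy e by (simp add: Rip)
      qed simp
      finally show "H.ip (R m (a * b) x) y = H.ip (R m a (R m b x)) y"
        using Q(4)[OF xy] by (simp add: Rip m xy)
    next
      fix a
      have "H.nm (R m a x) \<le> norm a * H.nm x" if x: "x \<in> H.C" for x
      proof -
        have "H.nm (R m a x) * H.nm (R m a x) = Re (m (a, x, R m a x))"
          using H.nm_sq[OF RC[OF m x]] by (simp add: power2_eq_square Rip m RC x)
        also have "\<dots> \<le> norm a * H.nm x * H.nm (R m a x)"
          using bound[OF x RC[OF m x]] complex_Re_le_cmod order_trans by blast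
        finally show ?thesis
          using H.nm_ge0[OF RC[OF m x, of a]] H.nm_ge0[OF x]
          by (cases "H.nm (R m a x) = 0") (auto simp: mult_le_cancel_right)
      qed
      then show "\<exists>B. \<forall>x\<in>H.C. H.nm (R m a x) \<le> B * H.nm x"
        by blast
    qed (simp_all add: RC Rip Q m, simp add: R_def)
    show "R m 1 \<xi> = \<xi>"
      by (rule H.inner_ext) (simp_all add: RC Rip Q m xi)
  qed
  have surj: "\<pi> \<in> R ` M" if \<pi>: "\<pi> \<in> RX" for \<pi>
  proof -
    have rep: "is_rep cmult star H \<pi>" "\<pi> 1 \<xi> = \<xi>"
      using \<pi> RX_iff by blast+
    interpret P: cstar_rep cmult star H \<pi>
      by (rule rep_intro[OF rep(1)])
    define m where "m = (\<lambda>(a, x, y). if x \<in> H.C \<and> y \<in> H.C then H.ip (\<pi> a x) y else 0)"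
    have mxy: "m (a, x, y) = H.ip (\<pi> a x) y" if "x \<in> H.C" "y \<in> H.C" for a x y
      using that by (simp add: m_def)
    have "m \<in> B"
      unfolding B_def
    proof (intro PiE_I)
      fix i :: "'a \<times> 'v \<times> 'v"
      obtain a x y where i: "i = (a, x, y)"
        by (cases i)
      have "cmod (H.ip (\<pi> a x) y) \<le> norm a * H.nm x * H.nm y" if "x \<in> H.C" "y \<in> H.C"
      proof -
        have "cmod (H.ip (\<pi> a x) y) \<le> H.nm (\<pi> a x) * H.nm y"
          using that by (intro H.cauchy_schwarz) auto
        also have "\<dots> \<le> norm a * H.nm x * H.nm y"
          using that by (intro mult_right_mono P.rep_nm_le) auto
        finally show ?thesis .
      qed
      then show "m i \<in> cball 0 (r i)"
        by (simp add: i m_def r_def)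
    qed simp
    moreover have "Q m"
      unfolding Q_def
    proof (intro allI impI conjI)
      fix a b c x y assume xy: "x \<in> H.C" "y \<in> H.C"
      have eC: "e \<in> H.C" if "e \<in> E" for e
        using that EC by blast
      show "m (a, x, y) = (\<Sum>e\<in>E. m (a, x, e) * H.ip e y)"
        using expand[of "\<pi> a x" y] xy by (simp add: mxy eC)
      show "m (a + b, x, y) = m (a, x, y) + m (b, x, y)" "m (cmult c a, x, y) = c * m (a, x, y)"
        using xy by (simp_all add: mxy P.inner_rep_add P.inner_rep_cmult)
      show "m (star a, x, y) = cnj (m (a, y, x))"
        using xy by (simp add: mxy P.rep_star H.cnj_inner)
      have "m (a * b, x, y) = H.ip (\<pi> b x) (\<pi> (star a) y)"
        using xy by (simp add: mxy P.rep_mult P.rep_adjoint)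
      also have "\<dots> = (\<Sum>e\<in>E. m (b, x, e) * cnj (m (star a, y, e)))"
        using expand[of "\<pi> b x" "\<pi> (star a) y"] xy by (simp add: mxy eC H.cnj_inner)
      finally show "m (a * b, x, y) = (\<Sum>e\<in>E. m (b, x, e) * cnj (m (star a, y, e)))" .
      show "m (1, \<xi>, y) = H.ip \<xi> y"
        using xy xi rep by (simp add: mxy)
    qed
    ultimately have m: "m \<in> M"
      by (simp add: M_def)
    have "R m a x = \<pi> a x" for a x
    proof (cases "x \<in> H.C")
      case True
      then show ?thesis
        by (intro H.inner_ext) (simp_all add: RC Rip m mxy)
    next
      case False
      then show ?thesis
        by (simp add: R_def P.rep_off)
    qed
    then have "R m = \<pi>"
      by (intro ext)
    with m show ?thesis
      by blast
  qed
  have "continuous_map (top_of_set M) (rep_topology cmult star H) R"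
    unfolding rep_topology_def
  proof (rule continuous_on_generated_topo)
    show "R ` topspace (top_of_set M) \<subseteq> \<Union> {{\<pi> \<in> reps cmult star H. H.ip (\<pi> a x) y \<in> U} |a x y U.
        x \<in> H.C \<and> y \<in> H.C \<and> open U}"
      using topspace_rep_topology[OF H.ips_axioms, of cmult star] R_RX unfolding rep_topology_def by auto
    fix V assume "V \<in> {{\<pi> \<in> reps cmult star H. H.ip (\<pi> a x) y \<in> U} |a x y U. x \<in> H.C \<and> y \<in> H.C \<and> open U}"
    then obtain a x y U where V: "V = {\<pi> \<in> reps cmult star H. H.ip (\<pi> a x) y \<in> U}" and xy: "x \<in> H.C" "y \<in> H.C"
      and U: "open U"
      by auto
    have "R -` V \<inter> topspace (top_of_set M) = M \<inter> (\<lambda>m. m (a, x, y)) -` U"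
      using R_RX by (auto simp: V Rip xy)
    moreover have "open ((\<lambda>m::'a \<times> 'v \<times> 'v \<Rightarrow> complex. m (a, x, y)) -` U)"
      using U cont by (rule open_vimage)
    ultimately show "openin (top_of_set M) (R -` V \<inter> topspace (top_of_set M))"
      by (simp add: openin_open_Int)
  qed
  moreover have "compactin (top_of_set M) M"
    using M by simp
  ultimately have "compactin (rep_topology cmult star H) (R ` M)"
    by (intro image_compactin)
  moreover have "R ` M = RX"
    using R_RX surj by blast
  ultimately show ?thesis
    by (simp add: compact_space_subtopology)
qed

lemma quotient_map_vector_state:
  "quotient_map (subtopology (rep_topology cmult star H) RX) (weak_star_topology cmult star) (vector_state H \<xi>)"
proof (cases "\<exists>E. orthonormal_basis H E \<and> finite E")
  case True
  then obtain E where "orthonormal_basis H E" "finite E"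
    by blast
  then show ?thesis
    using topspace_RX vector_state_image topspace_weak_star[of cmult star]
    by (intro continuous_imp_quotient_map continuous_vector_state compact_space_RX Hausdorff_weak_star)
      simp_all
next
  case False
  then show ?thesis
    by (rule quotient_map_infinite)
qed

end

end

theorem mainTheorem4:
  fixes cmult :: "complex \<Rightarrow> 'a::{real_normed_algebra_1,banach} \<Rightarrow> 'a"
    and star :: "'a \<Rightarrow> 'a"
    and H :: "'h hspace"
    and \<xi> :: 'h
  assumes A: "cstar_algebra cmult star"
    and H: "hilbert_space H"
    and dim_ge: "\<forall>(K :: (nat \<Rightarrow> 'a) hspace) \<pi>. cyclic_rep cmult star K \<pi> \<longrightarrow> hdim_le K H"
    and dim_gt: "(\<exists>n::nat. \<forall>(K :: (nat \<Rightarrow> 'a) hspace) \<pi>. cyclic_rep cmult star K \<pi> \<longrightarrow> hdim_le_nat K n)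
                 \<longrightarrow> (\<forall>(K :: (nat \<Rightarrow> 'a) hspace) \<pi>. cyclic_rep cmult star K \<pi> \<longrightarrow> \<not> hdim_le H K)"
    and xi: "\<xi> \<in> hcarrier H" "hnorm H \<xi> = 1"
  shows "quotient_map
           (subtopology (rep_topology cmult star H)
              {\<pi> \<in> reps cmult star H. \<exists>\<eta>\<in>hcarrier H. \<pi> 1 \<eta> = \<xi>})
           (weak_star_topology cmult star)
           (vector_state H \<xi>)"
proof -
  interpret cstar cmult star
    using A by (rule cstar.intro)
  show ?thesis
    by (rule quotient_map_vector_state[OF hilbert_space_imp_hilbert[OF H] dim_ge xi])
qed

end
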